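(* Let $d\ge3$, let $A$ be a non-empty compact subset of $\mathbb{R}^d$ and $\eta\in(0,1)$. Then (hard obstacles) $$\lim_{u\to0}\ \sup_{\ell_*\ge0,\ 0<\varepsilon\le u2^{-\ell_*}}\ \sup_{U_0\in\mathcal{U}_{\ell_*,A}}\ \sup_{\Sigma\in\mathcal{S}_{U_0,\varepsilon,\eta}}\ \sup_{x\in A}P_x[H_\Sigma=\infty]=0,$$ and the expression under $\lim_{u\to0}$ is maximal (among all non-empty compact $A$) for $A=\{0\}$. Likewise (soft obstacles) $$\lim_{u\to0}\ \sup_{\ell_*\ge0,\ 0<\varepsilon\le u2^{-\ell_*}}\ \sup_{U_0\in\mathcal{U}_{\ell_*,A}}\ \sup_{V\in\mathcal{V}_{U_0,\varepsilon,\eta}}\ \sup_{x\in A}E_x\Big[\exp\Big\{-\int_0^\infty V(X_s)\,ds\Big\}\Big]=0,$$ and the expression under $\lim_{u\to0}$ is maximal for $A=\{0\}$.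
   Context: $|\cdot|_\infty$ is the sup-norm, $B(x,r)$ the closed sup-norm ball, $|\cdot|$ Lebesgue measure. $P_x$, $E_x$: Wiener measure and expectation for canonical Brownian motion $X$ started at $x$; $H_F=\inf\{s\ge0:X_s\in F\}$; $\tau_r=\inf\{s\ge0: |X_s-X_0|_\infty\ge r\}$. For a non-empty bounded Borel $U_0$, $U_1=\mathbb{R}^d\setminus U_0$, $\widehat\sigma_\ell(x)=|B(x,2^{-\ell})\cap U_1|/|B(x,2^{-\ell})|$ ($\ell\in\mathbb{Z}$). For integer $\ell_*\ge0$, $\mathcal{U}_{\ell_*,A}$ is the collection of non-empty bounded Borel $U_0$ with $\widehat\sigma_\ell(x)\le\frac12$ for all $x\in A$, $\ell\ge\ell_*$. For $\varepsilon>0$, $\eta\in(0,1)$: $\mathcal{S}_{U_0,\varepsilon,\eta}$ is the class of compact $\Sigma\subseteq\mathbb{R}^d$ with $P_x[H_\Sigma<\tau_\varepsilon]\ge\eta$ for all $x\in\partial U_0$; $\mathcal{V}_{U_0,\varepsilon,\eta}$ is the class of non-negative, locally bounded measurable $V$ on $\mathbb{R}^d$ with $E_x[\exp\{-\int_0^{\tau_\varepsilon}V(X_s)ds\}]\le 1-\eta$ for all $x\in\partial U_0$. *)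

theory Defs
  imports "HOL-Analysis.Analysis" "HOL-Probability.Probability"
begin

definition supn :: "real^'n \<Rightarrow> real" where
  "supn x = Max (range (\<lambda>i. \<bar>x $ i\<bar>))"

definition sball :: "real^'n \<Rightarrow> real \<Rightarrow> (real^'n) set" where
  "sball x r = {y. supn (y - x) \<le> r}"

definition sigma_hat :: "(real^'n) set \<Rightarrow> int \<Rightarrow> real^'n \<Rightarrow> real" where
  "sigma_hat U0 l x =
     measure lebesgue (sball x (2 powr (- real_of_int l)) \<inter> (UNIV - U0))
     / measure lebesgue (sball x (2 powr (- real_of_int l)))"

definition Ucls :: "nat \<Rightarrow> (real^'n) set \<Rightarrow> (real^'n) set set" where
  "Ucls lstar A = {U0. U0 \<noteq> {} \<and> bounded U0 \<and> U0 \<in> sets borel \<and>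
      (\<forall>x\<in>A. \<forall>l::int. l \<ge> int lstar \<longrightarrow> sigma_hat U0 l x \<le> 1/2)}"

text \<open>Canonical path space: continuous paths \<omega> : [0,\<infinity>) \<rightarrow> R^d, extended constantly
  to negative times (so that paths are represented by total functions).\<close>
definition paths :: "(real \<Rightarrow> real^'n) set" where
  "paths = {\<omega>. continuous_on UNIV \<omega> \<and> (\<forall>t\<le>0. \<omega> t = \<omega> 0)}"

definition path_sets :: "(real \<Rightarrow> real^'n) set set" where
  "path_sets = sigma_sets paths
     {(\<lambda>\<omega>. \<omega> t) -` B \<inter> paths | t B. t \<ge> 0 \<and> B \<in> sets (borel :: (real^'n) measure)}"

definition gauss_dens :: "real \<Rightarrow> real^'n \<Rightarrow> real" where
  "gauss_dens t y = (2 * pi * t) powr (- real CARD('n) / 2) * exp (- (norm y)\<^sup>2 / (2 * t))"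

text \<open>P is the family of Wiener measures: P x is the law of canonical Brownian motion
  started at x (finite-dimensional distributions: X_0 = x a.s., independent
  Gaussian increments).  These determine P x uniquely on path_sets.\<close>
definition is_wiener :: "(real^'n \<Rightarrow> (real \<Rightarrow> real^'n) measure) \<Rightarrow> bool" where
  "is_wiener P \<longleftrightarrow> (\<forall>x.
     prob_space (P x) \<and> space (P x) = paths \<and> sets (P x) = path_sets \<and>
     (AE \<omega> in P x. \<omega> 0 = x)) \<and>
   (\<forall>x (k::nat) (ts::nat \<Rightarrow> real).
     0 \<le> ts 0 \<and> (\<forall>i<k. ts i < ts (Suc i)) \<longrightarrow>
       prob_space.indep_vars (P x) (\<lambda>_. borel) (\<lambda>i \<omega>. \<omega> (ts (Suc i)) - \<omega> (ts i)) {..<k} \<and>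
       (\<forall>i<k. distributed (P x) lborel (\<lambda>\<omega>. \<omega> (ts (Suc i)) - \<omega> (ts i))
                 (\<lambda>y. ennreal (gauss_dens (ts (Suc i) - ts i) y))))"

definition hit :: "(real^'n) set \<Rightarrow> (real \<Rightarrow> real^'n) \<Rightarrow> ereal" where
  "hit F \<omega> = Inf {ereal s | s. 0 \<le> s \<and> \<omega> s \<in> F}"

definition tau :: "real \<Rightarrow> (real \<Rightarrow> real^'n) \<Rightarrow> ereal" where
  "tau r \<omega> = Inf {ereal s | s. 0 \<le> s \<and> supn (\<omega> s - \<omega> 0) \<ge> r}"

definition exp_neg_int :: "(real^'n \<Rightarrow> real) \<Rightarrow> ereal \<Rightarrow> (real \<Rightarrow> real^'n) \<Rightarrow> real" where
  "exp_neg_int V T \<omega> =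
     (let I = (\<integral>\<^sup>+ s. indicator {s. 0 \<le> s \<and> ereal s < T} s * ennreal (V (\<omega> s)) \<partial>lborel)
      in if I = \<infinity> then 0 else exp (- enn2real I))"

definition Scls :: "(real^'n \<Rightarrow> (real \<Rightarrow> real^'n) measure) \<Rightarrow> (real^'n) set \<Rightarrow> real \<Rightarrow> real
                     \<Rightarrow> (real^'n) set set" where
  "Scls P U0 \<epsilon> \<eta> = {\<Sigma>. compact \<Sigma> \<and>
     (\<forall>x\<in>frontier U0. measure (P x) {\<omega>\<in>space (P x). hit \<Sigma> \<omega> < tau \<epsilon> \<omega>} \<ge> \<eta>)}"

definition locally_bounded :: "(real^'n \<Rightarrow> real) \<Rightarrow> bool" where
  "locally_bounded V \<longleftrightarrow> (\<forall>K. compact K \<longrightarrow> bounded (V ` K))"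

definition Vcls :: "(real^'n \<Rightarrow> (real \<Rightarrow> real^'n) measure) \<Rightarrow> (real^'n) set \<Rightarrow> real \<Rightarrow> real
                     \<Rightarrow> (real^'n \<Rightarrow> real) set" where
  "Vcls P U0 \<epsilon> \<eta> = {V. (\<forall>y. 0 \<le> V y) \<and> locally_bounded V \<and> V \<in> borel_measurable borel \<and>
     (\<forall>x\<in>frontier U0. (\<integral>\<omega>. exp_neg_int V (tau \<epsilon> \<omega>) \<omega> \<partial>P x) \<le> 1 - \<eta>)}"

definition hard_sup :: "(real^'n \<Rightarrow> (real \<Rightarrow> real^'n) measure) \<Rightarrow> real \<Rightarrow> (real^'n) set \<Rightarrow> real \<Rightarrow> ereal" where
  "hard_sup P \<eta> A u = (SUP (lstar, \<epsilon>, U0, \<Sigma>, x) \<in>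
      {(lstar, \<epsilon>, U0, \<Sigma>, x). 0 < \<epsilon> \<and> \<epsilon> \<le> u * 2 powr (- real lstar) \<and>
         U0 \<in> Ucls lstar A \<and> \<Sigma> \<in> Scls P U0 \<epsilon> \<eta> \<and> x \<in> A}.
      ereal (measure (P x) {\<omega>\<in>space (P x). hit \<Sigma> \<omega> = \<infinity>}))"

definition soft_sup :: "(real^'n \<Rightarrow> (real \<Rightarrow> real^'n) measure) \<Rightarrow> real \<Rightarrow> (real^'n) set \<Rightarrow> real \<Rightarrow> ereal" where
  "soft_sup P \<eta> A u = (SUP (lstar, \<epsilon>, U0, V, x) \<in>
      {(lstar, \<epsilon>, U0, V, x). 0 < \<epsilon> \<and> \<epsilon> \<le> u * 2 powr (- real lstar) \<and>
         U0 \<in> Ucls lstar A \<and> V \<in> Vcls P U0 \<epsilon> \<eta> \<and> x \<in> A}.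
      ereal (\<integral>\<omega>. exp_neg_int V \<infinity> \<omega> \<partial>P x))"

end

theory Submission
  imports Defs
begin

text \<open>
  Write \<open>\<sigma>\<^sub>r(x)\<close> for the proportion of \<open>B(x,r)\<close> outside \<open>U\<^sub>0\<close>.

  \<^item> Trial: if \<open>\<sigma>\<^sub>r(z)\<close> is bounded away from \<open>0\<close> and \<open>1\<close> and \<open>r \<ge> \<epsilon>\<close>, then Brownian motion from \<open>z\<close>
    crosses \<open>\<partial>U\<^sub>0\<close>, and is then killed by the obstacle, before leaving \<open>B(z,Cr)\<close>, with probability at
    least some \<open>c > 0\<close>.
  \<^item> Resonance: if this holds at \<open>z\<close> for \<open>j\<close> well separated scales, performing the trials from the
    smallest scale upwards bounds the survival probability from \<open>z\<close> by \<open>(1 - c)\<^sup>j\<close>.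
  \<^item> Halving: suppose \<open>\<sigma>\<^sub>r(x) \<le> 1/2\<close> at \<open>2m\<close> separated scales. As \<open>U\<^sub>0\<close> is bounded, for each of them
    there is a first time \<open>T\<^sub>r\<close> with \<open>\<sigma>\<^sub>r(X) = 1/2\<close>. Let \<open>\<tau>\<close> be the time when \<open>m\<close> of the \<open>T\<^sub>r\<close> have
    occurred. The other scales still have density at most \<open>1/2\<close> at \<open>X\<^sub>\<tau>\<close>, so the
    argument can be restarted there. For each \<open>T\<^sub>r \<le> \<tau>\<close> either \<open>X\<close> has not moved farther than \<open>Cr\<close> during
    \<open>[T\<^sub>r,\<tau>]\<close>, or a whole trial at scale \<open>r\<close> took place before \<open>\<tau>\<close>. If a positive proportion of scales are
    of the first kind, \<open>X\<^sub>\<tau>\<close> is a resonance point; otherwise, by averaging over the scales, the process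
    is killed before \<open>\<tau>\<close> with a probability bounded from below.

  Iterating the last step makes the survival probability arbitrarily small as the number of available
  scales between \<open>\<epsilon>\<close> and \<open>2\<^sup>-\<^sup>\<ell>\<close> grows.
\<close>

section \<open>Path space\<close>

text \<open>Trials at different scales overlap in time and are strongly dependent. The halving step
  therefore multiplies nothing: it adds expectations over the scales, and since at least
  \<open>m\<close> of the \<open>2 * m\<close> trials have started by \<open>\<tau>\<close>, a loss
  \<open>c\<close> per trial still gives a loss \<open>c / 4\<close> overall. Factors are multiplied
  only at a resonance point, where separation of the scales makes the trials successive. If
  \<open>a\<close> bounds survival from \<open>m\<close> scales, the step yields
  \<open>(1 - c / 4) * a + \<rho>\<close>, and \<open>\<rho>\<close> is made small compared with
  \<open>a\<close> by taking \<open>m\<close> large; so each round gains a fixed factor.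

  All constants must be uniform in the set, the obstacle, the scale and the starting point. Brownian
  scaling and translation invariance provide this, and one abstract submultiplicative weight treats
  hard and soft obstacles together. As \<open>P\<close> is specified by its finite-dimensional laws
  alone, uniqueness of the Wiener law, its invariances and the strong Markov property have to come
  first.\<close>

definition pathM :: "(real \<Rightarrow> real^'n) measure" where
  "pathM = sigma paths {(\<lambda>\<omega>. \<omega> t) -` B \<inter> paths | t B. t \<ge> 0 \<and> B \<in> sets (borel :: (real^'n) measure)}"

lemma space_pathM [simp]: "space pathM = paths"
  unfolding pathM_def by (rule space_measure_of) auto

text \<open>\<open>path_sets\<close> is a bare family of sets. Wrapped as a measure space it can
  serve as source and target of \<open>measurable\<close>, and whatever is measurable for
  \<open>pathM\<close> is measurable for every \<open>P x\<close>.\<close>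

lemma sets_pathM: "sets pathM = path_sets"
  unfolding pathM_def path_sets_def by (rule sets_measure_of) auto

lemma pathsD:
  assumes "\<omega> \<in> paths"
  shows "continuous_on UNIV \<omega>" "t \<le> 0 \<Longrightarrow> \<omega> t = \<omega> 0" "isCont \<omega> t"
proof -
  show c: "continuous_on UNIV \<omega>" and "t \<le> 0 \<Longrightarrow> \<omega> t = \<omega> 0" using assms unfolding paths_def by blast+
  show "isCont \<omega> t" using c by (simp add: continuous_on_eq_continuous_at)
qed

lemma paths_max: "\<omega> \<in> paths \<Longrightarrow> \<omega> (max t 0) = \<omega> t"
  using pathsD(2)[of \<omega> t] by (cases "t \<le> 0") (simp_all add: max_def)

text \<open>The generators involve only \<open>t \<ge> 0\<close>; a negative time is moved to
  \<open>0\<close>, where a path in \<open>paths\<close> has the same value.\<close>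

lemma coord_measurable: "(\<lambda>\<omega>. \<omega> t) \<in> borel_measurable (pathM :: (real \<Rightarrow> real^'n) measure)"
proof -
  have "(\<lambda>\<omega>. \<omega> (max t 0)) \<in> borel_measurable (pathM :: (real \<Rightarrow> real^'n) measure)"
  proof (rule measurableI)
    fix A :: "(real^'n) set" assume "A \<in> sets borel"
    then show "(\<lambda>\<omega>. \<omega> (max t 0)) -` A \<inter> space pathM \<in> sets pathM"
      unfolding sets_pathM path_sets_def space_pathM
      by (intro sigma_sets.Basic CollectI exI[of _ "max t 0"] exI[of _ A]) auto
  qed auto
  then show ?thesis
    by (subst measurable_cong[where g="\<lambda>\<omega>. \<omega> (max t 0)"]) (auto simp: paths_max)
qed

text \<open>Measurability of a path-valued map is tested on single coordinates. Stopping, shifting,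
  recentring, translating and scaling are all treated through this criterion.\<close>

lemma measurable_pathM:
  fixes f :: "'a \<Rightarrow> real \<Rightarrow> real^'n"
  assumes "\<And>x. x \<in> space N \<Longrightarrow> f x \<in> paths"
    and "\<And>t. t \<ge> 0 \<Longrightarrow> (\<lambda>x. f x t) \<in> borel_measurable N"
  shows "f \<in> measurable N pathM"
  unfolding pathM_def
proof (rule measurable_measure_of)
  fix y :: "(real \<Rightarrow> real^'n) set"
  assume "y \<in> {(\<lambda>\<omega>. \<omega> t) -` B \<inter> paths | t B. t \<ge> 0 \<and> B \<in> sets (borel :: (real^'n) measure)}"
  then obtain t B where y: "y = (\<lambda>\<omega>. \<omega> t) -` B \<inter> paths" "t \<ge> 0" "B \<in> sets (borel :: (real^'n) measure)"
    by auto
  have "f -` y \<inter> space N = (\<lambda>x. f x t) -` B \<inter> space N"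
    using y assms(1) by auto
  then show "f -` y \<inter> space N \<in> sets N"
    using measurable_sets[OF assms(2)[OF y(2)] y(3)] by simp
qed (use assms in auto)

text \<open>By continuity a path is the limit of its values at the grid times
  \<open>\<lfloor>(n + 1) * t\<rfloor> / (n + 1)\<close>. These times take countably many values,
  which reduces joint measurability to that of single coordinates.\<close>

lemma coord_measurable_pair:
  "(\<lambda>(t, \<omega>). \<omega> t) \<in> borel_measurable ((borel :: real measure) \<Otimes>\<^sub>M (pathM :: (real \<Rightarrow> real^'n) measure))"
proof (rule borel_measurable_LIMSEQ_metric)
  let ?M = "(borel :: real measure) \<Otimes>\<^sub>M (pathM :: (real \<Rightarrow> real^'n) measure)"
  fix n :: nat
  have 1: "(\<lambda>p. \<lfloor>real (Suc n) * fst p\<rfloor>) \<in> measurable ?M (count_space UNIV)"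
    by measurable
  have 2: "(\<lambda>p. (snd p) (real_of_int i / real (Suc n))) \<in> borel_measurable ?M" for i :: int
    by (rule measurable_compose[OF measurable_snd coord_measurable])
  show "(\<lambda>p. (snd p) (real_of_int \<lfloor>real (Suc n) * fst p\<rfloor> / real (Suc n))) \<in> borel_measurable ?M"
    by (rule measurable_compose_countable[where f="\<lambda>i p. (snd p) (real_of_int i / real (Suc n))", OF 2 1])
next
  fix p assume "p \<in> space ((borel :: real measure) \<Otimes>\<^sub>M (pathM :: (real \<Rightarrow> real^'n) measure))"
  then obtain t :: real and \<omega> where p: "p = (t, \<omega>)" "\<omega> \<in> paths"
    by (auto simp: space_pair_measure)
  have *: "(\<lambda>n. real_of_int \<lfloor>real (Suc n) * t\<rfloor> / real (Suc n)) \<longlonglongrightarrow> t"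
  proof (rule tendsto_sandwich[where f="\<lambda>n. t - 1 / real (Suc n)" and h="\<lambda>n. t"])
    show "\<forall>\<^sub>F n in sequentially. t - 1 / real (Suc n) \<le> real_of_int \<lfloor>real (Suc n) * t\<rfloor> / real (Suc n)"
    proof (intro always_eventually allI)
      fix n
      have "real (Suc n) * t - 1 \<le> real_of_int \<lfloor>real (Suc n) * t\<rfloor>" by linarith
      then have "(real (Suc n) * t - 1) / real (Suc n) \<le> real_of_int \<lfloor>real (Suc n) * t\<rfloor> / real (Suc n)"
        by (intro divide_right_mono) auto
      then show "t - 1 / real (Suc n) \<le> real_of_int \<lfloor>real (Suc n) * t\<rfloor> / real (Suc n)"
        by (simp add: diff_divide_distrib del: of_nat_Suc)
    qed
    show "\<forall>\<^sub>F n in sequentially. real_of_int \<lfloor>real (Suc n) * t\<rfloor> / real (Suc n) \<le> t"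
    proof (intro always_eventually allI)
      fix n
      have "real_of_int \<lfloor>real (Suc n) * t\<rfloor> \<le> real (Suc n) * t" by linarith
      then show "real_of_int \<lfloor>real (Suc n) * t\<rfloor> / real (Suc n) \<le> t"
        by (simp add: pos_divide_le_eq mult.commute del: of_nat_Suc)
    qed
    show "(\<lambda>n. t - 1 / real (Suc n)) \<longlonglongrightarrow> t"
      using tendsto_diff[OF tendsto_const[of t] LIMSEQ_inverse_real_of_nat]
      by (simp add: inverse_eq_divide)
  qed auto
  show "(\<lambda>n. (snd p) (real_of_int \<lfloor>real (Suc n) * fst p\<rfloor> / real (Suc n))) \<longlonglongrightarrow> (case p of (t, \<omega>) \<Rightarrow> \<omega> t)"
    using isCont_tendsto_compose[OF pathsD(3)[OF p(2)] *] p by simp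
qed

lemma measurable_eval:
  assumes "W \<in> measurable N (pathM :: (real \<Rightarrow> real^'n) measure)" "T \<in> borel_measurable N"
  shows "(\<lambda>x. W x (T x)) \<in> borel_measurable N"
  using measurable_compose[OF measurable_Pair[OF assms(2,1)] coord_measurable_pair] by simp

section \<open>Stopped, shifted and recentred paths\<close>

definition stop_path :: "real \<Rightarrow> (real \<Rightarrow> real^'n) \<Rightarrow> real \<Rightarrow> real^'n" where
  "stop_path t \<omega> = (\<lambda>s. \<omega> (min s t))"

text \<open>\<open>max s 0\<close> makes the shifted path constant on negative times, as
  \<open>paths\<close> requires. \<open>incr\<close> does the same and also recentres at the origin,
  so that it becomes independent of the past.\<close>

definition pshift :: "real \<Rightarrow> (real \<Rightarrow> real^'n) \<Rightarrow> real \<Rightarrow> real^'n" where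
  "pshift t \<omega> = (\<lambda>s. \<omega> (t + max s 0))"

definition incr :: "real \<Rightarrow> (real \<Rightarrow> real^'n) \<Rightarrow> real \<Rightarrow> real^'n" where
  "incr t \<omega> = (\<lambda>s. \<omega> (t + max s 0) - \<omega> t)"

lemma paths_compose:
  fixes \<omega> :: "real \<Rightarrow> real^'n"
  assumes "\<omega> \<in> paths" "continuous_on UNIV f"
  shows "continuous_on UNIV (\<lambda>s. \<omega> (f s))"
  using continuous_on_compose2[OF pathsD(1)[OF assms(1)] assms(2)] by auto

lemma pathsI: "continuous_on UNIV \<omega> \<Longrightarrow> (\<And>t. t \<le> 0 \<Longrightarrow> \<omega> t = \<omega> 0) \<Longrightarrow> \<omega> \<in> paths"
  unfolding paths_def by blast

lemma stop_paths:
  assumes "\<omega> \<in> paths" shows "stop_path t \<omega> \<in> paths"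
proof (rule pathsI)
  show "continuous_on UNIV (stop_path t \<omega>)"
    unfolding stop_path_def by (rule paths_compose[OF assms]) (intro continuous_on_min continuous_on_id continuous_on_const)
  fix s :: real assume "s \<le> 0"
  then show "stop_path t \<omega> s = stop_path t \<omega> 0"
    using pathsD(2)[OF assms, of "min s t"] pathsD(2)[OF assms, of "min 0 t"] by (simp add: stop_path_def)
qed

lemma pshift_paths:
  assumes "\<omega> \<in> paths" shows "pshift t \<omega> \<in> paths"
proof (rule pathsI)
  show "continuous_on UNIV (pshift t \<omega>)"
    unfolding pshift_def
    by (rule paths_compose[OF assms]) (intro continuous_on_max continuous_on_add continuous_on_id continuous_on_const)
qed (simp add: pshift_def)

lemma incr_paths:
  assumes "\<omega> \<in> paths" shows "incr t \<omega> \<in> paths"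
proof (rule pathsI)
  show "continuous_on UNIV (incr t \<omega>)"
    unfolding incr_def
    by (intro continuous_on_diff continuous_on_const, rule paths_compose[OF assms])
      (intro continuous_on_max continuous_on_add continuous_on_id continuous_on_const)
qed (simp add: incr_def)

lemma plus_paths:
  assumes "\<omega> \<in> paths" shows "(\<lambda>s. y + \<omega> s) \<in> paths"
proof (rule pathsI)
  show "continuous_on UNIV (\<lambda>s. y + \<omega> s)"
    by (intro continuous_on_add continuous_on_const pathsD(1)[OF assms])
  show "y + \<omega> t = y + \<omega> 0" if "t \<le> 0" for t using pathsD(2)[OF assms that] by simp
qed

lemma pshift_eq_incr: "pshift t \<omega> = (\<lambda>s. \<omega> t + incr t \<omega> s)"
  by (auto simp: pshift_def incr_def)

lemma stop_measurable:
  assumes "W \<in> measurable N pathM" "T \<in> borel_measurable N"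
  shows "(\<lambda>x. stop_path (T x) (W x)) \<in> measurable N pathM"
proof (rule measurable_pathM)
  show "stop_path (T x) (W x) \<in> paths" if "x \<in> space N" for x
    using measurable_space[OF assms(1) that] by (intro stop_paths) auto
  show "(\<lambda>x. stop_path (T x) (W x) t) \<in> borel_measurable N" for t
    unfolding stop_path_def by (rule measurable_eval[OF assms(1)]) (use assms(2) in measurable)
qed

lemma pshift_measurable:
  assumes "W \<in> measurable N pathM" "T \<in> borel_measurable N"
  shows "(\<lambda>x. pshift (T x) (W x)) \<in> measurable N pathM"
proof (rule measurable_pathM)
  show "pshift (T x) (W x) \<in> paths" if "x \<in> space N" for x
    using measurable_space[OF assms(1) that] by (intro pshift_paths) auto
  show "(\<lambda>x. pshift (T x) (W x) t) \<in> borel_measurable N" for t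
    unfolding pshift_def by (rule measurable_eval[OF assms(1)]) (use assms(2) in measurable)
qed

lemma incr_measurable:
  assumes "W \<in> measurable N pathM" "T \<in> borel_measurable N"
  shows "(\<lambda>x. incr (T x) (W x)) \<in> measurable N pathM"
proof (rule measurable_pathM)
  show "incr (T x) (W x) \<in> paths" if "x \<in> space N" for x
    using measurable_space[OF assms(1) that] by (intro incr_paths) auto
  have [measurable]: "(\<lambda>x. W x (T x + max t 0)) \<in> borel_measurable N"  "(\<lambda>x. W x (T x)) \<in> borel_measurable N" for t
    by (rule measurable_eval[OF assms(1)]; use assms(2) in measurable)+
  show "(\<lambda>x. incr (T x) (W x) t) \<in> borel_measurable N" for t
    unfolding incr_def by measurable
qed

lemma plus_measurable:
  fixes W :: "'a \<Rightarrow> real \<Rightarrow> real^'n"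
  assumes "W \<in> measurable N pathM" "Y \<in> borel_measurable N"
  shows "(\<lambda>x. (\<lambda>s. Y x + W x s)) \<in> measurable N pathM"
proof (rule measurable_pathM)
  show "(\<lambda>s. Y x + W x s) \<in> paths" if "x \<in> space N" for x
    using measurable_space[OF assms(1) that] by (intro plus_paths) auto
  have [measurable]: "(\<lambda>x. W x t) \<in> borel_measurable N" for t
    by (rule measurable_compose[OF assms(1) coord_measurable])
  show "(\<lambda>x. Y x + W x t) \<in> borel_measurable N" for t
    using assms(2) by measurable
qed

section \<open>First times\<close>

definition agree :: "real \<Rightarrow> (real \<Rightarrow> real^'n) \<Rightarrow> (real \<Rightarrow> real^'n) \<Rightarrow> bool" where
  "agree t \<omega> \<omega>' \<longleftrightarrow> (\<forall>s\<in>{0..t}. \<omega> s = \<omega>' s)"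

text \<open>Real-valued: on a path outside \<open>happens \<Phi>\<close> this is the meaningless
  number \<open>Inf {}\<close>, hence the constant restriction to \<open>happens\<close> in what
  follows.\<close>

definition first_time :: "(real \<Rightarrow> (real \<Rightarrow> real^'n) \<Rightarrow> bool) \<Rightarrow> (real \<Rightarrow> real^'n) \<Rightarrow> real" where
  "first_time \<Phi> \<omega> = Inf {t. 0 \<le> t \<and> \<Phi> t \<omega>}"

definition happens :: "(real \<Rightarrow> (real \<Rightarrow> real^'n) \<Rightarrow> bool) \<Rightarrow> (real \<Rightarrow> real^'n) set" where
  "happens \<Phi> = {\<omega>\<in>paths. \<exists>t\<ge>0. \<Phi> t \<omega>}"

text \<open>\<open>\<Phi> t \<omega>\<close> is read as: the event has occurred on the path \<open>\<omega>\<close> by time \<open>t\<close>. Adaptedness is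
  expressed pathwise (Galmarini's test) instead of through a filtration.\<close>
definition progress :: "(real \<Rightarrow> (real \<Rightarrow> real^'n) \<Rightarrow> bool) \<Rightarrow> bool" where
  "progress \<Phi> \<longleftrightarrow>
     (\<forall>\<omega>\<in>paths. \<forall>s t. 0 \<le> s \<longrightarrow> s \<le> t \<longrightarrow> \<Phi> s \<omega> \<longrightarrow> \<Phi> t \<omega>) \<and>
     (\<forall>\<omega>\<in>paths. \<forall>t\<ge>0. (\<forall>s>t. \<Phi> s \<omega>) \<longrightarrow> \<Phi> t \<omega>) \<and>
     (\<forall>\<omega>\<in>paths. \<forall>\<omega>'\<in>paths. \<forall>t\<ge>0. agree t \<omega> \<omega>' \<longrightarrow> \<Phi> t \<omega> \<longrightarrow> \<Phi> t \<omega>') \<and>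
     (\<forall>t\<ge>0. {\<omega>\<in>paths. \<Phi> t \<omega>} \<in> sets pathM)"

lemma agree_sym: "agree t \<omega> \<omega>' \<Longrightarrow> agree t \<omega>' \<omega>"
  by (auto simp: agree_def)

lemma agree_mono: "agree t \<omega> \<omega>' \<Longrightarrow> s \<le> t \<Longrightarrow> agree s \<omega> \<omega>'"
  by (auto simp: agree_def)

lemma agree_stop: "agree t \<omega> (stop_path t \<omega>)"
  by (auto simp: agree_def stop_path_def min_def)

lemma progressD:
  assumes "progress \<Phi>" "\<omega> \<in> paths"
  shows "0 \<le> s \<Longrightarrow> s \<le> t \<Longrightarrow> \<Phi> s \<omega> \<Longrightarrow> \<Phi> t \<omega>"
    and "t \<ge> 0 \<Longrightarrow> (\<And>s. s > t \<Longrightarrow> \<Phi> s \<omega>) \<Longrightarrow> \<Phi> t \<omega>"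
    and "\<omega>' \<in> paths \<Longrightarrow> t \<ge> 0 \<Longrightarrow> agree t \<omega> \<omega>' \<Longrightarrow> \<Phi> t \<omega> \<longleftrightarrow> \<Phi> t \<omega>'"
  using assms agree_sym[of t \<omega> \<omega>'] unfolding progress_def by blast+

lemma progress_sets: "progress \<Phi> \<Longrightarrow> t \<ge> 0 \<Longrightarrow> {\<omega>\<in>paths. \<Phi> t \<omega>} \<in> sets pathM"
  unfolding progress_def by blast

lemma first_time_nonneg:
  assumes "\<omega> \<in> happens \<Phi>"
  shows "0 \<le> first_time \<Phi> \<omega>"
  unfolding first_time_def using assms by (intro cInf_greatest) (auto simp: happens_def)

text \<open>Right-closedness of a \<open>progress\<close> event makes the infimum attained; without
  it only a strict inequality could be compared with \<open>\<Phi> t \<omega>\<close>.\<close>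

lemma first_time_le_iff:
  assumes "progress \<Phi>" "\<omega> \<in> happens \<Phi>" "0 \<le> t"
  shows "first_time \<Phi> \<omega> \<le> t \<longleftrightarrow> \<Phi> t \<omega>"
proof
  have bdd: "bdd_below {t. 0 \<le> t \<and> \<Phi> t \<omega>}" by (auto intro: bdd_belowI[of _ 0])
  show "\<Phi> t \<omega> \<Longrightarrow> first_time \<Phi> \<omega> \<le> t"
    unfolding first_time_def using assms(3) by (intro cInf_lower bdd) auto
  assume le: "first_time \<Phi> \<omega> \<le> t"
  have w: "\<omega> \<in> paths" using assms(2) by (auto simp: happens_def)
  show "\<Phi> t \<omega>"
  proof (rule progressD(2)[OF assms(1) w assms(3)])
    fix s assume "s > t"
    then have "first_time \<Phi> \<omega> < s" using le by simp
    moreover have "{t. 0 \<le> t \<and> \<Phi> t \<omega>} \<noteq> {}" using assms(2) by (auto simp: happens_def)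
    ultimately obtain r where "0 \<le> r" "\<Phi> r \<omega>" "r < s"
      unfolding first_time_def by (auto simp: cInf_less_iff[OF _ bdd])
    then show "\<Phi> s \<omega>" using progressD(1)[OF assms(1) w, of r s] by auto
  qed
qed

lemma first_time_occurs:
  assumes "progress \<Phi>" "\<omega> \<in> happens \<Phi>"
  shows "\<Phi> (first_time \<Phi> \<omega>) \<omega>"
  using first_time_le_iff[OF assms, of "first_time \<Phi> \<omega>"] first_time_nonneg[OF assms(2)] by simp

lemma happens_measurable:
  assumes "progress \<Phi>" shows "happens \<Phi> \<in> sets pathM"
proof -
  have "happens \<Phi> = (\<Union>n::nat. {\<omega>\<in>paths. \<Phi> (real n) \<omega>})"
  proof (intro set_eqI iffI)
    fix \<omega> assume "\<omega> \<in> happens \<Phi>"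
    then obtain t where t: "\<omega> \<in> paths" "t \<ge> 0" "\<Phi> t \<omega>" by (auto simp: happens_def)
    obtain n :: nat where "t \<le> real n" using real_arch_simple by blast
    then show "\<omega> \<in> (\<Union>n::nat. {\<omega>\<in>paths. \<Phi> (real n) \<omega>})" using t progressD(1)[OF assms t(1,2)] by auto
  next
    fix \<omega> assume "\<omega> \<in> (\<Union>n::nat. {\<omega>\<in>paths. \<Phi> (real n) \<omega>})"
    then obtain n :: nat where "\<omega> \<in> paths" "\<Phi> (real n) \<omega>" by blast
    then show "\<omega> \<in> happens \<Phi>" unfolding happens_def by (intro CollectI conjI exI[of _ "real n"]) auto
  qed
  moreover have "(\<Union>n::nat. {\<omega>\<in>paths. \<Phi> (real n) \<omega>}) \<in> sets pathM"
    by (intro sets.countable_nat_UN) (auto intro: progress_sets[OF assms])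
  ultimately show ?thesis by simp
qed

lemma first_time_measurable:
  assumes "progress \<Phi>"
  shows "first_time \<Phi> \<in> borel_measurable pathM"
proof (rule borel_measurable_iff_le[THEN iffD2], rule allI)
  fix a
  \<comment> \<open>Outside \<open>happens \<Phi>\<close> the value is the constant
    \<open>Inf {}\<close>, so that part of the sublevel set is everything or nothing.\<close>
  have "{w \<in> space pathM. first_time \<Phi> w \<le> a} =
     (if 0 \<le> a then happens \<Phi> \<inter> {w\<in>paths. \<Phi> a w} else {}) \<union> (if Inf {} \<le> a then space pathM - happens \<Phi> else {})"
  proof (intro set_eqI)
    fix w
    show "w \<in> {w \<in> space pathM. first_time \<Phi> w \<le> a} \<longleftrightarrow> w \<in> (if 0 \<le> a then happens \<Phi> \<inter> {w\<in>paths. \<Phi> a w} else {}) \<union> (if Inf {} \<le> a then space pathM - happens \<Phi> else {})"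
    proof (cases "w \<in> happens \<Phi>")
      case True
      then show ?thesis using first_time_nonneg[OF True] first_time_le_iff[OF assms True, of a]
        by (auto simp: happens_def)
    next
      case False
      then have "w \<in> paths \<Longrightarrow> {t. 0 \<le> t \<and> \<Phi> t w} = {}" by (auto simp: happens_def)
      then have "w \<in> paths \<Longrightarrow> first_time \<Phi> w = Inf {}" by (simp only: first_time_def)
      then show ?thesis using False by (auto simp: happens_def)
    qed
  qed
  also have "\<dots> \<in> sets pathM"
    using happens_measurable[OF assms] progress_sets[OF assms, of a]
    using sets.compl_sets[of "happens \<Phi>" pathM] by (intro sets.Un) (auto intro: sets.Int)
  finally show "{w \<in> space pathM. first_time \<Phi> w \<le> a} \<in> sets pathM" .
qed

text \<open>\<open>A\<close> is the event that the time is finite; the values of \<open>T\<close> outside \<open>A\<close> are irrelevant.\<close>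
definition stopping :: "(real \<Rightarrow> real^'n) set \<Rightarrow> ((real \<Rightarrow> real^'n) \<Rightarrow> real) \<Rightarrow> bool" where
  "stopping A T \<longleftrightarrow> A \<in> sets pathM \<and> T \<in> borel_measurable pathM \<and>
     (\<forall>\<omega>\<in>A. 0 \<le> T \<omega> \<and> (\<forall>\<omega>'\<in>paths. agree (T \<omega>) \<omega> \<omega>' \<longrightarrow> \<omega>' \<in> A \<and> T \<omega>' = T \<omega>))"

text \<open>Agreement up to the first time carries the event over to the second path, which gives
  one inequality. The second path then has its first time no later, and agreement up to there
  carries the event back.\<close>

lemma first_time_agree:
  assumes "progress \<Phi>" "\<omega> \<in> happens \<Phi>" "\<omega>' \<in> paths" "agree (first_time \<Phi> \<omega>) \<omega> \<omega>'"
  shows "\<omega>' \<in> happens \<Phi> \<and> first_time \<Phi> \<omega>' = first_time \<Phi> \<omega>"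
proof -
  let ?T = "first_time \<Phi> \<omega>"
  have w: "\<omega> \<in> paths" using assms(2) by (auto simp: happens_def)
  have 0: "0 \<le> ?T" by (rule first_time_nonneg[OF assms(2)])
  have 1: "\<Phi> ?T \<omega>'" using progressD(3)[OF assms(1) w assms(3) 0 assms(4)] first_time_occurs[OF assms(1,2)] by simp
  have h: "\<omega>' \<in> happens \<Phi>" using 1 0 assms(3) by (auto simp: happens_def)
  have le: "first_time \<Phi> \<omega>' \<le> ?T" using first_time_le_iff[OF assms(1) h 0] 1 by simp
  have 2: "0 \<le> first_time \<Phi> \<omega>'" by (rule first_time_nonneg[OF h])
  have "\<Phi> (first_time \<Phi> \<omega>') \<omega>"
    using progressD(3)[OF assms(1) w assms(3) 2 agree_mono[OF assms(4) le]] first_time_occurs[OF assms(1) h] by simp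
  then have "?T \<le> first_time \<Phi> \<omega>'" using first_time_le_iff[OF assms(1,2) 2] by simp
  with le h show ?thesis by simp
qed

lemma stopping_first_time: "progress \<Phi> \<Longrightarrow> stopping (happens \<Phi>) (first_time \<Phi>)"
  unfolding stopping_def
proof (intro conjI ballI impI)
  assume p: "progress \<Phi>"
  show "happens \<Phi> \<in> sets pathM" "first_time \<Phi> \<in> borel_measurable pathM"
    using p by (rule happens_measurable, rule first_time_measurable)
  fix \<omega> assume w: "\<omega> \<in> happens \<Phi>"
  show "0 \<le> first_time \<Phi> \<omega>" using w by (rule first_time_nonneg)
  fix \<omega>' assume w': "\<omega>' \<in> paths" "agree (first_time \<Phi> \<omega>) \<omega> \<omega>'"
  show "\<omega>' \<in> happens \<Phi>" using first_time_agree[OF p w w'] by (rule conjunct1)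
  show "first_time \<Phi> \<omega>' = first_time \<Phi> \<omega>" using first_time_agree[OF p w w'] by (rule conjunct2)
qed

section \<open>Hitting times of closed sets and exit times\<close>

definition hit_by :: "(real^'n) set \<Rightarrow> real \<Rightarrow> (real \<Rightarrow> real^'n) \<Rightarrow> bool" where
  "hit_by F t \<omega> \<longleftrightarrow> (\<exists>s\<in>{0..t}. \<omega> s \<in> F)"

text \<open>If the path avoids \<open>F\<close> on \<open>{0..t}\<close>, the open complement of
  \<open>F\<close> contains it for a little longer, so hits at times decreasing to \<open>t\<close>
  are impossible.\<close>

lemma hit_by_right:
  assumes F: "closed F" and "\<omega> \<in> paths" "t \<ge> 0" and h: "\<And>s. s > t \<Longrightarrow> hit_by F s \<omega>"
  shows "hit_by F t \<omega>"
proof (rule ccontr)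
  assume n: "\<not> hit_by F t \<omega>"
  then have "\<omega> t \<in> - F" using assms(3) by (auto simp: hit_by_def)
  moreover have "open (- F)" using F by auto
  ultimately have "\<forall>\<^sub>F s in at t. \<omega> s \<in> - F"
    using pathsD(3)[OF assms(2), of t] by (auto simp: isCont_def dest: topological_tendstoD)
  then obtain d where d: "d > 0" "\<And>s. s \<noteq> t \<Longrightarrow> dist s t < d \<Longrightarrow> \<omega> s \<notin> F"
    by (auto simp: eventually_at)
  from h[of "t + d/2"] d(1) obtain s where s: "0 \<le> s" "s \<le> t + d/2" "\<omega> s \<in> F"
    by (auto simp: hit_by_def)
  show False
  proof (cases "s \<le> t")
    case True then show False using s n by (auto simp: hit_by_def)
  next
    case False then show False using d(2)[of s] s d(1) by (auto simp: dist_real_def)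
  qed
qed

text \<open>The rationals are scaled to \<open>q * t\<close> so that the end point \<open>t\<close> is among the sampled times.\<close>
lemma hit_by_iff_rational:
  fixes \<omega> :: "real \<Rightarrow> real^'n"
  assumes F: "closed F" "F \<noteq> {}" and "\<omega> \<in> paths" "t \<ge> 0"
  shows "hit_by F t \<omega> \<longleftrightarrow> (\<forall>n::nat. \<exists>q\<in>(\<rat> \<inter> {0..1}). infdist (\<omega> (q * t)) F < 1 / real (Suc n))"
proof
  have cont: "continuous_on {0..1} (\<lambda>q. infdist (\<omega> (q * t)) F)"
    by (intro continuous_on_infdist continuous_on_compose2[OF pathsD(1)[OF assms(3)]] continuous_intros) auto
  {
    assume "hit_by F t \<omega>"
    then obtain s where s: "0 \<le> s" "s \<le> t" "\<omega> s \<in> F" by (auto simp: hit_by_def)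
    define q0 where "q0 = (if t = 0 then 0 else s / t)"
    have q0: "q0 \<in> {0..1}" "q0 * t = s" using s by (auto simp: q0_def)
    show "\<forall>n::nat. \<exists>q\<in>(\<rat> \<inter> {0..1}). infdist (\<omega> (q * t)) F < 1 / real (Suc n)"
    proof
      fix n :: nat
      have "infdist (\<omega> (q0 * t)) F < 1 / real (Suc n)" using s(3) q0(2) by simp
      moreover have "((\<lambda>q. infdist (\<omega> (q * t)) F) \<longlongrightarrow> infdist (\<omega> (q0 * t)) F) (at q0 within {0..1})"
        using cont q0 by (auto simp: continuous_on_def)
      ultimately have "\<forall>\<^sub>F q in at q0 within {0..1}. infdist (\<omega> (q * t)) F < 1 / real (Suc n)"
        by (rule order_tendstoD(2)[rotated])
      then obtain d where d: "d > 0" "\<And>q. q \<in> {0..1} \<Longrightarrow> q \<noteq> q0 \<Longrightarrow> dist q q0 < d \<Longrightarrow> infdist (\<omega> (q * t)) F < 1 / real (Suc n)"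
        by (auto simp: eventually_at)
      have "max 0 (q0 - d) < min 1 (q0 + d)" using q0(1) d(1) by auto
      then obtain q where q: "q \<in> \<rat>" "max 0 (q0 - d) < q" "q < min 1 (q0 + d)"
        using Rats_dense_in_real by blast
      then have "infdist (\<omega> (q * t)) F < 1 / real (Suc n)"
        using d(2)[of q] \<open>infdist (\<omega> (q0 * t)) F < 1 / real (Suc n)\<close>
        by (cases "q = q0") (auto simp: dist_real_def)
      then show "\<exists>q\<in>(\<rat> \<inter> {0..1}). infdist (\<omega> (q * t)) F < 1 / real (Suc n)" using q by force
    qed
  }
  assume h: "\<forall>n::nat. \<exists>q\<in>(\<rat> \<inter> {0..1}). infdist (\<omega> (q * t)) F < 1 / real (Suc n)"
  \<comment> \<open>The distance to \<open>F\<close> has a minimiser on the compact interval;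
    arbitrarily small sampled values force the minimum to be \<open>0\<close>.\<close>
  obtain q where q: "q \<in> {0..1}" "\<And>r. r \<in> {0..1} \<Longrightarrow> infdist (\<omega> (q * t)) F \<le> infdist (\<omega> (r * t)) F"
    using continuous_attains_inf[OF compact_Icc _ cont] by auto
  have "infdist (\<omega> (q * t)) F \<le> 0"
  proof (rule ccontr)
    assume "\<not> ?thesis"
    then obtain n where "inverse (real (Suc n)) < infdist (\<omega> (q * t)) F"
      using reals_Archimedean[of "infdist (\<omega> (q * t)) F"] by auto
    moreover obtain r where "r \<in> {0..1}" "infdist (\<omega> (r * t)) F < 1 / real (Suc n)" using h by blast
    ultimately show False using q(2)[of r] by (simp add: inverse_eq_divide)
  qed
  then have "\<omega> (q * t) \<in> F" using in_closed_iff_infdist_zero[OF F] infdist_nonneg[of "\<omega> (q*t)" F] by simp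
  then show "hit_by F t \<omega>" using q(1) assms(4)
    by (auto simp: hit_by_def mult_left_le_one_le intro!: bexI[of _ "q * t"])
qed

lemma hit_by_measurable:
  fixes F :: "(real^'n) set"
  assumes F: "closed F" and W: "W \<in> measurable N pathM" and "t \<ge> 0"
  shows "{x\<in>space N. hit_by F t (W x)} \<in> sets N"
proof (cases "F = {}")
  case True then show ?thesis by (simp add: hit_by_def)
next
  case False
  have *: "countable (\<rat> \<inter> {0..1::real})" by (intro countable_Int1 countable_rat)
  have [measurable]: "(\<lambda>x. W x s) \<in> borel_measurable N" for s
    by (rule measurable_compose[OF W coord_measurable])
  have [measurable]: "(\<lambda>x. infdist (W x s) F) \<in> borel_measurable N" for s
    by (rule measurable_compose[OF _ borel_measurable_continuous_onI[OF continuous_on_infdist[OF continuous_on_id]]]) measurable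
  have "{x\<in>space N. hit_by F t (W x)} =
    (\<Inter>n::nat. \<Union>q\<in>\<rat> \<inter> {0..1}. {x\<in>space N. infdist (W x (q * t)) F < 1 / real (Suc n)})" (is "?L = ?R")
  proof (intro set_eqI)
    fix x
    have "x \<in> space N \<Longrightarrow> hit_by F t (W x) \<longleftrightarrow> (\<forall>n::nat. \<exists>q\<in>\<rat> \<inter> {0..1}. infdist (W x (q * t)) F < 1 / real (Suc n))"
      using measurable_space[OF W, of x] by (intro hit_by_iff_rational[OF F False _ assms(3)]) simp
    then show "x \<in> ?L \<longleftrightarrow> x \<in> ?R" by blast
  qed
  also have "?R \<in> sets N"
  proof (rule sets.countable_INT, rule image_subsetI, intro sets.countable_UN' *)
    show "(\<lambda>q. {x \<in> space N. infdist (W x (q * t)) F < 1 / real (Suc n)}) ` (\<rat> \<inter> {0..1}) \<subseteq> sets N" for n :: nat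
      by (rule image_subsetI) measurable
  qed simp
  finally show ?thesis .
qed

lemma progressI:
  assumes "\<And>\<omega> s t. \<omega> \<in> paths \<Longrightarrow> 0 \<le> s \<Longrightarrow> s \<le> t \<Longrightarrow> \<Phi> s \<omega> \<Longrightarrow> \<Phi> t \<omega>"
    and "\<And>\<omega> t. \<omega> \<in> paths \<Longrightarrow> t \<ge> 0 \<Longrightarrow> (\<And>s. s > t \<Longrightarrow> \<Phi> s \<omega>) \<Longrightarrow> \<Phi> t \<omega>"
    and "\<And>\<omega> \<omega>' t. \<omega> \<in> paths \<Longrightarrow> \<omega>' \<in> paths \<Longrightarrow> t \<ge> 0 \<Longrightarrow> agree t \<omega> \<omega>' \<Longrightarrow> \<Phi> t \<omega> \<Longrightarrow> \<Phi> t \<omega>'"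
    and "\<And>t. t \<ge> 0 \<Longrightarrow> {\<omega>\<in>paths. \<Phi> t \<omega>} \<in> sets pathM"
  shows "progress \<Phi>"
  unfolding progress_def
proof (intro conjI ballI allI impI)
  show "\<Phi> t \<omega>" if "\<omega> \<in> paths" "0 \<le> s" "s \<le> t" "\<Phi> s \<omega>" for \<omega> s t using that by (rule assms(1))
  show "\<Phi> t \<omega>" if "\<omega> \<in> paths" "0 \<le> t" "\<forall>s>t. \<Phi> s \<omega>" for \<omega> t
    using assms(2)[OF that(1,2)] that(3) by blast
  show "\<Phi> t \<omega>'" if "\<omega> \<in> paths" "\<omega>' \<in> paths" "0 \<le> t" "agree t \<omega> \<omega>'" "\<Phi> t \<omega>" for \<omega> \<omega>' t
    using that by (rule assms(3))
  show "{\<omega>\<in>paths. \<Phi> t \<omega>} \<in> sets pathM" if "0 \<le> t" for t using that by (rule assms(4))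
qed

lemma hit_by_mono: "s \<le> t \<Longrightarrow> hit_by F s \<omega> \<Longrightarrow> hit_by F t \<omega>"
  unfolding hit_by_def by (elim bexE, rule bexI) auto

lemma hit_by_agree: "agree t \<omega> \<omega>' \<Longrightarrow> hit_by F t \<omega> \<Longrightarrow> hit_by F t \<omega>'"
  unfolding hit_by_def agree_def by (metis)

lemma progress_hit:
  assumes "closed F" shows "progress (hit_by F)"
proof (rule progressI)
  show "0 \<le> t \<Longrightarrow> {\<omega>\<in>paths. hit_by F t \<omega>} \<in> sets pathM" for t
    using hit_by_measurable[of F "\<lambda>x. x" pathM t] assms by simp
  show "hit_by F t \<omega>" if "\<omega> \<in> paths" "t \<ge> 0" "\<And>s. s > t \<Longrightarrow> hit_by F s \<omega>" for \<omega> t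
    by (rule hit_by_right[OF assms that])
  show "hit_by F t \<omega>" if "s \<le> t" "hit_by F s \<omega>" for s t \<omega>
    using that by (rule hit_by_mono)
  show "hit_by F t \<omega>'" if "agree t \<omega> \<omega>'" "hit_by F t \<omega>" for t \<omega> \<omega>'
    using that by (rule hit_by_agree)
qed

text \<open>Exits are measured from the starting point, as in \<open>tau\<close>. Expressing them as
  hits of the recentred path reuses the results on hitting and makes them translation
  invariant.\<close>

definition exit_by :: "(real^'n) set \<Rightarrow> real \<Rightarrow> (real \<Rightarrow> real^'n) \<Rightarrow> bool" where
  "exit_by F t \<omega> \<longleftrightarrow> hit_by F t (incr 0 \<omega>)"

lemma agree_incr_0: "0 \<le> t \<Longrightarrow> agree t \<omega> \<omega>' \<Longrightarrow> agree t (incr 0 \<omega>) (incr 0 \<omega>')"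
  by (simp add: agree_def incr_def)

lemma progress_exit:
  fixes F :: "(real^'n) set"
  assumes "closed F" shows "progress (exit_by F)"
proof (rule progressI)
  have "(\<lambda>x. incr 0 x) \<in> measurable pathM (pathM :: (real \<Rightarrow> real^'n) measure)"
    by (rule incr_measurable) auto
  then show "0 \<le> t \<Longrightarrow> {\<omega>\<in>paths. exit_by F t \<omega>} \<in> sets pathM" for t
    using hit_by_measurable[of F "\<lambda>x. incr 0 x" pathM t] assms by (simp add: exit_by_def)
next
  show "exit_by F t \<omega>" if "\<omega> \<in> paths" "t \<ge> 0" "\<And>s. s > t \<Longrightarrow> exit_by F s \<omega>" for \<omega> t
    using hit_by_right[OF assms incr_paths[OF that(1), of 0] that(2)] that(3) unfolding exit_by_def by blast
next
  show "exit_by F t \<omega>" if "s \<le> t" "exit_by F s \<omega>" for s t \<omega>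
    using that hit_by_mono unfolding exit_by_def by blast
  show "exit_by F t \<omega>'" if "t \<ge> 0" "agree t \<omega> \<omega>'" "exit_by F t \<omega>" for t \<omega> \<omega>'
    using hit_by_agree[OF agree_incr_0[OF that(1,2)]] that(3) unfolding exit_by_def by blast
qed

lemma first_time_hit_in:
  assumes "closed F" "\<omega> \<in> happens (hit_by F)"
  shows "\<omega> (first_time (hit_by F) \<omega>) \<in> F"
proof -
  let ?T = "first_time (hit_by F) \<omega>"
  obtain s where s: "0 \<le> s" "s \<le> ?T" "\<omega> s \<in> F"
    using first_time_occurs[OF progress_hit[OF assms(1)] assms(2)] by (auto simp: hit_by_def)
  then have "hit_by F s \<omega>" by (auto simp: hit_by_def)
  then have "?T \<le> s" using first_time_le_iff[OF progress_hit[OF assms(1)] assms(2) s(1)] by simp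
  with s have "s = ?T" by simp
  with s(3) show ?thesis by simp
qed

lemma before_first_time_hit:
  assumes "closed F" "\<omega> \<in> happens (hit_by F)" "0 \<le> s" "s < first_time (hit_by F) \<omega>"
  shows "\<omega> s \<notin> F"
proof
  assume "\<omega> s \<in> F"
  then have "hit_by F s \<omega>" using assms(3) unfolding hit_by_def by (intro bexI[of _ s]) auto
  then have "first_time (hit_by F) \<omega> \<le> s" by (rule first_time_le_iff[OF progress_hit[OF assms(1)] assms(2,3), THEN iffD2])
  then show False using assms(4) by simp
qed

section \<open>Finite-dimensional laws\<close>

definition cyl :: "real set \<Rightarrow> (real \<Rightarrow> (real^'n) set) \<Rightarrow> (real \<Rightarrow> real^'n) set" where
  "cyl J B = {\<omega>\<in>paths. \<forall>t\<in>J. \<omega> t \<in> B t}"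

definition cyls :: "(real \<Rightarrow> real^'n) set set" where
  "cyls = {cyl J B | J B. finite J \<and> (\<forall>t\<in>J. 0 \<le> t) \<and> (\<forall>t. closed (B t))}"

lemma cyl_in_sets:
  assumes "finite J" "\<And>t. B t \<in> sets (borel :: (real^'n) measure)"
  shows "cyl J B \<in> sets pathM"
proof (cases "J = {}")
  case True
  then have "cyl J B = space pathM" by (simp add: cyl_def)
  then show ?thesis by (metis sets.top)
next
  case False
  have "cyl J B = {\<omega>\<in>space pathM. \<forall>t\<in>J. \<omega> t \<in> B t}" by (simp add: cyl_def)
  also have "\<dots> \<in> sets pathM"
  proof (rule sets.sets_Collect_finite_All'[OF _ assms(1) False])
    fix t
    show "{\<omega> \<in> space pathM. \<omega> t \<in> B t} \<in> sets pathM"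
      using measurable_sets[OF coord_measurable assms(2), of t t] by (simp add: vimage_def Int_def conj_commute)
  qed
  finally show ?thesis .
qed

lemma Int_stable_cyls: "Int_stable (cyls :: (real \<Rightarrow> real^'n) set set)"
proof (rule Int_stableI)
  fix a b :: "(real \<Rightarrow> real^'n) set" assume "a \<in> cyls" "b \<in> cyls"
  then obtain J1 B1 J2 B2 where
    1: "a = cyl J1 B1" "finite J1" "\<forall>t\<in>J1. 0 \<le> t" "\<forall>t. closed (B1 t)" and
    2: "b = cyl J2 B2" "finite J2" "\<forall>t\<in>J2. 0 \<le> t" "\<forall>t. closed (B2 t)"
    unfolding cyls_def by blast
  define B where "B t = (if t \<in> J1 then B1 t else UNIV) \<inter> (if t \<in> J2 then B2 t else UNIV)" for t
  have "a \<inter> b = cyl (J1 \<union> J2) B"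
    unfolding 1 2 cyl_def B_def by auto
  moreover have "closed (B t)" for t unfolding B_def using 1 2 by auto
  ultimately show "a \<inter> b \<in> cyls"
    unfolding cyls_def using 1 2 by (intro CollectI exI[of _ "J1 \<union> J2"] exI[of _ B]) auto
qed

text \<open>For the non-trivial inclusion, complements of one-time closed cylinders make every
  coordinate measurable, so the identity is measurable into \<open>pathM\<close>.\<close>

lemma sets_pathM_cyls: "sets pathM = sigma_sets paths (cyls :: (real \<Rightarrow> real^'n) set set)"
proof
  have sub: "cyls \<subseteq> sets (pathM :: (real \<Rightarrow> real^'n) measure)"
    unfolding cyls_def by (auto intro!: cyl_in_sets)
  show "sigma_sets paths cyls \<subseteq> sets (pathM :: (real \<Rightarrow> real^'n) measure)"
    using sets.sigma_sets_subset[OF sub] by simp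
  define N where "N = sigma paths (cyls :: (real \<Rightarrow> real^'n) set set)"
  have c: "(cyls :: (real \<Rightarrow> real^'n) set set) \<subseteq> Pow paths" by (auto simp: cyls_def cyl_def)
  have sN: "space N = paths" "sets N = sigma_sets paths cyls"
    using c by (auto simp: N_def)
  have "(\<lambda>\<omega>. \<omega>) \<in> measurable N (pathM :: (real \<Rightarrow> real^'n) measure)"
  proof (rule measurable_pathM)
    fix t :: real assume t: "t \<ge> 0"
    show "(\<lambda>\<omega>. \<omega> t) \<in> borel_measurable N"
    proof (rule borel_measurableI)
      fix S :: "(real^'n) set" assume "open S"
      then have "cyl {t} (\<lambda>_. - S) \<in> cyls"
        using t unfolding cyls_def by (intro CollectI exI[of _ "{t}"] exI[of _ "\<lambda>_. - S"]) auto
      then have "cyl {t} (\<lambda>_. - S) \<in> sets N" unfolding sN by (rule sigma_sets.Basic)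
      then have "space N - cyl {t} (\<lambda>_. - S) \<in> sets N" by (rule sets.compl_sets)
      moreover have "space N - cyl {t} (\<lambda>_. - S) = (\<lambda>\<omega>. \<omega> t) -` S \<inter> space N"
        by (auto simp: sN cyl_def)
      ultimately show "(\<lambda>\<omega>. \<omega> t) -` S \<inter> space N \<in> sets N" by simp
    qed
  qed (simp add: sN)
  then have "\<And>A. A \<in> sets (pathM :: (real \<Rightarrow> real^'n) measure) \<Longrightarrow> (\<lambda>\<omega>. \<omega>) -` A \<inter> space N \<in> sets N"
    by (rule measurable_sets)
  moreover have "A \<in> sets (pathM :: (real \<Rightarrow> real^'n) measure) \<Longrightarrow> A \<subseteq> paths" for A
    using sets.sets_into_space[of A "pathM :: (real \<Rightarrow> real^'n) measure"] by simp
  ultimately show "sets (pathM :: (real \<Rightarrow> real^'n) measure) \<subseteq> sigma_sets paths cyls"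
    by (fastforce simp: sN Int_absorb2)
qed

lemma cyls_sub: "cyls \<subseteq> Pow paths" by (auto simp: cyls_def cyl_def)

lemma paths_in_cyls: "paths \<in> (cyls :: (real \<Rightarrow> real^'n) set set)"
  unfolding cyls_def by (intro CollectI exI[of _ "{}"] exI[of _ "\<lambda>_. UNIV"]) (auto simp: cyl_def)

text \<open>Uniqueness on an intersection-stable generator; since \<open>paths\<close> itself is a
  cylinder, the constant sequence serves as exhaustion.\<close>

lemma path_measure_eqI:
  fixes M N :: "(real \<Rightarrow> real^'n) measure"
  assumes "sets M = sets pathM" "sets N = sets pathM" "finite_measure M"
    and "\<And>C. C \<in> cyls \<Longrightarrow> emeasure M C = emeasure N C"
  shows "M = N"
proof (rule measure_eqI_generator_eq[OF Int_stable_cyls cyls_sub])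
  show "range (\<lambda>i::nat. paths) \<subseteq> (cyls :: (real \<Rightarrow> real^'n) set set)" using paths_in_cyls by auto
  show "emeasure M paths \<noteq> \<infinity>"
    using finite_measure.finite_emeasure_space[OF assms(3)] sets_eq_imp_space_eq[OF assms(1)] by simp
qed (use assms sets_pathM_cyls in auto)

section \<open>Uniqueness of the Wiener law\<close>

definition gaussM :: "real \<Rightarrow> (real^'n) measure" where
  "gaussM t = density lborel (\<lambda>y. ennreal (gauss_dens t y))"

text \<open>Independence and the Gaussian laws of the increments are merged into one statement about
  their joint law. In this form they are easily transported by push-forwards. The clause
  \<open>0 < k\<close> mirrors the non-empty index set in the library's characterisation of
  independence by product measures.\<close>

definition wiener_at :: "real^'n \<Rightarrow> (real \<Rightarrow> real^'n) measure \<Rightarrow> bool" where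
  "wiener_at x Q \<longleftrightarrow> prob_space Q \<and> sets Q = sets pathM \<and> (AE \<omega> in Q. \<omega> 0 = x) \<and>
    (\<forall>k ts. 0 < k \<longrightarrow> 0 \<le> ts 0 \<longrightarrow> (\<forall>i<k. ts i < ts (Suc i)) \<longrightarrow>
       distr Q (PiM {..<k} (\<lambda>_. borel)) (\<lambda>\<omega>. \<lambda>i\<in>{..<k}. \<omega> (ts (Suc i)) - \<omega> (ts i)) =
       PiM {..<k} (\<lambda>i. gaussM (ts (Suc i) - ts i)))"

lemma is_wienerD:
  assumes "is_wiener P"
  shows "prob_space (P x)" "sets (P x) = sets pathM" "space (P x) = paths" "AE \<omega> in P x. \<omega> 0 = x"
    and "0 \<le> ts 0 \<Longrightarrow> (\<And>i. i < k \<Longrightarrow> ts i < ts (Suc i)) \<Longrightarrow>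
       prob_space.indep_vars (P x) (\<lambda>_. borel) (\<lambda>i \<omega>. \<omega> (ts (Suc i)) - \<omega> (ts i)) {..<k}"
    and "0 \<le> ts 0 \<Longrightarrow> (\<And>i. i < k \<Longrightarrow> ts i < ts (Suc i)) \<Longrightarrow> i < k \<Longrightarrow>
       distributed (P x) lborel (\<lambda>\<omega>. \<omega> (ts (Suc i)) - \<omega> (ts i)) (\<lambda>y. ennreal (gauss_dens (ts (Suc i) - ts i) y))"
  using assms unfolding is_wiener_def sets_pathM by blast+

lemma wiener_increment_law:
  assumes "is_wiener P" "0 \<le> s" "s < t"
  shows "distr (P x) borel (\<lambda>\<omega>. \<omega> t - \<omega> s) = gaussM (t - s)"
proof -
  have "distributed (P x) lborel (\<lambda>\<omega>. \<omega> t - \<omega> s) (\<lambda>y. ennreal (gauss_dens (t - s) y))"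
    using is_wienerD(6)[OF assms(1), of "\<lambda>i. if i = 0 then s else t" 1 0 x] assms(2,3) by simp
  then have "distr (P x) lborel (\<lambda>\<omega>. \<omega> t - \<omega> s) = gaussM (t - s)"
    by (simp add: distributed_def gaussM_def)
  then show ?thesis by (simp cong: distr_cong)
qed

lemma coord_measurable':
  "sets Q = sets pathM \<Longrightarrow> (\<lambda>\<omega>. \<omega> t) \<in> borel_measurable (Q :: (real \<Rightarrow> real^'n) measure)"
  using coord_measurable[of t] measurable_cong_sets by blast

lemma wiener_at_wiener:
  assumes "is_wiener P"
  shows "wiener_at x (P x)"
  unfolding wiener_at_def
proof (intro conjI allI impI)
  interpret prob_space "P x" by (rule is_wienerD(1)[OF assms])
  note [measurable] = coord_measurable'[OF is_wienerD(2)[OF assms]]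
  show "prob_space (P x)" by unfold_locales
  show "sets (P x) = sets pathM" "AE \<omega> in P x. \<omega> 0 = x" using is_wienerD(2,4)[OF assms] by auto
  fix k :: nat and ts :: "nat \<Rightarrow> real"
  assume k: "0 < k" and t: "0 \<le> ts 0" "\<forall>i<k. ts i < ts (Suc i)"
  have t0: "0 \<le> ts i" if "i \<le> k" for i
    using that t by (induction i) (auto dest: less_imp_le intro: order_trans simp: Suc_le_eq)
  have "distr (P x) (PiM {..<k} (\<lambda>_. borel)) (\<lambda>\<omega>. \<lambda>i\<in>{..<k}. \<omega> (ts (Suc i)) - \<omega> (ts i)) =
      PiM {..<k} (\<lambda>i. distr (P x) borel (\<lambda>\<omega>. \<omega> (ts (Suc i)) - \<omega> (ts i)))"
    by (rule indep_vars_iff_distr_eq_PiM'[THEN iffD1])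
       (use k t is_wienerD(5)[OF assms, of ts k] in auto)
  also have "\<dots> = PiM {..<k} (\<lambda>i. gaussM (ts (Suc i) - ts i))"
    by (intro PiM_cong refl wiener_increment_law[OF assms]) (use t t0 in auto)
  finally show "distr (P x) (PiM {..<k} (\<lambda>_. borel)) (\<lambda>\<omega>. \<lambda>i\<in>{..<k}. \<omega> (ts (Suc i)) - \<omega> (ts i)) = \<dots>" .
qed

lemma enumerate_times:
  fixes F :: "real set"
  assumes "finite F" "0 \<in> F" "\<And>t. t \<in> F \<Longrightarrow> 0 \<le> t"
  obtains k :: nat and ts where "ts 0 = 0" "\<And>i. i < k \<Longrightarrow> ts i < ts (Suc i)" "F = ts ` {..k}"
    "\<And>i j. i \<le> k \<Longrightarrow> j \<le> k \<Longrightarrow> ts i \<le> ts j \<longleftrightarrow> i \<le> j"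
proof -
  let ?xs = "sorted_list_of_set F"
  have l: "length ?xs = card F" "set ?xs = F" using assms(1) by auto
  have c: "0 < card F" using assms(1,2) by (auto simp: card_gt_0_iff)
  have mono: "i < j \<Longrightarrow> j < card F \<Longrightarrow> ?xs ! i < ?xs ! j" for i j
    using strict_sorted_list_of_set[of F] l by (auto simp: sorted_wrt_iff_nth_less)
  obtain i where i: "i < card F" "?xs ! i = 0" using assms(2) l by (metis in_set_conv_nth)
  have "?xs ! 0 \<in> F" using l c by (metis nth_mem)
  then have "0 \<le> ?xs ! 0" by (rule assms(3))
  then have "i = 0" using mono[of 0 i] i by (cases i) auto
  then have 0: "?xs ! 0 = 0" using i by simp
  show ?thesis
  proof (rule that[of "\<lambda>i. ?xs ! i" "card F - 1"])
    show "?xs ! 0 = 0" by fact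
    show "?xs ! i < ?xs ! Suc i" if "i < card F - 1" for i using mono[of i "Suc i"] that by auto
    have "F = (\<lambda>i. ?xs ! i) ` {..<card F}" using l by (metis lessThan_atLeast0 list.set_map map_nth set_upt)
    also have "{..<card F} = {..card F - 1}" using c by auto
    finally show "F = (\<lambda>i. ?xs ! i) ` {..card F - 1}" .
    show "?xs ! i \<le> ?xs ! j \<longleftrightarrow> i \<le> j" if "i \<le> card F - 1" "j \<le> card F - 1" for i j
    proof -
      have "i < card F" "j < card F" using that c by auto
      then show ?thesis using mono[of i j] mono[of j i] by (cases i j rule: linorder_cases) auto
    qed
  qed
qed

lemma telescope:
  fixes f :: "nat \<Rightarrow> 'a::ab_group_add"
  assumes "m \<le> n" shows "f n = f m + (\<Sum>i=m..<n. f (Suc i) - f i)"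
  using sum_Suc_diff'[OF assms, of f] by simp

text \<open>A cylinder event constrains finitely many positions. In increasing order of time these
  are the starting point plus partial sums of increments, and the joint law of the increments is
  prescribed.\<close>

lemma wiener_at_unique:
  fixes Q1 Q2 :: "(real \<Rightarrow> real^'n) measure"
  assumes "wiener_at x Q1" "wiener_at x Q2"
  shows "Q1 = Q2"
proof (rule path_measure_eqI)
  show "sets Q1 = sets pathM" "sets Q2 = sets pathM" using assms by (auto simp: wiener_at_def)
  show "finite_measure Q1" using assms by (auto simp: wiener_at_def intro: prob_space.finite_measure)
  fix C :: "(real \<Rightarrow> real^'n) set" assume "C \<in> cyls"
  then obtain J B where C: "C = cyl J B" "finite J" "\<forall>t\<in>J. 0 \<le> t" "\<forall>t. closed (B t)"
    unfolding cyls_def by blast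
  \<comment> \<open>Time \<open>0\<close> anchors the partial sums at \<open>x\<close>; time
    \<open>1\<close> is added only to guarantee at least one increment.\<close>
  obtain k ts where ts: "ts 0 = 0" "\<And>i. i < k \<Longrightarrow> ts i < ts (Suc i)" "insert 0 (insert 1 J) = ts ` {..k}"
    by (rule enumerate_times[of "insert 0 (insert 1 J)"]) (use C in auto)
  have k: "0 < k" using ts(1,3) by (cases k) auto
  let ?inc = "\<lambda>\<omega>. \<lambda>i\<in>{..<k}. \<omega> (ts (Suc i)) - \<omega> (ts i) :: real^'n"
  let ?P = "PiM {..<k} (\<lambda>_. borel :: (real^'n) measure)"
  define E where "E = {y\<in>space ?P. \<forall>i\<in>{..k}. ts i \<in> J \<longrightarrow> x + (\<Sum>j=0..<i. y j) \<in> B (ts i)}"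
  have E: "E \<in> sets ?P"
    unfolding E_def
  proof (intro sets.sets_Collect_finite_All' finite_atMost)
    fix i assume i: "i \<in> {..k}"
    have "(\<lambda>y. x + (\<Sum>j=0..<i. y j)) \<in> borel_measurable ?P"
      by (intro borel_measurable_add borel_measurable_const borel_measurable_sum measurable_component_singleton)
         (use i in auto)
    from measurable_sets[OF this, of "B (ts i)"] show "{y \<in> space ?P. ts i \<in> J \<longrightarrow> x + (\<Sum>j=0..<i. y j) \<in> B (ts i)} \<in> sets ?P"
      using C(4) by (cases "ts i \<in> J") (auto simp: vimage_def Int_def conj_commute)
  qed auto
  have main: "emeasure Q C = emeasure (PiM {..<k} (\<lambda>i. gaussM (ts (Suc i) - ts i))) E"
    if w: "wiener_at x Q" for Q :: "(real \<Rightarrow> real^'n) measure"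
  proof -
    have sQ: "sets Q = sets pathM" and sp: "space Q = paths" using w sets_eq_imp_space_eq[of Q pathM] by (auto simp: wiener_at_def)
    note [measurable] = coord_measurable'[OF sQ]
    have inc: "?inc \<in> measurable Q ?P" by measurable
    have "emeasure Q C = emeasure Q (?inc -` E \<inter> space Q)"
    proof (rule emeasure_eq_AE)
      have "AE \<omega> in Q. \<omega> 0 = x" using w by (simp add: wiener_at_def)
      then show "AE \<omega> in Q. \<omega> \<in> C \<longleftrightarrow> \<omega> \<in> ?inc -` E \<inter> space Q"
      proof (rule AE_mp[OF _ AE_I2], intro impI)
        fix \<omega> assume \<omega>: "\<omega> \<in> space Q" "\<omega> 0 = x"
        have *: "x + (\<Sum>j=0..<i. ?inc \<omega> j) = \<omega> (ts i)" if "i \<le> k" for i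
        proof -
          have "(\<Sum>j=0..<i. ?inc \<omega> j) = (\<Sum>j=0..<i. \<omega> (ts (Suc j)) - \<omega> (ts j))"
            using that by (intro sum.cong) auto
          then show ?thesis using telescope[of 0 i "\<lambda>j. \<omega> (ts j)"] \<omega>(2) ts(1) by simp
        qed
        have "\<omega> \<in> ?inc -` E \<inter> space Q \<longleftrightarrow> ?inc \<omega> \<in> E" using \<omega>(1) by simp
        also have "\<dots> \<longleftrightarrow> (\<forall>i\<in>{..k}. ts i \<in> J \<longrightarrow> \<omega> (ts i) \<in> B (ts i))"
          unfolding E_def using measurable_space[OF inc \<omega>(1)] * by auto
        also have "\<dots> \<longleftrightarrow> (\<forall>t\<in>ts`{..k}. t \<in> J \<longrightarrow> \<omega> t \<in> B t)" by blast
        also have "\<dots> \<longleftrightarrow> \<omega> \<in> C" using \<omega>(1) sp by (auto simp: C(1) cyl_def ts(3)[symmetric])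
        finally show "\<omega> \<in> C \<longleftrightarrow> \<omega> \<in> ?inc -` E \<inter> space Q" ..
      qed
      show "C \<in> sets Q" unfolding sQ C(1) using C by (intro cyl_in_sets) auto
      show "?inc -` E \<inter> space Q \<in> sets Q" by (rule measurable_sets[OF inc E])
    qed
    also have "\<dots> = emeasure (distr Q ?P ?inc) E" by (rule emeasure_distr[OF inc E, symmetric])
    also have "distr Q ?P ?inc = PiM {..<k} (\<lambda>i. gaussM (ts (Suc i) - ts i))"
      using w k ts(1,2) unfolding wiener_at_def by auto
    finally show ?thesis .
  qed
  show "emeasure Q1 C = emeasure Q2 C" using main[OF assms(1)] main[OF assms(2)] by simp
qed

lemma wiener_at_distr:
  fixes Q :: "(real \<Rightarrow> real^'n) measure" and f :: "(real \<Rightarrow> real^'n) \<Rightarrow> real \<Rightarrow> real^'n"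
  assumes "prob_space Q" "sets Q = sets pathM" and f: "f \<in> measurable Q pathM"
    and "AE \<omega> in Q. f \<omega> 0 = x"
    and "\<And>k ts. 0 < k \<Longrightarrow> 0 \<le> ts 0 \<Longrightarrow> (\<forall>i<k. ts i < ts (Suc i)) \<Longrightarrow>
       distr Q (PiM {..<k} (\<lambda>_. borel)) (\<lambda>\<omega>. \<lambda>i\<in>{..<k}. f \<omega> (ts (Suc i)) - f \<omega> (ts i)) =
       PiM {..<k} (\<lambda>i. gaussM (ts (Suc i) - ts i))"
  shows "wiener_at x (distr Q pathM f)"
  unfolding wiener_at_def
proof (intro conjI allI impI)
  interpret prob_space Q by fact
  show "prob_space (distr Q pathM f)" by (rule prob_space_distr[OF f])
  have "(\<lambda>\<omega>. \<omega> 0) \<in> borel_measurable (pathM :: (real \<Rightarrow> real^'n) measure)" by (rule coord_measurable)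
  then have "{\<omega> \<in> space (pathM :: (real \<Rightarrow> real^'n) measure). \<omega> 0 = x} \<in> sets (pathM :: (real \<Rightarrow> real^'n) measure)" by measurable
  then show "AE \<omega> in distr Q pathM f. \<omega> 0 = x"
    using assms(4) by (subst AE_distr_iff[OF f]) auto
  note [measurable] = coord_measurable
  fix k :: nat and ts :: "nat \<Rightarrow> real" assume "0 < k" "0 \<le> ts 0" "\<forall>i<k. ts i < ts (Suc i)"
  note * = assms(5)[OF this]
  show "distr (distr Q pathM f) (PiM {..<k} (\<lambda>_. borel)) (\<lambda>\<omega>. \<lambda>i\<in>{..<k}. \<omega> (ts (Suc i)) - \<omega> (ts i)) =
       PiM {..<k} (\<lambda>i. gaussM (ts (Suc i) - ts i))"
    by (subst distr_distr[OF _ f]) (auto simp: *[symmetric] comp_def)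
qed simp

section \<open>Invariance under translation, restart and scaling\<close>

lemma wiener_translate:
  assumes "is_wiener P"
  shows "P y = distr (P x) pathM (\<lambda>\<omega> s. (y - x) + \<omega> s)"
proof (rule wiener_at_unique[OF wiener_at_wiener[OF assms]])
  note sP = is_wienerD(2)[OF assms]
  have f: "(\<lambda>\<omega> s. (y - x) + \<omega> s) \<in> measurable (P x) pathM"
    by (rule plus_measurable[of "\<lambda>\<omega>. \<omega>" "P x" "\<lambda>_. y - x"]) (use sP in \<open>auto simp: measurable_ident_sets\<close>)
  show "wiener_at y (distr (P x) pathM (\<lambda>\<omega> s. (y - x) + \<omega> s))"
  proof (rule wiener_at_distr[OF is_wienerD(1,2)[OF assms] f])
    show "AE \<omega> in P x. y - x + \<omega> 0 = y" using is_wienerD(4)[OF assms, of x] by eventually_elim simp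
  qed (use wiener_at_wiener[OF assms, of x] in \<open>simp add: wiener_at_def\<close>)
qed

text \<open>Increments of the recentred future over a grid are increments of the original path over
  the grid moved by \<open>t\<close>. They have the prescribed law, and uniqueness identifies the
  whole law.\<close>

lemma wiener_incr:
  fixes P :: "real^'n \<Rightarrow> (real \<Rightarrow> real^'n) measure"
  assumes "is_wiener P" "0 \<le> t"
  shows "distr (P x) pathM (incr t) = P 0"
proof (rule wiener_at_unique[OF _ wiener_at_wiener[OF assms(1)]])
  note sP = is_wienerD(2)[OF assms(1)]
  have f: "incr t \<in> measurable (P x) pathM"
    by (rule incr_measurable[of "\<lambda>\<omega>. \<omega>" "P x" "\<lambda>_. t"]) (use sP in \<open>auto simp: measurable_ident_sets\<close>)
  show "wiener_at 0 (distr (P x) pathM (incr t))"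
  proof (rule wiener_at_distr[OF is_wienerD(1,2)[OF assms(1)] f])
    fix k :: nat and ts :: "nat \<Rightarrow> real" assume k: "0 < k" "0 \<le> ts 0" "\<forall>i<k. ts i < ts (Suc i)"
    have t0: "0 \<le> ts i" if "i \<le> k" for i
      using that k by (induction i) (auto dest: less_imp_le intro: order_trans simp: Suc_le_eq)
    have "(\<lambda>\<omega>. \<lambda>i\<in>{..<k}. incr t \<omega> (ts (Suc i)) - incr t \<omega> (ts i)) = (\<lambda>\<omega>. \<lambda>i\<in>{..<k}. \<omega> (t + ts (Suc i)) - \<omega> (t + ts i) :: real^'n)"
      by (intro ext restrict_ext) (auto simp: incr_def t0 max_absorb1)
    moreover have "distr (P x) (PiM {..<k} (\<lambda>_. borel)) (\<lambda>\<omega>. \<lambda>i\<in>{..<k}. \<omega> (t + ts (Suc i)) - \<omega> (t + ts i)) =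
       PiM {..<k} (\<lambda>i. gaussM ((t + ts (Suc i)) - (t + ts i)))"
      using wiener_at_wiener[OF assms(1), of x, unfolded wiener_at_def, THEN conjunct2, THEN conjunct2, THEN conjunct2,
        THEN spec, of k, THEN spec, of "\<lambda>i. t + ts i"] k assms(2) by simp
    ultimately show "distr (P x) (PiM {..<k} (\<lambda>_. borel)) (\<lambda>\<omega>. \<lambda>i\<in>{..<k}. incr t \<omega> (ts (Suc i)) - incr t \<omega> (ts i)) =
       PiM {..<k} (\<lambda>i. gaussM (ts (Suc i) - ts i))" by simp
  qed (simp add: incr_def)
qed

text \<open>Substituting \<open>v = a x\<close>, the Jacobian \<open>a ^ d\<close> cancels the
  factor \<open>(a\<^sup>2) powr (- d / 2)\<close> of the normalisation, and the exponent is
  homogeneous.\<close>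

lemma gaussM_scale:
  assumes "0 < a" "0 < t"
  shows "distr (gaussM (a\<^sup>2 * t)) borel (\<lambda>v. (1 / a) *\<^sub>R v) = (gaussM t :: (real^'n) measure)"
proof (rule measure_eqI)
  fix A assume "A \<in> sets (distr (gaussM (a\<^sup>2 * t)) borel (\<lambda>v. (1 / a) *\<^sub>R v :: real^'n))"
  then have A [measurable]: "A \<in> sets (borel :: (real^'n) measure)" by simp
  have [measurable]: "gauss_dens s \<in> borel_measurable (borel :: (real^'n) measure)" for s
    unfolding gauss_dens_def by measurable
  have dens: "gauss_dens (a\<^sup>2 * t) (a *\<^sub>R x) * a ^ CARD('n) = gauss_dens t x" for x :: "real^'n"
  proof -
    have "(2 * pi * (a\<^sup>2 * t)) powr (- real CARD('n) / 2) = (a\<^sup>2) powr (- real CARD('n) / 2) * (2 * pi * t) powr (- real CARD('n) / 2)"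
      using assms by (subst powr_mult[symmetric]) (auto simp: mult_ac)
    also have "(a\<^sup>2) powr (- real CARD('n) / 2) = inverse (a ^ CARD('n))"
    proof -
      have "(a\<^sup>2) powr (- real CARD('n) / 2) = a powr (- real CARD('n))"
        using assms by (simp add: powr_powr flip: powr_numeral)
      then show ?thesis using assms by (simp add: powr_minus powr_realpow)
    qed
    finally have *: "(2 * pi * (a\<^sup>2 * t)) powr (- real CARD('n) / 2) = inverse (a ^ CARD('n)) * (2 * pi * t) powr (- real CARD('n) / 2)" .
    have "(norm (a *\<^sub>R x))\<^sup>2 / (2 * (a\<^sup>2 * t)) = (norm x)\<^sup>2 / (2 * t)"
      using assms by (simp add: power_mult_distrib)
    then show ?thesis unfolding gauss_dens_def * using assms by (simp add: field_simps)
  qed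
  have "emeasure (distr (gaussM (a\<^sup>2 * t)) borel (\<lambda>v. (1 / a) *\<^sub>R v)) A =
    (\<integral>\<^sup>+ v. ennreal (gauss_dens (a\<^sup>2 * t) v) * indicator A ((1 / a) *\<^sub>R v) \<partial>lborel)"
  proof -
    have "(\<lambda>v::real^'n. (1 / a) *\<^sub>R v) -` A \<in> sets borel"
      using measurable_sets[of "\<lambda>v::real^'n. (1 / a) *\<^sub>R v" borel borel A] by simp
    then show ?thesis unfolding gaussM_def
      by (subst emeasure_distr) (auto simp: emeasure_density indicator_def intro!: nn_integral_cong)
  qed
  also have "\<dots> = (\<integral>\<^sup>+ v. ennreal (gauss_dens (a\<^sup>2 * t) v) * indicator A ((1 / a) *\<^sub>R v)
      \<partial>density (distr lborel borel (\<lambda>x::real^'n. 0 + a *\<^sub>R x)) (\<lambda>_. \<bar>a\<bar> ^ DIM(real^'n)))"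
    using lborel_affine[of a "0 :: real^'n"] assms by simp
  also have "\<dots> = (\<integral>\<^sup>+ x. ennreal (a ^ CARD('n)) * (ennreal (gauss_dens (a\<^sup>2 * t) (a *\<^sub>R x)) * indicator A x) \<partial>lborel)"
    using assms by (subst nn_integral_density) (auto simp: nn_integral_distr)
  also have "\<dots> = (\<integral>\<^sup>+ x. ennreal (gauss_dens t x) * indicator A x \<partial>lborel)"
    using assms by (intro nn_integral_cong) (auto simp: dens[symmetric] ennreal_mult' indicator_def mult.assoc mult.commute[of _ "a ^ CARD('n)"])
  also have "\<dots> = emeasure (gaussM t) A"
    unfolding gaussM_def by (subst emeasure_density) auto
  finally show "emeasure (distr (gaussM (a\<^sup>2 * t)) borel (\<lambda>v. (1 / a) *\<^sub>R v)) A = emeasure (gaussM t) A" .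
qed (simp add: gaussM_def)

lemma scale_measurable:
  "(\<lambda>\<omega> s. (1 / a) *\<^sub>R \<omega> (a\<^sup>2 * s)) \<in> measurable pathM (pathM :: (real \<Rightarrow> real^'n) measure)"
proof (rule measurable_pathM)
  note [measurable] = coord_measurable
  fix \<omega> :: "real \<Rightarrow> real^'n" assume "\<omega> \<in> space pathM"
  then have w: "\<omega> \<in> paths" by simp
  show "(\<lambda>s. (1 / a) *\<^sub>R \<omega> (a\<^sup>2 * s)) \<in> paths"
  proof (rule pathsI)
    show "continuous_on UNIV (\<lambda>s. (1 / a) *\<^sub>R \<omega> (a\<^sup>2 * s))"
      by (intro continuous_on_scaleR continuous_on_const, rule paths_compose[OF w]) (intro continuous_intros)
    fix t :: real assume "t \<le> 0"
    then have "a\<^sup>2 * t \<le> 0" by (simp add: mult_nonneg_nonpos)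
    then show "(1 / a) *\<^sub>R \<omega> (a\<^sup>2 * t) = (1 / a) *\<^sub>R \<omega> (a\<^sup>2 * 0)" using pathsD(2)[OF w, of "a\<^sup>2 * t"] by simp
  qed
next
  note [measurable] = coord_measurable
  show "(\<lambda>\<omega>. (1 / a) *\<^sub>R \<omega> (a\<^sup>2 * t)) \<in> borel_measurable (pathM :: (real \<Rightarrow> real^'n) measure)" for t by measurable
qed

text \<open>Running time faster by \<open>a\<^sup>2\<close> and shrinking space by \<open>a\<close>
  preserves every increment law. This is what makes an estimate at radius \<open>1\<close> valid at
  all radii with the same constant.\<close>

lemma wiener_scale:
  fixes P :: "real^'n \<Rightarrow> (real \<Rightarrow> real^'n) measure"
  assumes "is_wiener P" "0 < a"
  shows "distr (P 0) pathM (\<lambda>\<omega> s. (1 / a) *\<^sub>R \<omega> (a\<^sup>2 * s)) = P 0"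
proof (rule wiener_at_unique[OF _ wiener_at_wiener[OF assms(1)]])
  note sP = is_wienerD(2)[OF assms(1)]
  note [measurable] = coord_measurable'[OF sP]
  interpret prob_space "P 0" by (rule is_wienerD(1)[OF assms(1)])
  have f: "(\<lambda>\<omega> s. (1 / a) *\<^sub>R \<omega> (a\<^sup>2 * s)) \<in> measurable (P 0) pathM"
    unfolding measurable_cong_sets[OF sP refl] by (rule scale_measurable)
  show "wiener_at 0 (distr (P 0) pathM (\<lambda>\<omega> s. (1 / a) *\<^sub>R \<omega> (a\<^sup>2 * s)))"
  proof (rule wiener_at_distr[OF is_wienerD(1,2)[OF assms(1)] f])
    show "AE \<omega> in P 0. (1 / a) *\<^sub>R \<omega> (a\<^sup>2 * 0) = 0" using is_wienerD(4)[OF assms(1), of 0] by eventually_elim simp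
    fix k :: nat and ts :: "nat \<Rightarrow> real" assume k: "0 < k" "0 \<le> ts 0" "\<forall>i<k. ts i < ts (Suc i)"
    have t0: "0 \<le> ts i" if "i \<le> k" for i
      using that k by (induction i) (auto dest: less_imp_le intro: order_trans simp: Suc_le_eq)
    have i1: "indep_vars (\<lambda>_. borel) (\<lambda>i \<omega>. \<omega> (a\<^sup>2 * ts (Suc i)) - \<omega> (a\<^sup>2 * ts i)) {..<k}"
      using is_wienerD(5)[OF assms(1), of "\<lambda>i. a\<^sup>2 * ts i" k 0] k assms(2) by simp
    have i2: "indep_vars (\<lambda>_. borel) (\<lambda>i \<omega>. (1 / a) *\<^sub>R (\<omega> (a\<^sup>2 * ts (Suc i)) - \<omega> (a\<^sup>2 * ts i))) {..<k}"
      by (rule indep_vars_compose2[OF i1, of "\<lambda>_ v. (1/a) *\<^sub>R v"]) measurable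
    have "distr (P 0) (PiM {..<k} (\<lambda>_. borel)) (\<lambda>\<omega>. \<lambda>i\<in>{..<k}. (1 / a) *\<^sub>R (\<omega> (a\<^sup>2 * ts (Suc i)) - \<omega> (a\<^sup>2 * ts i))) =
        PiM {..<k} (\<lambda>i. distr (P 0) borel (\<lambda>\<omega>. (1 / a) *\<^sub>R (\<omega> (a\<^sup>2 * ts (Suc i)) - \<omega> (a\<^sup>2 * ts i))))"
      by (rule indep_vars_iff_distr_eq_PiM'[THEN iffD1, OF _ _ i2]) (use k in auto)
    also have "\<dots> = PiM {..<k} (\<lambda>i. gaussM (ts (Suc i) - ts i))"
    proof (rule PiM_cong[OF refl])
      fix i assume "i \<in> {..<k}"
      then have i: "ts i < ts (Suc i)" "0 \<le> ts i" using k t0 by auto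
      have "distr (P 0) borel (\<lambda>\<omega>. (1 / a) *\<^sub>R (\<omega> (a\<^sup>2 * ts (Suc i)) - \<omega> (a\<^sup>2 * ts i))) =
         distr (distr (P 0) borel (\<lambda>\<omega>. \<omega> (a\<^sup>2 * ts (Suc i)) - \<omega> (a\<^sup>2 * ts i))) borel (\<lambda>v. (1 / a) *\<^sub>R v)"
        by (subst distr_distr) (auto simp: comp_def)
      also have "distr (P 0) borel (\<lambda>\<omega>. \<omega> (a\<^sup>2 * ts (Suc i)) - \<omega> (a\<^sup>2 * ts i)) = gaussM (a\<^sup>2 * (ts (Suc i) - ts i))"
        using wiener_increment_law[OF assms(1), of "a\<^sup>2 * ts i" "a\<^sup>2 * ts (Suc i)" 0] i assms(2) by (simp add: right_diff_distrib)
      also have "distr \<dots> borel (\<lambda>v. (1 / a) *\<^sub>R v) = gaussM (ts (Suc i) - ts i)"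
        by (rule gaussM_scale) (use i assms(2) in auto)
      finally show "distr (P 0) borel (\<lambda>\<omega>. (1 / a) *\<^sub>R (\<omega> (a\<^sup>2 * ts (Suc i)) - \<omega> (a\<^sup>2 * ts i))) = gaussM (ts (Suc i) - ts i)" .
    qed
    finally show "distr (P 0) (PiM {..<k} (\<lambda>_. borel)) (\<lambda>\<omega>. \<lambda>i\<in>{..<k}. (1 / a) *\<^sub>R \<omega> (a\<^sup>2 * ts (Suc i)) - (1 / a) *\<^sub>R \<omega> (a\<^sup>2 * ts i)) =
       PiM {..<k} (\<lambda>i. gaussM (ts (Suc i) - ts i))" by (simp add: scaleR_diff_right)
  qed
qed

section \<open>The strong Markov property\<close>

lemma wiener_measurable_sets:
  assumes "is_wiener P"
  shows "measurable (P x) N = measurable pathM N"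
  by (rule measurable_cong_sets) (use is_wienerD(2)[OF assms] in auto)

lemma stop_measurable_const: "stop_path t \<in> measurable pathM (pathM :: (real \<Rightarrow> real^'n) measure)"
  by (rule stop_measurable[of "\<lambda>\<omega>. \<omega>" pathM "\<lambda>_. t"]) auto

lemma incr_measurable_const: "incr t \<in> measurable pathM (pathM :: (real \<Rightarrow> real^'n) measure)"
  by (rule incr_measurable[of "\<lambda>\<omega>. \<omega>" pathM "\<lambda>_. t"]) auto

text \<open>The times \<open>min s t\<close> of the past, \<open>t + s\<close> of the future and
  \<open>t\<close> itself are merged into one grid, in which \<open>t\<close> has index
  \<open>m\<close>. The past depends on increments below \<open>m\<close>, the future on those from
  \<open>m\<close> on, and the two blocks are independent.\<close>

lemma wiener_indep_cyl:
  fixes P :: "real^'n \<Rightarrow> (real \<Rightarrow> real^'n) measure"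
  assumes P: "is_wiener P" and t: "0 \<le> t" and "C1 \<in> cyls" "C2 \<in> cyls"
  shows "measure (P x) ((stop_path t -` C1 \<inter> paths) \<inter> (incr t -` C2 \<inter> paths)) =
    measure (P x) (stop_path t -` C1 \<inter> paths) * measure (P x) (incr t -` C2 \<inter> paths)"
proof -
  interpret prob_space "P x" by (rule is_wienerD(1)[OF P])
  note sP = is_wienerD(2)[OF P] and spP = is_wienerD(3)[OF P]
  note [measurable] = coord_measurable'[OF sP]
  note mP = wiener_measurable_sets[OF P, of x]
  obtain J1 B1 where C1: "C1 = cyl J1 B1" "finite J1" "\<forall>t\<in>J1. 0 \<le> t" "\<forall>t. closed (B1 t)"
    using assms(3) unfolding cyls_def by blast
  obtain J2 B2 where C2: "C2 = cyl J2 B2" "finite J2" "\<forall>t\<in>J2. 0 \<le> t" "\<forall>t. closed (B2 t)"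
    using assms(4) unfolding cyls_def by blast
  let ?F = "insert 0 (insert t ((\<lambda>s. min s t) ` J1 \<union> (\<lambda>s. t + s) ` J2))"
  obtain k ts where ts: "ts 0 = 0" "\<And>i. i < k \<Longrightarrow> ts i < ts (Suc i)" "?F = ts ` {..k}"
    "\<And>i j. i \<le> k \<Longrightarrow> j \<le> k \<Longrightarrow> ts i \<le> ts j \<longleftrightarrow> i \<le> j"
    by (rule enumerate_times[of ?F]) (use C1 C2 t in auto)
  obtain m where m: "m \<le> k" "ts m = t" using ts(3) by (metis (no_types, lifting) atMost_iff image_iff insertCI)
  have "\<exists>i. i \<le> m \<and> ts i = min s t" if "s \<in> J1" for s
  proof -
    have "min s t \<in> ts ` {..k}" using that unfolding ts(3)[symmetric] by blast
    then obtain i where "i \<le> k" "ts i = min s t" by auto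
    then show ?thesis using ts(4)[of i m] m by auto
  qed
  then obtain idx1 where idx1: "\<And>s. s \<in> J1 \<Longrightarrow> idx1 s \<le> m \<and> ts (idx1 s) = min s t" by metis
  have "\<exists>i. m \<le> i \<and> i \<le> k \<and> ts i = t + s" if "s \<in> J2" for s
  proof -
    have "t + s \<in> ts ` {..k}" using that unfolding ts(3)[symmetric] by blast
    then obtain i where "i \<le> k" "ts i = t + s" by auto
    then show ?thesis using ts(4)[of m i] m C2(3) that by auto
  qed
  then obtain idx2 where idx2: "\<And>s. s \<in> J2 \<Longrightarrow> m \<le> idx2 s \<and> idx2 s \<le> k \<and> ts (idx2 s) = t + s" by metis
  let ?P1 = "PiM {..<m} (\<lambda>_. borel :: (real^'n) measure)"
  let ?P2 = "PiM {m..<k} (\<lambda>_. borel :: (real^'n) measure)"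
  let ?X = "\<lambda>i \<omega>. \<omega> (ts (Suc i)) - \<omega> (ts i) :: real^'n"
  have "indep_vars (\<lambda>_. borel) ?X {..<k}"
    using is_wienerD(5)[OF P, of ts k x] ts(1,2) by simp
  then have ind: "indep_var ?P1 (\<lambda>\<omega>. \<lambda>i\<in>{..<m}. ?X i \<omega>) ?P2 (\<lambda>\<omega>. \<lambda>i\<in>{m..<k}. ?X i \<omega>)"
    by (rule indep_var_restrict) (use m in auto)
  define E1 where "E1 = {y\<in>space ?P1. \<forall>s\<in>J1. x + (\<Sum>j=0..<idx1 s. y j) \<in> B1 s}"
  define E2 where "E2 = {y\<in>space ?P2. \<forall>s\<in>J2. (\<Sum>j=m..<idx2 s. y j) \<in> B2 s}"
  have E1: "E1 \<in> sets ?P1"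
  proof (cases "J1 = {}")
    case True then show ?thesis unfolding E1_def by simp
  next
    case False
    show ?thesis unfolding E1_def
    proof (intro sets.sets_Collect_finite_All' C1(2) False)
      fix s assume s: "s \<in> J1"
      have "(\<lambda>y. x + (\<Sum>j=0..<idx1 s. y j)) \<in> borel_measurable ?P1"
        by (intro borel_measurable_add borel_measurable_const borel_measurable_sum measurable_component_singleton)
           (use idx1[OF s] in auto)
      from measurable_sets[OF this, of "B1 s"] show "{y \<in> space ?P1. x + (\<Sum>j=0..<idx1 s. y j) \<in> B1 s} \<in> sets ?P1"
        using C1(4) by (auto simp: vimage_def Int_def conj_commute)
    qed
  qed
  have E2: "E2 \<in> sets ?P2"
  proof (cases "J2 = {}")
    case True then show ?thesis unfolding E2_def by simp
  next
    case False
    show ?thesis unfolding E2_def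
    proof (intro sets.sets_Collect_finite_All' C2(2) False)
      fix s assume s: "s \<in> J2"
      have "(\<lambda>y. (\<Sum>j=m..<idx2 s. y j)) \<in> borel_measurable ?P2"
        by (intro borel_measurable_sum measurable_component_singleton) (use idx2[OF s] in auto)
      from measurable_sets[OF this, of "B2 s"] show "{y \<in> space ?P2. (\<Sum>j=m..<idx2 s. y j) \<in> B2 s} \<in> sets ?P2"
        using C2(4) by (auto simp: vimage_def Int_def conj_commute)
    qed
  qed
  let ?S1 = "stop_path t -` C1 \<inter> paths" and ?S2 = "incr t -` C2 \<inter> paths"
  let ?T1 = "(\<lambda>\<omega>. \<lambda>i\<in>{..<m}. ?X i \<omega>) -` E1 \<inter> space (P x)"
  let ?T2 = "(\<lambda>\<omega>. \<lambda>i\<in>{m..<k}. ?X i \<omega>) -` E2 \<inter> space (P x)"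
  have in_sets: "cyl J1 B1 \<in> sets pathM" "cyl J2 B2 \<in> sets pathM" using C1 C2 by (auto intro!: cyl_in_sets)
  have S1: "?S1 \<in> sets (P x)"
    unfolding sP C1(1) using measurable_sets[OF stop_measurable_const[of t] in_sets(1)] by simp
  have S2: "?S2 \<in> sets (P x)"
    unfolding sP C2(1) using measurable_sets[OF incr_measurable_const[of t] in_sets(2)] by simp
  have T1: "?T1 \<in> sets (P x)" by (rule measurable_sets[OF indep_var_rv1[OF ind] E1])
  have T2: "?T2 \<in> sets (P x)" by (rule measurable_sets[OF indep_var_rv2[OF ind] E2])
  \<comment> \<open>Positions in the past are recovered from increments through the starting point,
    which is known only almost surely. The future is recentred, so there the two events coincide
    exactly.\<close>
  have ST1: "AE \<omega> in P x. \<omega> \<in> ?S1 \<longleftrightarrow> \<omega> \<in> ?T1"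
  proof (rule AE_mp[OF is_wienerD(4)[OF P, of x] AE_I2], intro impI)
    fix \<omega> assume \<omega>: "\<omega> \<in> space (P x)" "\<omega> 0 = x"
    have w: "\<omega> \<in> paths" using \<omega> spP by simp
    have *: "x + (\<Sum>j=0..<idx1 s. (\<lambda>i\<in>{..<m}. ?X i \<omega>) j) = \<omega> (min s t)" if "s \<in> J1" for s
    proof -
      have "(\<Sum>j=0..<idx1 s. (\<lambda>i\<in>{..<m}. ?X i \<omega>) j) = (\<Sum>j=0..<idx1 s. ?X j \<omega>)"
        using idx1[OF that] by (intro sum.cong) auto
      then show ?thesis using telescope[of 0 "idx1 s" "\<lambda>j. \<omega> (ts j)"] \<omega>(2) ts(1) idx1[OF that] by simp
    qed
    have "\<omega> \<in> ?T1 \<longleftrightarrow> (\<forall>s\<in>J1. \<omega> (min s t) \<in> B1 s)"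
      unfolding E1_def using * \<omega>(1) by (auto simp: space_PiM)
    also have "\<dots> \<longleftrightarrow> \<omega> \<in> ?S1"
      using w stop_paths[OF w, of t] by (auto simp: C1(1) cyl_def stop_path_def)
    finally show "\<omega> \<in> ?S1 \<longleftrightarrow> \<omega> \<in> ?T1" by simp
  qed
  have ST2: "\<omega> \<in> ?S2 \<longleftrightarrow> \<omega> \<in> ?T2" if \<omega>: "\<omega> \<in> space (P x)" for \<omega>
  proof -
    have w: "\<omega> \<in> paths" using \<omega> spP by simp
    have *: "(\<Sum>j=m..<idx2 s. (\<lambda>i\<in>{m..<k}. ?X i \<omega>) j) = \<omega> (t + s) - \<omega> t" if "s \<in> J2" for s
    proof -
      have "(\<Sum>j=m..<idx2 s. (\<lambda>i\<in>{m..<k}. ?X i \<omega>) j) = (\<Sum>j=m..<idx2 s. ?X j \<omega>)"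
        using idx2[OF that] by (intro sum.cong) auto
      then show ?thesis using telescope[of m "idx2 s" "\<lambda>j. \<omega> (ts j)"] idx2[OF that] m(2) by simp
    qed
    have "\<omega> \<in> ?T2 \<longleftrightarrow> (\<forall>s\<in>J2. \<omega> (t + s) - \<omega> t \<in> B2 s)"
      unfolding E2_def using * \<omega>(1) by (auto simp: space_PiM)
    also have "\<dots> \<longleftrightarrow> \<omega> \<in> ?S2"
      using w incr_paths[OF w, of t] C2(3) by (auto simp: C2(1) cyl_def incr_def max_absorb1)
    finally show ?thesis by simp
  qed
  have S2T2: "?S2 = ?T2"
  proof (intro set_eqI iffI)
    fix \<omega> show "\<omega> \<in> ?S2 \<Longrightarrow> \<omega> \<in> ?T2" using ST2[of \<omega>] spP[of x] by blast
    show "\<omega> \<in> ?T2 \<Longrightarrow> \<omega> \<in> ?S2" using ST2[of \<omega>] by blast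
  qed
  have "prob (?S1 \<inter> ?S2) = prob (?T1 \<inter> ?T2)"
  proof (rule finite_measure_eq_AE)
    show "AE \<omega> in P x. \<omega> \<in> ?S1 \<inter> ?S2 \<longleftrightarrow> \<omega> \<in> ?T1 \<inter> ?T2" using ST1 unfolding S2T2 by eventually_elim blast
  qed (use S1 S2 T1 T2 in auto)
  also have "?T1 \<inter> ?T2 = (\<lambda>\<omega>. (\<lambda>i\<in>{..<m}. ?X i \<omega>, \<lambda>i\<in>{m..<k}. ?X i \<omega>)) -` (E1 \<times> E2) \<inter> space (P x)" by auto
  also have "prob \<dots> = prob ?T1 * prob ?T2" by (rule indep_varD[OF ind E1 E2])
  also have "prob ?T1 = prob ?S1" by (rule finite_measure_eq_AE) (use ST1 S1 T1 in auto)
  finally show ?thesis by (simp only: S2T2)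
qed

text \<open>Preimages of cylinders form intersection-stable generators of the sigma-algebras
  generated by the past and by the future, so independence extends from cylinders.\<close>

lemma wiener_indep:
  fixes P :: "real^'n \<Rightarrow> (real \<Rightarrow> real^'n) measure"
  assumes P: "is_wiener P" and t: "0 \<le> t"
  shows "prob_space.indep_var (P x) pathM (stop_path t) pathM (incr t)"
proof -
  interpret prob_space "P x" by (rule is_wienerD(1)[OF P])
  note spP = is_wienerD(3)[OF P, of x]
  note mP = wiener_measurable_sets[OF P, of x]
  have gen: "sigma_sets paths {f -` A \<inter> paths |A. A \<in> sets (pathM :: (real \<Rightarrow> real^'n) measure)} = sigma_sets paths {f -` A \<inter> paths |A. A \<in> cyls}"
    if "\<And>\<omega>. \<omega> \<in> paths \<Longrightarrow> f \<omega> \<in> paths" for f :: "(real \<Rightarrow> real^'n) \<Rightarrow> real \<Rightarrow> real^'n"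
  proof -
    have "{f -` A \<inter> paths |A. A \<in> sets (pathM :: (real \<Rightarrow> real^'n) measure)} = sigma_sets paths {f -` A \<inter> paths |A. A \<in> cyls}"
      unfolding sets_pathM_cyls by (rule sigma_sets_vimage_commute) (use that in auto)
    then show ?thesis by (simp add: sigma_sets_sigma_sets_eq) (subst sigma_sets_sigma_sets_eq, auto)
  qed
  have stable: "Int_stable {f -` A \<inter> paths |A. A \<in> (cyls :: (real \<Rightarrow> real^'n) set set)}" for f :: "(real \<Rightarrow> real^'n) \<Rightarrow> real \<Rightarrow> real^'n"
  proof (rule Int_stableI)
    fix a b :: "(real \<Rightarrow> real^'n) set"
    assume "a \<in> {f -` A \<inter> paths |A. A \<in> cyls}" "b \<in> {f -` A \<inter> paths |A. A \<in> cyls}"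
    then obtain A B :: "(real \<Rightarrow> real^'n) set" where AB: "a = f -` A \<inter> paths" "A \<in> cyls" "b = f -` B \<inter> paths" "B \<in> cyls" by blast
    have "A \<inter> B \<in> cyls" using Int_stable_cyls AB by (auto simp: Int_stable_def)
    moreover have "a \<inter> b = f -` (A \<inter> B) \<inter> paths" using AB by auto
    ultimately show "a \<inter> b \<in> {f -` A \<inter> paths |A. A \<in> cyls}" by blast
  qed
  have csub: "A \<in> sets pathM" if "A \<in> (cyls :: (real \<Rightarrow> real^'n) set set)" for A
    unfolding sets_pathM_cyls using that by (rule sigma_sets.Basic)
  have vs: "f -` A \<inter> paths \<in> sets (P x)" if "f \<in> measurable pathM pathM" "A \<in> cyls" for A and f :: "(real \<Rightarrow> real^'n) \<Rightarrow> real \<Rightarrow> real^'n"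
    using measurable_sets[OF that(1) csub[OF that(2)]] is_wienerD(2)[OF P] by simp
  have "indep_set {stop_path t -` A \<inter> paths |A. A \<in> cyls} {incr t -` A \<inter> paths |A. A \<in> cyls}"
    unfolding indep_sets2_eq
  proof (intro conjI ballI)
    show "{stop_path t -` A \<inter> paths |A. A \<in> cyls} \<subseteq> events" using vs[OF stop_measurable_const[of t]] by blast
    show "{incr t -` A \<inter> paths |A. A \<in> cyls} \<subseteq> events" using vs[OF incr_measurable_const[of t]] by blast
    fix a b :: "(real \<Rightarrow> real^'n) set" assume "a \<in> {stop_path t -` A \<inter> paths |A. A \<in> cyls}" "b \<in> {incr t -` A \<inter> paths |A. A \<in> cyls}"
    then obtain A B :: "(real \<Rightarrow> real^'n) set" where AB: "a = stop_path t -` A \<inter> paths" "A \<in> cyls" "b = incr t -` B \<inter> paths" "B \<in> cyls" by blast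
    show "prob (a \<inter> b) = prob a * prob b"
      unfolding AB(1,3) by (rule wiener_indep_cyl[OF P t AB(2,4)])
  qed
  from indep_set_sigma_sets[OF this stable stable]
  have "indep_set (sigma_sets paths {stop_path t -` A \<inter> paths |A. A \<in> cyls}) (sigma_sets paths {incr t -` A \<inter> paths |A. A \<in> cyls})"
    by (simp only: spP)
  then show ?thesis
    using gen[of "stop_path t", OF stop_paths] gen[of "incr t", OF incr_paths]
    unfolding indep_var_eq spP mP by (simp add: stop_measurable_const incr_measurable_const)
qed

lemma stopping_le_eq:
  assumes "\<omega> \<in> paths" "\<omega>' \<in> paths" "0 \<le> t" "agree t \<omega> \<omega>'"
  shows "stop_path t \<omega> = stop_path t \<omega>'"
proof
  fix s
  show "stop_path t \<omega> s = stop_path t \<omega>' s"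
  proof (cases "s \<le> 0")
    case True
    then show ?thesis using assms(3,4) pathsD(2)[OF assms(1) True] pathsD(2)[OF assms(2) True]
      by (simp add: stop_path_def agree_def min_def)
  next
    case False then show ?thesis using assms(3,4) by (auto simp: stop_path_def agree_def min_def)
  qed
qed

text \<open>An event that only looks at the path up to \<open>t\<close> is its own preimage under
  \<open>stop_path t\<close>. This turns the pathwise form of adaptedness into membership in the
  sigma-algebra of the past.\<close>

lemma markov_deterministic:
  fixes P :: "real^'n \<Rightarrow> (real \<Rightarrow> real^'n) measure"
  assumes P: "is_wiener P" and t: "0 \<le> t" and A: "A \<in> sets pathM" and C: "C \<in> sets pathM"
    and adapted: "\<And>\<omega> \<omega>'. \<omega> \<in> A \<Longrightarrow> \<omega>' \<in> paths \<Longrightarrow> agree t \<omega> \<omega>' \<Longrightarrow> \<omega>' \<in> A"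
  shows "emeasure (P x) (A \<inter> (incr t -` C \<inter> paths)) = emeasure (P x) A * emeasure (P 0) C"
proof -
  interpret prob_space "P x" by (rule is_wienerD(1)[OF P])
  note spP = is_wienerD(3)[OF P, of x]
  note mP = wiener_measurable_sets[OF P, of x]
  have Asub: "A \<subseteq> paths" using sets.sets_into_space[OF A] by simp
  have AA: "A = stop_path t -` A \<inter> paths"
  proof (intro set_eqI iffI)
    fix \<omega> assume "\<omega> \<in> A"
    then show "\<omega> \<in> stop_path t -` A \<inter> paths"
      using adapted[of \<omega> "stop_path t \<omega>"] stop_paths[of \<omega> t] agree_stop[of t \<omega>] Asub by blast
  next
    fix \<omega> assume "\<omega> \<in> stop_path t -` A \<inter> paths"
    then show "\<omega> \<in> A" using adapted[of "stop_path t \<omega>" \<omega>] agree_sym[OF agree_stop[of t \<omega>]] by blast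
  qed
  have "prob (stop_path t -` A \<inter> paths \<inter> (incr t -` C \<inter> paths)) = prob ((\<lambda>\<omega>. (stop_path t \<omega>, incr t \<omega>)) -` (A \<times> C) \<inter> space (P x))"
    by (rule arg_cong[where f=prob]) (auto simp: spP)
  also have "\<dots> = prob (stop_path t -` A \<inter> paths) * prob (incr t -` C \<inter> paths)"
    using indep_varD[OF wiener_indep[OF P t] A C] by (simp only: spP)
  also have "prob (incr t -` C \<inter> paths) = measure (P 0) C"
    unfolding wiener_incr[OF P t, of x, symmetric]
    using C incr_measurable_const[of t] mP by (subst measure_distr) (auto simp: spP)
  finally have *: "prob (A \<inter> (incr t -` C \<inter> paths)) = prob A * measure (P 0) C" using AA by simp
  interpret P0: prob_space "P 0" by (rule is_wienerD(1)[OF P])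
  show ?thesis unfolding emeasure_eq_measure P0.emeasure_eq_measure * by (simp add: ennreal_mult)
qed

text \<open>The hypothesis says that the law of \<open>X\<close> on \<open>A\<close> is a multiple
  of \<open>P 0\<close>; stating this as an equality of measures passes from events to
  integrands.\<close>

lemma nn_integral_restricted_distr:
  fixes P :: "real^'n \<Rightarrow> (real \<Rightarrow> real^'n) measure"
  assumes P: "is_wiener P" and X: "X \<in> measurable pathM (pathM :: (real \<Rightarrow> real^'n) measure)" and A: "A \<in> sets pathM"
    and eq: "\<And>C. C \<in> sets pathM \<Longrightarrow> emeasure (P x) (A \<inter> (X -` C \<inter> paths)) = emeasure (P x) A * emeasure (P 0) C"
    and h: "h \<in> borel_measurable pathM"
  shows "(\<integral>\<^sup>+\<omega>. indicator A \<omega> * h (X \<omega>) \<partial>P x) = emeasure (P x) A * (\<integral>\<^sup>+\<omega>. h \<omega> \<partial>P 0)"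
proof -
  note sP = is_wienerD(2)[OF P] and spP = is_wienerD(3)[OF P]
  note mP = wiener_measurable_sets[OF P]
  have X': "X \<in> measurable (P x) pathM" using X by (simp add: mP)
  have A': "A \<in> sets (P x)" using A sP by simp
  define N where "N = density (P x) (indicator A :: _ \<Rightarrow> ennreal)"
  have XN: "X \<in> measurable N pathM" using X' by (simp add: N_def)
  have "distr N pathM X = scale_measure (emeasure (P x) A) (P 0)"
  proof (rule measure_eqI)
    fix C assume "C \<in> sets (distr N pathM X)"
    then have C: "C \<in> sets pathM" by simp
    have V: "X -` C \<inter> paths \<in> sets (P x)" using measurable_sets[OF X' C] spP by simp
    have "emeasure (distr N pathM X) C = emeasure N (X -` C \<inter> paths)"
      by (subst emeasure_distr[OF XN C]) (simp add: N_def spP)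
    also have "\<dots> = (\<integral>\<^sup>+\<omega>. indicator A \<omega> * indicator (X -` C \<inter> paths) \<omega> \<partial>P x)"
      unfolding N_def using A' V by (intro emeasure_density) auto
    also have "\<dots> = (\<integral>\<^sup>+\<omega>. indicator (A \<inter> (X -` C \<inter> paths)) \<omega> \<partial>P x)"
      by (intro nn_integral_cong) (simp add: indicator_def)
    also have "\<dots> = emeasure (P x) (A \<inter> (X -` C \<inter> paths))"
      using A' V by (intro nn_integral_indicator) auto
    also have "\<dots> = emeasure (scale_measure (emeasure (P x) A) (P 0)) C"
      by (simp add: eq[OF C])
    finally show "emeasure (distr N pathM X) C = emeasure (scale_measure (emeasure (P x) A) (P 0)) C" .
  qed (use sP in simp)
  then have "(\<integral>\<^sup>+\<omega>. h \<omega> \<partial>distr N pathM X) = (\<integral>\<^sup>+\<omega>. h \<omega> \<partial>scale_measure (emeasure (P x) A) (P 0))" by simp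
  also have "\<dots> = emeasure (P x) A * (\<integral>\<^sup>+\<omega>. h \<omega> \<partial>P 0)"
    by (rule nn_integral_scale_measure) (use h in \<open>simp add: mP\<close>)
  finally have 1: "(\<integral>\<^sup>+\<omega>. h \<omega> \<partial>distr N pathM X) = emeasure (P x) A * (\<integral>\<^sup>+\<omega>. h \<omega> \<partial>P 0)" .
  have "(\<integral>\<^sup>+\<omega>. h \<omega> \<partial>distr N pathM X) = (\<integral>\<^sup>+\<omega>. h (X \<omega>) \<partial>N)" by (rule nn_integral_distr[OF XN]) (use h in simp)
  also have "\<dots> = (\<integral>\<^sup>+\<omega>. indicator A \<omega> * h (X \<omega>) \<partial>P x)"
    unfolding N_def using A' measurable_compose[OF X' h] by (intro nn_integral_density) auto
  finally show ?thesis using 1 by simp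
qed

lemma stoppingD:
  assumes "stopping A T"
  shows "A \<in> sets pathM" "T \<in> borel_measurable pathM" "\<omega> \<in> A \<Longrightarrow> 0 \<le> T \<omega>" "\<omega> \<in> A \<Longrightarrow> \<omega> \<in> paths"
    "\<omega> \<in> A \<Longrightarrow> \<omega>' \<in> paths \<Longrightarrow> agree (T \<omega>) \<omega> \<omega>' \<Longrightarrow> \<omega>' \<in> A"
    "\<omega> \<in> A \<Longrightarrow> \<omega>' \<in> paths \<Longrightarrow> agree (T \<omega>) \<omega> \<omega>' \<Longrightarrow> T \<omega>' = T \<omega>"
proof -
  show "A \<in> sets pathM" "T \<in> borel_measurable pathM" "\<omega> \<in> A \<Longrightarrow> 0 \<le> T \<omega>"
    "\<omega> \<in> A \<Longrightarrow> \<omega>' \<in> paths \<Longrightarrow> agree (T \<omega>) \<omega> \<omega>' \<Longrightarrow> \<omega>' \<in> A"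
    "\<omega> \<in> A \<Longrightarrow> \<omega>' \<in> paths \<Longrightarrow> agree (T \<omega>) \<omega> \<omega>' \<Longrightarrow> T \<omega>' = T \<omega>"
    using assms unfolding stopping_def by blast+
  then show "\<omega> \<in> A \<Longrightarrow> \<omega> \<in> paths" using sets.sets_into_space[of A pathM] by auto
qed

text \<open>Rounding goes upwards: by the time the rounded clock rings, \<open>T\<close> has
  occurred, so the cell containing \<open>T\<close> is already known to the path.\<close>

definition grid_up :: "nat \<Rightarrow> real \<Rightarrow> real" where
  "grid_up n t = (real (nat \<lfloor>real (Suc n) * t\<rfloor>) + 1) / real (Suc n)"

lemma grid_up_ge: "0 \<le> t \<Longrightarrow> t \<le> grid_up n t"
proof -
  assume t: "0 \<le> t"
  then have "real (Suc n) * t \<le> real (nat \<lfloor>real (Suc n) * t\<rfloor>) + 1" by linarith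
  then show ?thesis unfolding grid_up_def by (simp add: pos_le_divide_eq mult.commute del: of_nat_Suc)
qed

lemma grid_up_le: "0 \<le> t \<Longrightarrow> grid_up n t \<le> t + 1 / real (Suc n)"
proof -
  assume t: "0 \<le> t"
  then have "0 \<le> \<lfloor>real (Suc n) * t\<rfloor>" by simp
  then have "real (nat \<lfloor>real (Suc n) * t\<rfloor>) \<le> real (Suc n) * t" by linarith
  then have "(real (nat \<lfloor>real (Suc n) * t\<rfloor>) + 1) / real (Suc n) \<le> (real (Suc n) * t + 1) / real (Suc n)"
    by (intro divide_right_mono) auto
  then show ?thesis unfolding grid_up_def by (simp add: add_divide_distrib del: of_nat_Suc)
qed

lemma grid_up_tendsto: "0 \<le> t \<Longrightarrow> (\<lambda>n. grid_up n t) \<longlonglongrightarrow> t"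
proof (rule tendsto_sandwich[where f="\<lambda>n. t" and h="\<lambda>n. t + 1 / real (Suc n)"])
  show "(\<lambda>n. t + 1 / real (Suc n)) \<longlonglongrightarrow> t"
    using tendsto_add[OF tendsto_const[of t] LIMSEQ_inverse_real_of_nat] by (simp add: inverse_eq_divide)
qed (auto simp: grid_up_ge grid_up_le simp del: of_nat_Suc)

lemma grid_up_measurable: "grid_up n \<in> borel_measurable borel"
  unfolding grid_up_def by measurable

text \<open>Discretization at the times \<open>grid_up n T > T\<close>, which converge to \<open>T\<close> and take countably many values; path continuity then
  passes to the limit on continuous cylinder functions.\<close>
lemma strong_markov_discrete:
  fixes P :: "real^'n \<Rightarrow> (real \<Rightarrow> real^'n) measure"
  assumes P: "is_wiener P" and st: "stopping A T" and C: "C \<in> sets pathM"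
  shows "emeasure (P x) (A \<inter> ((\<lambda>\<omega>. incr (grid_up n (T \<omega>)) \<omega>) -` C \<inter> paths)) = emeasure (P x) A * emeasure (P 0) C"
proof -
  note sP = is_wienerD(2)[OF P] and spP = is_wienerD(3)[OF P]
  let ?N = "real (Suc n)"
  define tk where "tk k = (real k + 1) / ?N" for k :: nat
  define Ak where "Ak k = A \<inter> {\<omega>. nat \<lfloor>?N * T \<omega>\<rfloor> = k}" for k
  note [measurable] = stoppingD(2)[OF st]
  have Ak: "Ak k \<in> sets pathM" for k
  proof -
    have "{\<omega>\<in>space pathM. nat \<lfloor>?N * T \<omega>\<rfloor> = k} \<in> sets pathM" by measurable
    then have "A \<inter> {\<omega>\<in>space pathM. nat \<lfloor>?N * T \<omega>\<rfloor> = k} \<in> sets pathM" using stoppingD(1)[OF st] by blast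
    also have "A \<inter> {\<omega>\<in>space pathM. nat \<lfloor>?N * T \<omega>\<rfloor> = k} = Ak k"
      unfolding Ak_def using stoppingD(4)[OF st] by auto
    finally show ?thesis .
  qed
  have tk0: "0 \<le> tk k" for k by (simp add: tk_def)
  have ad: "\<omega>' \<in> Ak k" if "\<omega> \<in> Ak k" "\<omega>' \<in> paths" "agree (tk k) \<omega> \<omega>'" for \<omega> \<omega>' k
  proof -
    have w: "\<omega> \<in> A" "nat \<lfloor>?N * T \<omega>\<rfloor> = k" using that(1) by (auto simp: Ak_def)
    have "T \<omega> \<le> tk k" using grid_up_ge[OF stoppingD(3)[OF st w(1)], of n] w(2) by (simp add: grid_up_def tk_def)
    then have "agree (T \<omega>) \<omega> \<omega>'" by (rule agree_mono[OF that(3)])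
    then show ?thesis using stoppingD(5,6)[OF st w(1) that(2)] w(2) by (simp add: Ak_def)
  qed
  have V: "incr t -` C \<inter> paths \<in> sets pathM" for t using measurable_sets[OF incr_measurable_const[of t] C] by simp
  have "A \<inter> ((\<lambda>\<omega>. incr (grid_up n (T \<omega>)) \<omega>) -` C \<inter> paths) = (\<Union>k. Ak k \<inter> (incr (tk k) -` C \<inter> paths))"
    unfolding Ak_def tk_def grid_up_def by auto
  also have "emeasure (P x) \<dots> = (\<Sum>k. emeasure (P x) (Ak k \<inter> (incr (tk k) -` C \<inter> paths)))"
    by (rule suminf_emeasure[symmetric]) (use Ak V sP in \<open>auto simp: disjoint_family_on_def Ak_def\<close>)
  also have "\<dots> = (\<Sum>k. emeasure (P x) (Ak k) * emeasure (P 0) C)"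
    by (intro suminf_cong markov_deterministic[OF P tk0 Ak C ad])
  also have "\<dots> = (\<Sum>k. emeasure (P x) (Ak k)) * emeasure (P 0) C" by (rule ennreal_suminf_multc)
  also have "(\<Sum>k. emeasure (P x) (Ak k)) = emeasure (P x) (\<Union>k. Ak k)"
    by (rule suminf_emeasure) (use Ak sP in \<open>auto simp: disjoint_family_on_def Ak_def\<close>)
  also have "(\<Union>k. Ak k) = A" by (auto simp: Ak_def)
  finally show ?thesis .
qed

lemma incr_stopping_measurable:
  "T \<in> borel_measurable pathM \<Longrightarrow> (\<lambda>\<omega>. incr (T \<omega>) \<omega>) \<in> measurable pathM (pathM :: (real \<Rightarrow> real^'n) measure)"
  by (rule incr_measurable) auto

lemma strong_markov_cylinder_function:
  fixes P :: "real^'n \<Rightarrow> (real \<Rightarrow> real^'n) measure"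
  assumes P: "is_wiener P" and st: "stopping A T" and J: "finite J" "\<forall>s\<in>J. 0 \<le> s"
    and \<phi>: "\<And>s. continuous_on UNIV (\<phi> s)" "\<And>s v. 0 \<le> \<phi> s v" "\<And>s v. \<phi> s v \<le> (1::real)"
  shows "(\<integral>\<^sup>+\<omega>. indicator A \<omega> * ennreal (\<Prod>s\<in>J. \<phi> s (incr (T \<omega>) \<omega> s)) \<partial>P x) =
    emeasure (P x) A * (\<integral>\<^sup>+\<omega>. ennreal (\<Prod>s\<in>J. \<phi> s (\<omega> s)) \<partial>P 0)"
proof -
  interpret prob_space "P x" by (rule is_wienerD(1)[OF P])
  note mP = wiener_measurable_sets[OF P]
  note spP = is_wienerD(3)[OF P]
  have A: "A \<in> sets (P x)" using stoppingD(1)[OF st] is_wienerD(2)[OF P] by simp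
  have h: "(\<lambda>\<omega>. ennreal (\<Prod>s\<in>J. \<phi> s (\<omega> s))) \<in> borel_measurable (pathM :: (real \<Rightarrow> real^'n) measure)"
    by (intro measurable_compose[OF _ measurable_ennreal] borel_measurable_prod
        measurable_compose[OF coord_measurable borel_measurable_continuous_onI[OF \<phi>(1)]])
  have gm: "(\<lambda>\<omega>. incr (grid_up n (T \<omega>)) \<omega>) \<in> measurable pathM pathM" for n
    by (intro incr_stopping_measurable measurable_compose[OF stoppingD(2)[OF st] grid_up_measurable])
  have im: "(\<lambda>\<omega>. incr (T \<omega>) \<omega>) \<in> measurable pathM pathM"
    by (intro incr_stopping_measurable stoppingD(2)[OF st])
  have "(\<lambda>n. (\<integral>\<^sup>+\<omega>. indicator A \<omega> * ennreal (\<Prod>s\<in>J. \<phi> s (incr (grid_up n (T \<omega>)) \<omega> s)) \<partial>P x))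
     \<longlonglongrightarrow> (\<integral>\<^sup>+\<omega>. indicator A \<omega> * ennreal (\<Prod>s\<in>J. \<phi> s (incr (T \<omega>) \<omega> s)) \<partial>P x)"
  proof (rule nn_integral_dominated_convergence[where w="\<lambda>_. 1"])
    show "(\<lambda>\<omega>. indicator A \<omega> * ennreal (\<Prod>s\<in>J. \<phi> s (incr (grid_up n (T \<omega>)) \<omega> s))) \<in> borel_measurable (P x)" for n
      using measurable_compose[OF gm[of n] h] borel_measurable_indicator[OF A]
      by (intro borel_measurable_times_ennreal) (simp_all add: mP)
    show "(\<lambda>\<omega>. indicator A \<omega> * ennreal (\<Prod>s\<in>J. \<phi> s (incr (T \<omega>) \<omega> s))) \<in> borel_measurable (P x)"
      using measurable_compose[OF im h] borel_measurable_indicator[OF A]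
      by (intro borel_measurable_times_ennreal) (simp_all add: mP)
    show "AE \<omega> in P x. indicator A \<omega> * ennreal (\<Prod>s\<in>J. \<phi> s (incr (grid_up n (T \<omega>)) \<omega> s)) \<le> 1" for n
      by (intro AE_I2) (simp add: indicator_def prod_le_1 \<phi>(2,3))
    show "AE \<omega> in P x. (\<lambda>n. indicator A \<omega> * ennreal (\<Prod>s\<in>J. \<phi> s (incr (grid_up n (T \<omega>)) \<omega> s)))
        \<longlonglongrightarrow> indicator A \<omega> * ennreal (\<Prod>s\<in>J. \<phi> s (incr (T \<omega>) \<omega> s))"
    proof (rule AE_I2)
      fix \<omega> assume "\<omega> \<in> space (P x)"
      show "(\<lambda>n. indicator A \<omega> * ennreal (\<Prod>s\<in>J. \<phi> s (incr (grid_up n (T \<omega>)) \<omega> s)))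
        \<longlonglongrightarrow> indicator A \<omega> * ennreal (\<Prod>s\<in>J. \<phi> s (incr (T \<omega>) \<omega> s))"
      proof (cases "\<omega> \<in> A")
        case True
        note w = stoppingD(4)[OF st True] and t = grid_up_tendsto[OF stoppingD(3)[OF st True]]
        have "(\<lambda>n. incr (grid_up n (T \<omega>)) \<omega> s) \<longlonglongrightarrow> incr (T \<omega>) \<omega> s" for s
          unfolding incr_def
          by (intro tendsto_diff isCont_tendsto_compose[OF pathsD(3)[OF w]] tendsto_add t tendsto_const)
        moreover have "isCont (\<phi> s) v" for s v using \<phi>(1)[of s] by (simp add: continuous_on_eq_continuous_at)
        ultimately have "(\<lambda>n. (\<Prod>s\<in>J. \<phi> s (incr (grid_up n (T \<omega>)) \<omega> s))) \<longlonglongrightarrow> (\<Prod>s\<in>J. \<phi> s (incr (T \<omega>) \<omega> s))"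
          by (intro tendsto_prod isCont_tendsto_compose[where g="\<phi> _"])
        then show ?thesis using True by (simp add: tendsto_ennrealI)
      qed simp
    qed
  qed (auto simp: emeasure_space_1)
  moreover have "(\<integral>\<^sup>+\<omega>. indicator A \<omega> * ennreal (\<Prod>s\<in>J. \<phi> s (incr (grid_up n (T \<omega>)) \<omega> s)) \<partial>P x) =
    emeasure (P x) A * (\<integral>\<^sup>+\<omega>. ennreal (\<Prod>s\<in>J. \<phi> s (\<omega> s)) \<partial>P 0)" for n
    by (rule nn_integral_restricted_distr[OF P gm stoppingD(1)[OF st] strong_markov_discrete[OF P st] h])
  ultimately show ?thesis by (simp add: LIMSEQ_const_iff)
qed

text \<open>Continuous functions that decrease to the indicator of a closed non-empty set as the
  slope \<open>m\<close> grows.\<close>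

definition bump :: "(real^'n) set \<Rightarrow> nat \<Rightarrow> real^'n \<Rightarrow> real" where
  "bump B m v = max 0 (1 - real m * infdist v B)"

lemma bump_props:
  "continuous_on UNIV (bump B m)" "0 \<le> bump B m v" "bump B m v \<le> 1"
  unfolding bump_def by (auto intro!: continuous_intros continuous_on_infdist simp: infdist_nonneg)

lemma bump_tendsto:
  assumes "closed B" "B \<noteq> {}"
  shows "(\<lambda>m. bump B m v) \<longlonglongrightarrow> indicator B v"
proof (cases "v \<in> B")
  case True then show ?thesis by (simp add: bump_def)
next
  case False
  then have d: "0 < infdist v B" using in_closed_iff_infdist_zero[OF assms, of v] infdist_nonneg[of v B] by simp
  obtain m0 :: nat where m0: "1 / infdist v B \<le> real m0" using real_arch_simple by blast
  have "bump B m v = 0" if "m \<ge> m0" for m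
  proof -
    have "1 / infdist v B \<le> real m" using m0 that by linarith
    then have "1 \<le> real m * infdist v B" using d by (simp add: pos_divide_le_eq)
    then show ?thesis by (simp add: bump_def)
  qed
  then have "\<forall>\<^sub>F m in sequentially. bump B m v = indicator B v"
    using False by (auto simp: eventually_sequentially)
  then show ?thesis by (rule tendsto_eventually)
qed

text \<open>The identity for continuous cylinder functions passes to indicators of closed cylinders
  by dominated convergence along \<open>bump\<close>. These determine both sides as measures in
  \<open>C\<close>.\<close>

lemma strong_markov_incr:
  fixes P :: "real^'n \<Rightarrow> (real \<Rightarrow> real^'n) measure"
  assumes P: "is_wiener P" and st: "stopping A T"  and C: "C \<in> sets pathM"
  shows "emeasure (P x) (A \<inter> ((\<lambda>\<omega>. incr (T \<omega>) \<omega>) -` C \<inter> paths)) = emeasure (P x) A * emeasure (P 0) C"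
proof -
  interpret prob_space "P x" by (rule is_wienerD(1)[OF P])
  interpret P0: prob_space "P 0" by (rule is_wienerD(1)[OF P])
  note mP = wiener_measurable_sets[OF P]
  note spP = is_wienerD(3)[OF P] and sP = is_wienerD(2)[OF P]
  have A: "A \<in> sets (P x)" using stoppingD(1)[OF st] is_wienerD(2)[OF P] by simp
  have im: "(\<lambda>\<omega>. incr (T \<omega>) \<omega>) \<in> measurable pathM pathM"
    by (intro incr_stopping_measurable stoppingD(2)[OF st])
  have im': "(\<lambda>\<omega>. incr (T \<omega>) \<omega>) \<in> measurable (P x) pathM" using im by (simp add: mP)
  define N where "N = density (P x) (indicator A :: _ \<Rightarrow> ennreal)"
  have imN: "(\<lambda>\<omega>. incr (T \<omega>) \<omega>) \<in> measurable N pathM" using im' by (simp add: N_def)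
  have N: "emeasure (distr N pathM (\<lambda>\<omega>. incr (T \<omega>) \<omega>)) C = emeasure (P x) (A \<inter> ((\<lambda>\<omega>. incr (T \<omega>) \<omega>) -` C \<inter> paths))"
    if "C \<in> sets pathM" for C
  proof -
    have V: "(\<lambda>\<omega>. incr (T \<omega>) \<omega>) -` C \<inter> paths \<in> sets (P x)" using measurable_sets[OF im' that] spP by simp
    have "emeasure (distr N pathM (\<lambda>\<omega>. incr (T \<omega>) \<omega>)) C = emeasure N ((\<lambda>\<omega>. incr (T \<omega>) \<omega>) -` C \<inter> paths)"
      by (subst emeasure_distr[OF imN that]) (simp add: N_def spP)
    also have "\<dots> = (\<integral>\<^sup>+\<omega>. indicator A \<omega> * indicator ((\<lambda>\<omega>. incr (T \<omega>) \<omega>) -` C \<inter> paths) \<omega> \<partial>P x)"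
      unfolding N_def using A V by (intro emeasure_density) auto
    also have "\<dots> = (\<integral>\<^sup>+\<omega>. indicator (A \<inter> ((\<lambda>\<omega>. incr (T \<omega>) \<omega>) -` C \<inter> paths)) \<omega> \<partial>P x)"
      by (intro nn_integral_cong) (simp add: indicator_def)
    also have "\<dots> = emeasure (P x) (A \<inter> ((\<lambda>\<omega>. incr (T \<omega>) \<omega>) -` C \<inter> paths))"
      using A V by (intro nn_integral_indicator) auto
    finally show ?thesis .
  qed
  have "distr N pathM (\<lambda>\<omega>. incr (T \<omega>) \<omega>) = scale_measure (emeasure (P x) A) (P 0)"
  proof (rule path_measure_eqI)
    show "finite_measure (distr N pathM (\<lambda>\<omega>. incr (T \<omega>) \<omega>))"
    proof (rule finite_measureI)
      have "space (distr N pathM (\<lambda>\<omega>. incr (T \<omega>) \<omega>)) = paths" by simp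
      moreover have "(paths :: (real \<Rightarrow> real^'n) set) \<in> sets pathM" using sets.top[of pathM] by simp
      ultimately show "emeasure (distr N pathM (\<lambda>\<omega>. incr (T \<omega>) \<omega>)) (space (distr N pathM (\<lambda>\<omega>. incr (T \<omega>) \<omega>))) \<noteq> \<infinity>"
        using N[of paths] by simp
    qed
    fix C :: "(real \<Rightarrow> real^'n) set" assume Cc: "C \<in> cyls"
    then have Cs: "C \<in> sets pathM" unfolding sets_pathM_cyls by (rule sigma_sets.Basic)
    obtain J B where C: "C = cyl J B" "finite J" "\<forall>t\<in>J. 0 \<le> t" "\<forall>t. closed (B t)"
      using Cc unfolding cyls_def by blast
    have "emeasure (P x) (A \<inter> ((\<lambda>\<omega>. incr (T \<omega>) \<omega>) -` C \<inter> paths)) = emeasure (P x) A * emeasure (P 0) C"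
    \<comment> \<open>As \<open>infdist v {} = 0\<close>, the function \<open>bump {}\<close> is
      constantly \<open>1\<close> and does not approximate the empty set; then the cylinder is empty
      anyway.\<close>
    proof (cases "\<exists>s\<in>J. B s = {}")
      case True
      then have "C = {}" unfolding C(1) cyl_def by auto
      then show ?thesis by simp
    next
      case False
      let ?h = "\<lambda>m \<omega>. ennreal (\<Prod>s\<in>J. bump (B s) m (\<omega> s))"
      have h: "?h m \<in> borel_measurable (pathM :: (real \<Rightarrow> real^'n) measure)" for m
        by (intro measurable_compose[OF _ measurable_ennreal] borel_measurable_prod
            measurable_compose[OF coord_measurable borel_measurable_continuous_onI[OF bump_props(1)]])
      have lim: "(\<lambda>m. ?h m \<omega>) \<longlonglongrightarrow> indicator C \<omega>" if "\<omega> \<in> paths" for \<omega>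
      proof -
        have "(\<lambda>m. (\<Prod>s\<in>J. bump (B s) m (\<omega> s))) \<longlonglongrightarrow> (\<Prod>s\<in>J. indicator (B s) (\<omega> s))"
          by (intro tendsto_prod bump_tendsto) (use C(4) False in auto)
        also have "(\<Prod>s\<in>J. indicator (B s) (\<omega> s)) = (indicator C \<omega> :: real)"
          using that C(2) by (auto simp: C(1) cyl_def indicator_def)
        finally have "(\<lambda>m. ?h m \<omega>) \<longlonglongrightarrow> ennreal (indicator C \<omega>)" by (rule tendsto_ennrealI)
        then show ?thesis by (simp add: ennreal_indicator)
      qed
      have le1: "?h m \<omega> \<le> 1" for m \<omega>
        by (simp add: prod_le_1 bump_props(2,3))
      have "(\<lambda>m. \<integral>\<^sup>+\<omega>. indicator A \<omega> * ?h m (incr (T \<omega>) \<omega>) \<partial>P x) \<longlonglongrightarrow>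
          (\<integral>\<^sup>+\<omega>. indicator A \<omega> * indicator C (incr (T \<omega>) \<omega>) \<partial>P x)"
      proof (rule nn_integral_dominated_convergence[where w="\<lambda>_. 1"])
        show "(\<lambda>\<omega>. indicator A \<omega> * ?h m (incr (T \<omega>) \<omega>)) \<in> borel_measurable (P x)" for m
          using measurable_compose[OF im' h[of m]] A by (intro borel_measurable_times_ennreal) auto
        show "(\<lambda>\<omega>. indicator A \<omega> * (indicator C (incr (T \<omega>) \<omega>) :: ennreal)) \<in> borel_measurable (P x)"
          using measurable_compose[OF im' borel_measurable_indicator[OF Cs]] A by (intro borel_measurable_times_ennreal) auto
        show "AE \<omega> in P x. indicator A \<omega> * ?h m (incr (T \<omega>) \<omega>) \<le> 1" for m
          using le1 by (intro AE_I2) (auto simp: indicator_def)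
        show "AE \<omega> in P x. (\<lambda>m. indicator A \<omega> * ?h m (incr (T \<omega>) \<omega>)) \<longlonglongrightarrow> indicator A \<omega> * indicator C (incr (T \<omega>) \<omega>)"
        proof (rule AE_I2)
          fix \<omega> assume "\<omega> \<in> space (P x)"
          then have "(\<lambda>m. ?h m (incr (T \<omega>) \<omega>)) \<longlonglongrightarrow> indicator C (incr (T \<omega>) \<omega>)"
            by (intro lim incr_paths) (simp add: spP)
          then show "(\<lambda>m. indicator A \<omega> * ?h m (incr (T \<omega>) \<omega>)) \<longlonglongrightarrow> indicator A \<omega> * indicator C (incr (T \<omega>) \<omega>)"
            by (cases "\<omega> \<in> A") simp_all
        qed
      qed (auto simp: emeasure_space_1)
      moreover have "(\<integral>\<^sup>+\<omega>. indicator A \<omega> * ?h m (incr (T \<omega>) \<omega>) \<partial>P x) = emeasure (P x) A * (\<integral>\<^sup>+\<omega>. ?h m \<omega> \<partial>P 0)" for m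
        by (rule strong_markov_cylinder_function[OF P st C(2,3) bump_props])
      moreover have "(\<lambda>m. emeasure (P x) A * (\<integral>\<^sup>+\<omega>. ?h m \<omega> \<partial>P 0)) \<longlonglongrightarrow> emeasure (P x) A * (\<integral>\<^sup>+\<omega>. indicator C \<omega> \<partial>P 0)"
      proof (intro ennreal_tendsto_cmult)
        show "emeasure (P x) A < top" using emeasure_finite[of A] by (simp add: less_top[symmetric])
        show "(\<lambda>m. \<integral>\<^sup>+\<omega>. ?h m \<omega> \<partial>P 0) \<longlonglongrightarrow> (\<integral>\<^sup>+\<omega>. indicator C \<omega> \<partial>P 0)"
          by (rule nn_integral_dominated_convergence[where w="\<lambda>_. 1"])
             (use h le1 lim Cs sP in \<open>auto simp: P0.emeasure_space_1[unfolded spP] spP mP\<close>)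
      qed
      ultimately have "(\<integral>\<^sup>+\<omega>. indicator A \<omega> * indicator C (incr (T \<omega>) \<omega>) \<partial>P x) = emeasure (P x) A * (\<integral>\<^sup>+\<omega>. indicator C \<omega> \<partial>P 0)"
        using LIMSEQ_unique by auto
      moreover have "(\<integral>\<^sup>+\<omega>. indicator A \<omega> * indicator C (incr (T \<omega>) \<omega>) \<partial>P x) = emeasure (P x) (A \<inter> ((\<lambda>\<omega>. incr (T \<omega>) \<omega>) -` C \<inter> paths))"
      proof -
        have "(\<integral>\<^sup>+\<omega>. indicator A \<omega> * indicator C (incr (T \<omega>) \<omega>) \<partial>P x) = (\<integral>\<^sup>+\<omega>. indicator (A \<inter> ((\<lambda>\<omega>. incr (T \<omega>) \<omega>) -` C \<inter> paths)) \<omega> \<partial>P x)"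
          by (intro nn_integral_cong) (simp add: indicator_def spP)
        then show ?thesis using A measurable_sets[OF im' Cs] by (simp add: spP)
      qed
      ultimately show ?thesis using Cs sP by simp
    qed
    then show "emeasure (distr N pathM (\<lambda>\<omega>. incr (T \<omega>) \<omega>)) C = emeasure (scale_measure (emeasure (P x) A) (P 0)) C"
      using N[OF Cs] by simp
  qed (use sP in auto)
  then show ?thesis using N[OF C] by simp
qed

text \<open>On \<open>A\<close> the stopped path and the recentred future have a product law.
  \<open>g\<close> is a function of the former, the shifted path is the end point plus the latter,
  and Fubini with translation invariance turns the inner integral into one under
  \<open>P (\<omega> (T \<omega>))\<close>.\<close>

lemma strong_markov_nn:
  fixes P :: "real^'n \<Rightarrow> (real \<Rightarrow> real^'n) measure"
  assumes P: "is_wiener P" and st: "stopping A T"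
    and g: "g \<in> borel_measurable pathM"
    and g_adapted: "\<And>\<omega> \<omega>'. \<omega> \<in> A \<Longrightarrow> \<omega>' \<in> paths \<Longrightarrow> agree (T \<omega>) \<omega> \<omega>' \<Longrightarrow> g \<omega>' = g \<omega>"
    and f: "f \<in> borel_measurable pathM"
  shows "(\<integral>\<^sup>+\<omega>. indicator A \<omega> * (g \<omega> * f (pshift (T \<omega>) \<omega>)) \<partial>P x) =
    (\<integral>\<^sup>+\<omega>. indicator A \<omega> * (g \<omega> * (\<integral>\<^sup>+\<omega>'. f \<omega>' \<partial>P (\<omega> (T \<omega>)))) \<partial>P x)"
proof -
  interpret prob_space "P x" by (rule is_wienerD(1)[OF P])
  interpret P0: prob_space "P 0" by (rule is_wienerD(1)[OF P])
  note mP = wiener_measurable_sets[OF P]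
  note spP = is_wienerD(3)[OF P] and sP = is_wienerD(2)[OF P]
  have A: "A \<in> sets (P x)" using stoppingD(1)[OF st] sP by simp
  define N where "N = density (P x) (indicator A :: _ \<Rightarrow> ennreal)"
  have spN: "space N = paths" by (simp add: N_def spP)
  have NE: "emeasure N B = emeasure (P x) (A \<inter> B)" if "B \<in> sets pathM" for B
  proof -
    have "emeasure N B = (\<integral>\<^sup>+\<omega>. indicator A \<omega> * indicator B \<omega> \<partial>P x)"
      unfolding N_def by (rule emeasure_density[OF borel_measurable_indicator[OF A]]) (use that sP in simp)
    also have "\<dots> = (\<integral>\<^sup>+\<omega>. indicator (A \<inter> B) \<omega> \<partial>P x)"
      by (intro nn_integral_cong) (simp add: indicator_def)
    also have "\<dots> = emeasure (P x) (A \<inter> B)" using A that sP by (intro nn_integral_indicator) auto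
    finally show ?thesis .
  qed
  have NI: "(\<integral>\<^sup>+\<omega>. h \<omega> \<partial>N) = (\<integral>\<^sup>+\<omega>. indicator A \<omega> * h \<omega> \<partial>P x)" if "h \<in> borel_measurable pathM" for h
    unfolding N_def by (rule nn_integral_density[OF borel_measurable_indicator[OF A]]) (use that in \<open>simp add: mP\<close>)
  have mN: "measurable N L = measurable pathM L" for L :: "'c measure"
    by (rule measurable_cong_sets) (simp_all add: N_def sP)
  define S where "S = (\<lambda>\<omega>. stop_path (T \<omega>) \<omega>)"
  define I where "I = (\<lambda>\<omega>. incr (T \<omega>) \<omega>)"
  have S: "S \<in> measurable pathM pathM" unfolding S_def by (rule stop_measurable) (use stoppingD(2)[OF st] in auto)
  have I: "I \<in> measurable pathM pathM" unfolding I_def by (rule incr_stopping_measurable[OF stoppingD(2)[OF st]])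
  have SN: "S \<in> measurable N pathM" and IN: "I \<in> measurable N pathM" using S I by (simp_all add: mN)
  have fN: "finite_measure N"
    by (rule finite_measureI) (use NE[of paths] spN sets.top[of "pathM :: (real \<Rightarrow> real^'n) measure"] in simp)
  have fM1: "finite_measure (distr N pathM S)" by (rule finite_measure.finite_measure_distr[OF fN SN])
  have pair: "distr N pathM S \<Otimes>\<^sub>M P 0 = distr N (pathM \<Otimes>\<^sub>M pathM) (\<lambda>\<omega>. (S \<omega>, I \<omega>))"
  proof (rule pair_measure_eqI)
    show "sigma_finite_measure (distr N pathM S)" by (rule finite_measure.sigma_finite_measure[OF fM1])
    show "sigma_finite_measure (P 0)" by unfold_locales
    show "sets (distr N pathM S \<Otimes>\<^sub>M P 0) = sets (distr N (pathM \<Otimes>\<^sub>M pathM) (\<lambda>\<omega>. (S \<omega>, I \<omega>)))"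
      using sP[of 0] by (simp cong: sets_pair_measure_cong)
    fix B C assume "B \<in> sets (distr N pathM S)" "C \<in> sets (P 0)"
    then have B: "B \<in> sets pathM" and C: "C \<in> sets pathM" using sP by auto
    have SB: "S -` B \<inter> paths \<in> sets pathM" using measurable_sets[OF S B] by simp
    have IC: "I -` C \<inter> paths \<in> sets pathM" using measurable_sets[OF I C] by simp
    \<comment> \<open>A constraint on the stopped path is known at time \<open>T\<close>, so it can
      be absorbed into the stopping event, to which \<open>strong_markov_incr\<close>
      applies.\<close>
    have st': "stopping (A \<inter> (S -` B \<inter> paths)) T"
      unfolding stopping_def
    proof (intro conjI ballI impI)
      show "A \<inter> (S -` B \<inter> paths) \<in> sets pathM" using SB stoppingD(1)[OF st] by blast
      show "T \<in> borel_measurable pathM" by (rule stoppingD(2)[OF st])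
      fix \<omega> assume w: "\<omega> \<in> A \<inter> (S -` B \<inter> paths)"
      then show T0: "0 \<le> T \<omega>" using stoppingD(3)[OF st] by blast
      fix \<omega>' assume w': "\<omega>' \<in> paths" "agree (T \<omega>) \<omega> \<omega>'"
      show "T \<omega>' = T \<omega>" using stoppingD(6)[OF st] w w' by blast
      then have "S \<omega>' = S \<omega>" unfolding S_def using stopping_le_eq[of \<omega> \<omega>' "T \<omega>"] w w' T0 by simp
      then show "\<omega>' \<in> A \<inter> (S -` B \<inter> paths)" using stoppingD(5)[OF st] w w' by auto
    qed
    have "emeasure (distr N (pathM \<Otimes>\<^sub>M pathM) (\<lambda>\<omega>. (S \<omega>, I \<omega>))) (B \<times> C)
        = emeasure N ((\<lambda>\<omega>. (S \<omega>, I \<omega>)) -` (B \<times> C) \<inter> space N)"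
      by (rule emeasure_distr) (use SN IN B C in auto)
    also have "(\<lambda>\<omega>. (S \<omega>, I \<omega>)) -` (B \<times> C) \<inter> space N = (S -` B \<inter> paths) \<inter> (I -` C \<inter> paths)"
      by (auto simp: spN)
    also have "emeasure N \<dots> = emeasure (P x) ((A \<inter> (S -` B \<inter> paths)) \<inter> (I -` C \<inter> paths))"
      by (subst NE[OF sets.Int[OF SB IC]]) (simp only: Int_assoc)
    also have "\<dots> = emeasure (P x) (A \<inter> (S -` B \<inter> paths)) * emeasure (P 0) C"
      unfolding I_def by (rule strong_markov_incr[OF P st' C])
    also have "emeasure (P x) (A \<inter> (S -` B \<inter> paths)) = emeasure (distr N pathM S) B"
      by (subst emeasure_distr[OF SN B]) (simp add: spN NE[OF SB])
    finally show "emeasure (distr N pathM S) B * emeasure (P 0) C =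
      emeasure (distr N (pathM \<Otimes>\<^sub>M pathM) (\<lambda>\<omega>. (S \<omega>, I \<omega>))) (B \<times> C)" ..
  qed
  \<comment> \<open>The integrand as a function of the pair (past, future increments); the first
    component knows \<open>T\<close> and the end point because stopping at \<open>T\<close>
    preserves both.\<close>
  define F where "F p = g (fst p) * f (\<lambda>s. fst p (T (fst p)) + snd p s)" for p
  have e: "(\<lambda>\<omega>. \<omega> (T \<omega>)) \<in> borel_measurable pathM"
    by (rule measurable_eval) (use stoppingD(2)[OF st] in auto)
  have Fm: "F \<in> borel_measurable (pathM \<Otimes>\<^sub>M pathM)"
    unfolding F_def
  proof (intro borel_measurable_times_ennreal)
    show "(\<lambda>p. g (fst p)) \<in> borel_measurable (pathM \<Otimes>\<^sub>M pathM)" by (rule measurable_compose[OF measurable_fst g])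
    have "(\<lambda>p s. fst p (T (fst p)) + snd p s) \<in> measurable (pathM \<Otimes>\<^sub>M pathM) (pathM :: (real \<Rightarrow> real^'n) measure)"
      by (rule plus_measurable[OF measurable_snd measurable_compose[OF measurable_fst e]])
    from measurable_compose[OF this f]
    show "(\<lambda>p. f (\<lambda>s. fst p (T (fst p)) + snd p s)) \<in> borel_measurable (pathM \<Otimes>\<^sub>M pathM)" .
  qed
  have Fm': "F \<in> borel_measurable (distr N pathM S \<Otimes>\<^sub>M P 0)"
    using Fm sP[of 0] measurable_cong_sets[OF sets_pair_measure_cong[of "distr N pathM S" pathM "P 0" pathM] refl] by simp
  have on_A: "g (S \<omega>) = g \<omega>" "T (S \<omega>) = T \<omega>" "S \<omega> (T \<omega>) = \<omega> (T \<omega>)" if "\<omega> \<in> A" for \<omega>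
    using stoppingD(6)[OF st that stop_paths[OF stoppingD(4)[OF st that]] agree_stop[of "T \<omega>" \<omega>]]
      g_adapted[OF that stop_paths[OF stoppingD(4)[OF st that]] agree_stop[of "T \<omega>" \<omega>]]
    by (simp_all add: S_def) (simp add: stop_path_def)
  have "(\<integral>\<^sup>+p. F p \<partial>distr N (pathM \<Otimes>\<^sub>M pathM) (\<lambda>\<omega>. (S \<omega>, I \<omega>))) = (\<integral>\<^sup>+\<omega>. F (S \<omega>, I \<omega>) \<partial>N)"
    by (rule nn_integral_distr) (use SN IN Fm in auto)
  also have "\<dots> = (\<integral>\<^sup>+\<omega>. indicator A \<omega> * F (S \<omega>, I \<omega>) \<partial>P x)"
    by (rule NI, rule measurable_compose[OF _ Fm]) (use S I in auto)
  also have "\<dots> = (\<integral>\<^sup>+\<omega>. indicator A \<omega> * (g \<omega> * f (pshift (T \<omega>) \<omega>)) \<partial>P x)"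
    by (intro nn_integral_cong) (auto simp: indicator_def F_def on_A pshift_eq_incr I_def)
  finally have 1: "(\<integral>\<^sup>+p. F p \<partial>distr N (pathM \<Otimes>\<^sub>M pathM) (\<lambda>\<omega>. (S \<omega>, I \<omega>))) = \<dots>" .
  have fst_m: "(\<lambda>\<omega>. \<integral>\<^sup>+\<omega>2. F (\<omega>, \<omega>2) \<partial>P 0) \<in> borel_measurable pathM"
  proof -
    have "F \<in> borel_measurable (pathM \<Otimes>\<^sub>M P 0)"
      using Fm sP[of 0] measurable_cong_sets[OF sets_pair_measure_cong[of pathM pathM "P 0" pathM] refl] by simp
    then show ?thesis by (rule P0.borel_measurable_nn_integral_fst)
  qed
  have "(\<integral>\<^sup>+p. F p \<partial>(distr N pathM S \<Otimes>\<^sub>M P 0)) = (\<integral>\<^sup>+\<omega>. (\<integral>\<^sup>+\<omega>2. F (\<omega>, \<omega>2) \<partial>P 0) \<partial>distr N pathM S)"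
    by (rule P0.nn_integral_fst[OF Fm', symmetric])
  also have "\<dots> = (\<integral>\<^sup>+\<omega>. (\<integral>\<^sup>+\<omega>2. F (S \<omega>, \<omega>2) \<partial>P 0) \<partial>N)"
    by (rule nn_integral_distr[OF SN]) (use fst_m in simp)
  also have "\<dots> = (\<integral>\<^sup>+\<omega>. indicator A \<omega> * (\<integral>\<^sup>+\<omega>2. F (S \<omega>, \<omega>2) \<partial>P 0) \<partial>P x)"
    by (rule NI, rule measurable_compose[OF S fst_m])
  also have "\<dots> = (\<integral>\<^sup>+\<omega>. indicator A \<omega> * (g \<omega> * (\<integral>\<^sup>+\<omega>'. f \<omega>' \<partial>P (\<omega> (T \<omega>)))) \<partial>P x)"
  proof (intro nn_integral_cong)
    fix \<omega>
    show "indicator A \<omega> * (\<integral>\<^sup>+\<omega>2. F (S \<omega>, \<omega>2) \<partial>P 0) = indicator A \<omega> * (g \<omega> * (\<integral>\<^sup>+\<omega>'. f \<omega>' \<partial>P (\<omega> (T \<omega>))))"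
    proof (cases "\<omega> \<in> A")
      case True
      let ?y = "\<omega> (T \<omega>)"
      have tm: "(\<lambda>\<omega>2 s. (?y - 0) + \<omega>2 s) \<in> measurable (P 0) pathM"
        unfolding mP by (rule plus_measurable) auto
      have "(\<integral>\<^sup>+\<omega>2. F (S \<omega>, \<omega>2) \<partial>P 0) = (\<integral>\<^sup>+\<omega>2. g \<omega> * f (\<lambda>s. (?y - 0) + \<omega>2 s) \<partial>P 0)"
        by (simp add: F_def on_A[OF True])
      also have "\<dots> = g \<omega> * (\<integral>\<^sup>+\<omega>2. f (\<lambda>s. (?y - 0) + \<omega>2 s) \<partial>P 0)"
        by (rule nn_integral_cmult[OF measurable_compose[OF tm f]])
      also have "(\<integral>\<^sup>+\<omega>2. f (\<lambda>s. (?y - 0) + \<omega>2 s) \<partial>P 0) = (\<integral>\<^sup>+\<omega>'. f \<omega>' \<partial>P ?y)"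
        unfolding wiener_translate[OF P, of ?y 0] by (rule nn_integral_distr[OF tm, symmetric]) (use f in simp)
      finally show ?thesis by simp
    qed simp
  qed
  finally show ?thesis using 1 pair by simp
qed

lemma wiener_integrable:
  fixes P :: "real^'n \<Rightarrow> (real \<Rightarrow> real^'n) measure"
  assumes P: "is_wiener P" and f: "f \<in> borel_measurable pathM" and b: "\<And>\<omega>. \<omega> \<in> paths \<Longrightarrow> 0 \<le> f \<omega> \<and> f \<omega> \<le> (B::real)"
  shows "integrable (P x) f" "ennreal (\<integral>\<omega>. f \<omega> \<partial>P x) = (\<integral>\<^sup>+\<omega>. ennreal (f \<omega>) \<partial>P x)"
proof -
  interpret prob_space "P x" by (rule is_wienerD(1)[OF P])
  show i: "integrable (P x) f"
    by (rule integrable_const_bound[where B=B])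
       (use b f in \<open>auto simp: wiener_measurable_sets[OF P] is_wienerD(3)[OF P] intro!: AE_I2\<close>)
  show "ennreal (\<integral>\<omega>. f \<omega> \<partial>P x) = (\<integral>\<^sup>+\<omega>. ennreal (f \<omega>) \<partial>P x)"
    by (rule nn_integral_eq_integral[OF i, symmetric]) (use b is_wienerD(3)[OF P] in \<open>auto intro!: AE_I2\<close>)
qed

text \<open>The form used from here on. Comparing with a given measurable \<open>b\<close> avoids
  any question about how the expectation under \<open>P y\<close> depends on
  \<open>y\<close>.\<close>

lemma strong_markov_le:
  fixes P :: "real^'n \<Rightarrow> (real \<Rightarrow> real^'n) measure"
  assumes P: "is_wiener P" and st: "stopping A T"
    and g: "g \<in> borel_measurable pathM" "\<And>\<omega>. \<omega> \<in> paths \<Longrightarrow> 0 \<le> g \<omega> \<and> g \<omega> \<le> 1"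
    and g_adapted: "\<And>\<omega> \<omega>'. \<omega> \<in> A \<Longrightarrow> \<omega>' \<in> paths \<Longrightarrow> agree (T \<omega>) \<omega> \<omega>' \<Longrightarrow> g \<omega>' = g \<omega>"
    and f: "f \<in> borel_measurable pathM" "\<And>\<omega>. \<omega> \<in> paths \<Longrightarrow> 0 \<le> f \<omega> \<and> f \<omega> \<le> 1"
    and b: "b \<in> borel_measurable pathM" "\<And>\<omega>. \<omega> \<in> paths \<Longrightarrow> 0 \<le> b \<omega> \<and> b \<omega> \<le> B"
    and le: "\<And>\<omega>. \<omega> \<in> A \<Longrightarrow> (\<integral>\<omega>'. f \<omega>' \<partial>P (\<omega> (T \<omega>))) \<le> b \<omega>"
  shows "(\<integral>\<omega>. indicator A \<omega> * (g \<omega> * f (pshift (T \<omega>) \<omega>)) \<partial>P x) \<le> (\<integral>\<omega>. indicator A \<omega> * (g \<omega> * b \<omega>) \<partial>P x :: real)"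
proof -
  have ps: "(\<lambda>\<omega>. pshift (T \<omega>) \<omega>) \<in> measurable pathM (pathM :: (real \<Rightarrow> real^'n) measure)"
    by (rule pshift_measurable) (use stoppingD(2)[OF st] in auto)
  have iA: "indicator A \<in> borel_measurable pathM" by (rule borel_measurable_indicator[OF stoppingD(1)[OF st]])
  have 1: "(\<lambda>\<omega>. indicator A \<omega> * (g \<omega> * f (pshift (T \<omega>) \<omega>))) \<in> borel_measurable pathM"
    by (intro borel_measurable_times iA g(1) measurable_compose[OF ps f(1)])
  have 2: "(\<lambda>\<omega>. indicator A \<omega> * (g \<omega> * b \<omega>)) \<in> borel_measurable pathM"
    by (intro borel_measurable_times iA g(1) b(1))
  have 3: "0 \<le> indicator A \<omega> * (g \<omega> * f (pshift (T \<omega>) \<omega>)) \<and> indicator A \<omega> * (g \<omega> * f (pshift (T \<omega>) \<omega>)) \<le> 1" if "\<omega> \<in> paths" for \<omega>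
    using g(2)[OF that] f(2)[OF pshift_paths[OF that]] by (auto simp: indicator_def mult_le_one)
  have 4: "0 \<le> indicator A \<omega> * (g \<omega> * b \<omega>) \<and> indicator A \<omega> * (g \<omega> * b \<omega>) \<le> B" if "\<omega> \<in> paths" for \<omega>
  proof -
    have "g \<omega> * b \<omega> \<le> 1 * B" using g(2)[OF that] b(2)[OF that] by (intro mult_mono) auto
    then show ?thesis using g(2)[OF that] b(2)[OF that] by (auto simp: indicator_def)
  qed
  have "ennreal (\<integral>\<omega>. indicator A \<omega> * (g \<omega> * f (pshift (T \<omega>) \<omega>)) \<partial>P x) = (\<integral>\<^sup>+\<omega>. ennreal (indicator A \<omega> * (g \<omega> * f (pshift (T \<omega>) \<omega>))) \<partial>P x)"
    by (rule wiener_integrable(2)[OF P 1 3])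
  also have "\<dots> = (\<integral>\<^sup>+\<omega>. indicator A \<omega> * (ennreal (g \<omega>) * ennreal (f (pshift (T \<omega>) \<omega>))) \<partial>P x)"
  proof (rule nn_integral_cong)
    fix \<omega> assume "\<omega> \<in> space (P x)"
    then have w: "\<omega> \<in> paths" using is_wienerD(3)[OF P] by simp
    show "ennreal (indicator A \<omega> * (g \<omega> * f (pshift (T \<omega>) \<omega>))) = indicator A \<omega> * (ennreal (g \<omega>) * ennreal (f (pshift (T \<omega>) \<omega>)))"
      using g(2)[OF w] by (cases "\<omega> \<in> A") (simp_all add: ennreal_mult')
  qed
  also have "\<dots> = (\<integral>\<^sup>+\<omega>. indicator A \<omega> * (ennreal (g \<omega>) * (\<integral>\<^sup>+\<omega>'. ennreal (f \<omega>') \<partial>P (\<omega> (T \<omega>)))) \<partial>P x)"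
    by (rule strong_markov_nn[OF P st]) (use g f g_adapted in auto)
  also have "\<dots> \<le> (\<integral>\<^sup>+\<omega>. ennreal (indicator A \<omega> * (g \<omega> * b \<omega>)) \<partial>P x)"
  proof (rule nn_integral_mono)
    fix \<omega> assume "\<omega> \<in> space (P x)"
    then have w: "\<omega> \<in> paths" using is_wienerD(3)[OF P] by simp
    show "indicator A \<omega> * (ennreal (g \<omega>) * (\<integral>\<^sup>+\<omega>'. ennreal (f \<omega>') \<partial>P (\<omega> (T \<omega>)))) \<le> ennreal (indicator A \<omega> * (g \<omega> * b \<omega>))"
    proof (cases "\<omega> \<in> A")
      case True
      have "(\<integral>\<^sup>+\<omega>'. ennreal (f \<omega>') \<partial>P (\<omega> (T \<omega>))) = ennreal (\<integral>\<omega>'. f \<omega>' \<partial>P (\<omega> (T \<omega>)))"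
        by (rule wiener_integrable(2)[OF P f, symmetric])
      also have "\<dots> \<le> ennreal (b \<omega>)" using le[OF True] by (rule ennreal_leI)
      finally show ?thesis using True g(2)[OF w] by (simp add: ennreal_mult' mult_left_mono)
    qed simp
  qed
  also have "\<dots> = ennreal (\<integral>\<omega>. indicator A \<omega> * (g \<omega> * b \<omega>) \<partial>P x)"
    by (rule wiener_integrable(2)[OF P 2 4, symmetric])
  finally show ?thesis
    by (subst (asm) ennreal_le_iff) (auto intro!: integral_nonneg_AE AE_I2 simp: 4 is_wienerD(3)[OF P])
qed

section \<open>The sup-norm\<close>

lemma supn_le_iff: "supn x \<le> r \<longleftrightarrow> (\<forall>i. \<bar>x $ i\<bar> \<le> r)"
  unfolding supn_def by (subst Max_le_iff) auto

lemma abs_le_supn: "\<bar>x $ i\<bar> \<le> supn x"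
  using supn_le_iff[of x "supn x"] by simp

lemma supn_nonneg: "0 \<le> supn x"
  using abs_le_supn[of x undefined] by linarith

lemma supn_zero [simp]: "supn 0 = 0"
  by (rule antisym) (simp_all add: supn_le_iff supn_nonneg)

lemma supn_triangle: "supn (x + y) \<le> supn x + supn y"
  unfolding supn_le_iff
proof
  fix i show "\<bar>(x + y) $ i\<bar> \<le> supn x + supn y" using abs_le_supn[of x i] abs_le_supn[of y i] by simp
qed

lemma supn_minus: "supn (- x) = supn x"
  unfolding supn_def by simp

lemma supn_commute: "supn (x - y) = supn (y - x)"
  using supn_minus[of "x - y"] by simp

lemma supn_triangle_diff: "supn (x - z) \<le> supn (x - y) + supn (y - z)"
  using supn_triangle[of "x - y" "y - z"] by simp

lemma supn_scaleR: "0 \<le> c \<Longrightarrow> supn (c *\<^sub>R x) = c * supn x"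
proof (rule antisym)
  assume c: "0 \<le> c"
  show "supn (c *\<^sub>R x) \<le> c * supn x"
    unfolding supn_le_iff using c abs_le_supn[of x] by (auto simp: abs_mult mult_left_mono)
  show "c * supn x \<le> supn (c *\<^sub>R x)"
  proof (cases "c = 0")
    case True then show ?thesis by (simp add: supn_nonneg)
  next
    case False
    then have c0: "0 < c" using c by simp
    have "supn x \<le> supn (c *\<^sub>R x) / c"
      unfolding supn_le_iff
    proof
      fix i
      have "c * \<bar>x $ i\<bar> \<le> supn (c *\<^sub>R x)" using abs_le_supn[of "c *\<^sub>R x" i] c by (simp add: abs_mult)
      then show "\<bar>x $ i\<bar> \<le> supn (c *\<^sub>R x) / c" using c0 by (simp add: pos_le_divide_eq mult.commute)
    qed
    then show ?thesis using c0 by (simp add: pos_le_divide_eq mult.commute)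
  qed
qed

lemma supn_le_norm: "supn x \<le> norm x"
  unfolding supn_le_iff using component_le_norm_cart by blast

text \<open>Kept in squared form because it is applied to the exponent of the Gaussian
  density.\<close>

lemma norm_le_supn: "(norm (x :: real^'n))\<^sup>2 \<le> real CARD('n) * (supn x)\<^sup>2"
proof -
  have "(norm x)\<^sup>2 = (\<Sum>i\<in>UNIV. (x $ i)\<^sup>2)"
    by (simp add: norm_vec_def L2_set_def sum_nonneg)
  also have "\<dots> \<le> (\<Sum>i\<in>(UNIV :: 'n set). (supn x)\<^sup>2)"
    by (intro sum_mono) (use abs_le_supn[of x] supn_nonneg[of x] in \<open>auto simp: abs_le_square_iff[symmetric]\<close>)
  finally show ?thesis by simp
qed

lemma continuous_supn: "continuous_on UNIV (supn :: real^'n \<Rightarrow> real)"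
proof (rule continuous_on_eq_continuous_at[THEN iffD2, OF open_UNIV], rule ballI)
  fix x :: "real^'n"
  have "(supn \<longlongrightarrow> supn x) (at x)"
  proof (rule Lim_null[THEN iffD2], rule Lim_null_comparison)
    show "\<forall>\<^sub>F y in at x. norm (supn y - supn x) \<le> norm (y - x)"
    proof (intro always_eventually allI)
      fix y
      show "norm (supn y - supn x) \<le> norm (y - x)"
        using supn_triangle[of "y - x" x] supn_triangle[of "x - y" y] supn_le_norm[of "y - x"] supn_commute[of x y]
        by (simp add: abs_le_iff)
    qed
    show "((\<lambda>y. norm (y - x)) \<longlongrightarrow> 0) (at x)"
      by (intro tendsto_norm_zero) (use LIM_zero[OF tendsto_ident_at] in auto)
  qed
  then show "isCont supn x" by (simp add: isCont_def)
qed

text \<open>Sup-norm balls are boxes: volume, closedness, compactness and Borel measurability are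
  read off from \<open>cbox\<close>.\<close>

lemma sball_eq_cbox: "sball x r = cbox (x - (\<chi> i. r)) (x + (\<chi> i. r))"
  unfolding sball_def supn_le_iff by (auto simp: mem_box_cart abs_le_iff algebra_simps)

lemma measure_sball: "0 \<le> r \<Longrightarrow> measure lborel (sball (x :: real^'n) r) = (2 * r) ^ CARD('n)"
proof -
  assume r: "0 \<le> r"
  have "measure lborel (sball x r) = (\<Prod>i\<in>UNIV. (x + (\<chi> i. r)) $ i - (x - (\<chi> i. r)) $ i)"
    unfolding sball_eq_cbox using r by (subst content_cbox_cart[symmetric]) (auto simp: interval_ne_empty_cart)
  then show ?thesis by simp
qed

lemma closed_sball: "closed (sball x r)" unfolding sball_eq_cbox by (rule closed_cbox)

lemma sball_borel [measurable, simp]: "sball x r \<in> sets borel" unfolding sball_eq_cbox by simp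

lemma emeasure_sball: "0 \<le> r \<Longrightarrow> emeasure lborel (sball (x :: real^'n) r) = ennreal ((2 * r) ^ CARD('n))"
  using measure_sball[of r x] unfolding sball_eq_cbox
  by (subst emeasure_eq_ennreal_measure) (use emeasure_lborel_cbox_finite in \<open>auto simp: less_top\<close>)

section \<open>Local densities\<close>

text \<open>\<open>sigma_hat\<close> for arbitrary real radii, with the volume of the ball written
  out. The enlarged balls of the resonance argument leave the dyadic radii.\<close>

definition outer_density :: "(real^'n) set \<Rightarrow> real \<Rightarrow> real^'n \<Rightarrow> real" where
  "outer_density U r x = measure lborel (sball x r \<inter> - U) / (2 * r) ^ CARD('n)"

lemma sball_fmeasurable: "sball x r \<inter> V \<in> fmeasurable lborel" if "V \<in> sets borel"
proof (rule fmeasurable_Int_fmeasurable)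
  show "sball x r \<in> fmeasurable lborel" unfolding sball_eq_cbox by simp
qed (use that in simp)

lemma sigma_hat_eq_outer_density:
  assumes "U \<in> sets borel"
  shows "sigma_hat U l x = outer_density U (2 powr (- real_of_int l)) x"
proof -
  have "measure lebesgue (sball x r \<inter> (UNIV - U)) = measure lborel (sball x r \<inter> - U)" for r
    using assms by (subst measure_completion) (auto simp: Compl_eq_Diff_UNIV)
  moreover have "measure lebesgue (sball x (2 powr (- real_of_int l))) = (2 * 2 powr (- real_of_int l)) ^ CARD('a)"
    by (subst measure_completion) (auto simp: measure_sball)
  ultimately show ?thesis by (simp add: sigma_hat_def outer_density_def)
qed

lemma sball_subset: "supn (x - y) + r \<le> R \<Longrightarrow> sball x r \<subseteq> sball y R"
proof
  fix z assume "supn (x - y) + r \<le> R" "z \<in> sball x r"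
  then show "z \<in> sball y R" using supn_triangle_diff[of z y x] by (simp add: sball_def)
qed

lemma outer_density_compl:
  fixes U :: "(real^'n) set"
  assumes "U \<in> sets borel" "0 < r"
  shows "outer_density (- U) r x = 1 - outer_density U r x"
proof -
  have "measure lborel (sball x r) = measure lborel ((sball x r \<inter> U) \<union> (sball x r \<inter> - U))"
    by (rule arg_cong[where f="measure lborel"]) auto
  also have "\<dots> = measure lborel (sball x r \<inter> U) + measure lborel (sball x r \<inter> - U)"
    using sball_fmeasurable[OF assms(1), of x r] sball_fmeasurable[OF borel_comp[OF assms(1)], of x r]
    by (subst measure_Un3) auto
  finally have "measure lborel (sball x r \<inter> U) + measure lborel (sball x r \<inter> - U) = (2 * r) ^ CARD('n)"
    using measure_sball[of r x] assms by simp
  then show ?thesis using assms(2) by (simp add: outer_density_def field_simps)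
qed

lemma outer_density_scale_le:
  fixes U :: "(real^'n) set"
  assumes "U \<in> sets borel" "0 < r" "supn (x - y) + r \<le> R"
  shows "(r / R) ^ CARD('n) * outer_density U r x \<le> outer_density U R y"
proof -
  have R: "0 < R" using assms supn_nonneg[of "x - y"] by linarith
  have "measure lborel (sball x r \<inter> - U) \<le> measure lborel (sball y R \<inter> - U)"
    by (rule measure_mono_fmeasurable[OF _ _ sball_fmeasurable]) (use assms sball_subset[OF assms(3)] in auto)
  then have "measure lborel (sball x r \<inter> - U) / (2 * R) ^ CARD('n) \<le> outer_density U R y"
    unfolding outer_density_def using R by (intro divide_right_mono) auto
  moreover have "(r / R) ^ CARD('n) * outer_density U r x = measure lborel (sball x r \<inter> - U) / (2 * R) ^ CARD('n)"
    unfolding outer_density_def using assms(2) R by (simp add: power_divide power_mult_distrib)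
  ultimately show ?thesis by simp
qed

text \<open>The smaller ball fills the fraction \<open>(r / R) ^ d\<close> of the larger one.
  Monotonicity of volume is applied to \<open>U\<close> and to its complement, so being away from
  \<open>0\<close> and being away from \<open>1\<close> are both inherited.\<close>

lemma outer_density_between:
  fixes U :: "(real^'n) set"
  assumes U: "U \<in> sets borel" "0 < r" "supn (x - y) + r \<le> R"
    and a: "\<alpha> \<le> outer_density U r x" "outer_density U r x \<le> 1 - \<alpha>"
  shows "(r / R) ^ CARD('n) * \<alpha> \<le> outer_density U R y" "outer_density U R y \<le> 1 - (r / R) ^ CARD('n) * \<alpha>"
proof -
  have R: "0 < R" using assms supn_nonneg[of "x - y"] by linarith
  then have c: "0 \<le> (r / R) ^ CARD('n)" using U(2) by simp
  show "(r / R) ^ CARD('n) * \<alpha> \<le> outer_density U R y"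
    using outer_density_scale_le[OF U] mult_left_mono[OF a(1) c] by linarith
  have "(r / R) ^ CARD('n) * outer_density (- U) r x \<le> outer_density (- U) R y" by (rule outer_density_scale_le) (use U in auto)
  moreover have "(r / R) ^ CARD('n) * \<alpha> \<le> (r / R) ^ CARD('n) * (1 - outer_density U r x)"
    using a(2) c by (intro mult_left_mono) auto
  ultimately show "outer_density U R y \<le> 1 - (r / R) ^ CARD('n) * \<alpha>"
    unfolding outer_density_compl[OF U(1,2)] outer_density_compl[OF U(1) R] by linarith
qed

lemma measure_sball_shift:
  fixes V :: "(real^'n) set"
  assumes "V \<in> sets borel" "0 \<le> r" "supn (x - y) \<le> \<delta>"
  shows "measure lborel (sball y r \<inter> V) \<le> measure lborel (sball x r \<inter> V) + ((2 * (r + \<delta>)) ^ CARD('n) - (2 * r) ^ CARD('n))"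
proof -
  have d: "0 \<le> \<delta>" using assms(3) supn_nonneg[of "x - y"] by linarith
  have sub: "sball x r \<subseteq> sball x (r + \<delta>)" by (rule sball_subset) (use d in simp)
  have "measure lborel (sball y r \<inter> V) \<le> measure lborel ((sball x r \<inter> V) \<union> (sball x (r + \<delta>) - sball x r))"
  proof (rule measure_mono_fmeasurable)
    show "sball y r \<inter> V \<subseteq> sball x r \<inter> V \<union> (sball x (r + \<delta>) - sball x r)"
      using sball_subset[of y x r "r + \<delta>"] assms(3) supn_commute[of x y] by auto
    have "sball x (r + \<delta>) \<in> fmeasurable lborel" "sball x r \<in> fmeasurable lborel" unfolding sball_eq_cbox by auto
    then show "sball x r \<inter> V \<union> (sball x (r + \<delta>) - sball x r) \<in> fmeasurable lborel"
      using assms(1) sball_fmeasurable by (intro fmeasurable.Un fmeasurable.Diff) auto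
  qed (use assms in auto)
  also have "\<dots> \<le> measure lborel (sball x r \<inter> V) + measure lborel (sball x (r + \<delta>) - sball x r)"
    by (rule measure_Un_le) (use assms in auto)
  also have "measure lborel (sball x (r + \<delta>) - sball x r) = measure lborel (sball x (r + \<delta>)) - measure lborel (sball x r)"
    by (rule measure_Diff) (use sub emeasure_sball[of "r + \<delta>" x] d assms(2) in auto)
  finally show ?thesis using assms(2) d by (simp add: measure_sball)
qed

text \<open>Continuity is what makes the density equal to \<open>1/2\<close> at the first time it
  reaches \<open>1/2\<close>, since it cannot jump over that value. The modulus is the volume of the
  shell from \<open>measure_sball_shift\<close>.\<close>

lemma continuous_outer_density:
  fixes U :: "(real^'n) set"
  assumes U: "U \<in> sets borel" "0 < r"
  shows "continuous_on UNIV (outer_density U r)"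
proof (rule continuous_on_eq_continuous_at[THEN iffD2, OF open_UNIV], rule ballI)
  fix x :: "real^'n"
  let ?e = "\<lambda>\<delta>. ((2 * (r + \<delta>)) ^ CARD('n) - (2 * r) ^ CARD('n)) / (2 * r) ^ CARD('n)"
  have "(outer_density U r \<longlongrightarrow> outer_density U r x) (at x)"
  proof (rule Lim_null[THEN iffD2], rule Lim_null_comparison)
    show "\<forall>\<^sub>F y in at x. norm (outer_density U r y - outer_density U r x) \<le> ?e (supn (x - y))"
    proof (intro always_eventually allI)
      fix y
      have V: "- U \<in> sets borel" using U by auto
      have "measure lborel (sball y r \<inter> - U) - measure lborel (sball x r \<inter> - U) \<le> (2 * (r + supn (x - y))) ^ CARD('n) - (2 * r) ^ CARD('n)"
        using measure_sball_shift[OF V, of r x y "supn (x - y)"] U by simp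
      moreover have "measure lborel (sball x r \<inter> - U) - measure lborel (sball y r \<inter> - U) \<le> (2 * (r + supn (x - y))) ^ CARD('n) - (2 * r) ^ CARD('n)"
        using measure_sball_shift[OF V, of r y x "supn (x - y)"] U supn_commute[of x y] by simp
      ultimately have "\<bar>measure lborel (sball y r \<inter> - U) - measure lborel (sball x r \<inter> - U)\<bar> \<le> (2 * (r + supn (x - y))) ^ CARD('n) - (2 * r) ^ CARD('n)"
        by (simp add: abs_le_iff)
      then show "norm (outer_density U r y - outer_density U r x) \<le> ?e (supn (x - y))"
        unfolding outer_density_def diff_divide_distrib[symmetric] using U(2) by (simp add: divide_right_mono)
    qed
    have "((\<lambda>y. supn (x - y)) \<longlongrightarrow> supn (x - x)) (at x)"
      by (rule isCont_tendsto_compose[where g=supn])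
         (use continuous_supn in \<open>auto simp only: continuous_on_eq_continuous_at[OF open_UNIV] intro!: tendsto_diff tendsto_const tendsto_ident_at\<close>)
    then have "((\<lambda>y. ?e (supn (x - y))) \<longlongrightarrow> ?e 0) (at x)" using U(2) by (intro tendsto_intros) auto
    then show "((\<lambda>y. ?e (supn (x - y))) \<longlongrightarrow> 0) (at x)" by simp
  qed
  then show "isCont (outer_density U r) x" by (simp add: isCont_def)
qed

text \<open>This is where boundedness of \<open>U\<close> enters: far away the density is
  \<open>1\<close>, so every scale eventually reaches \<open>1/2\<close>.\<close>

lemma outer_density_far:
  fixes U :: "(real^'n) set"
  assumes "bounded U" "0 < r"
  obtains M where "0 < M" "\<And>y. M \<le> supn y \<Longrightarrow> outer_density U r y = 1"
proof -
  obtain B where B: "0 < B" "\<And>u. u \<in> U \<Longrightarrow> norm u \<le> B" using assms(1) by (auto simp: bounded_pos)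
  show ?thesis
  proof (rule that[of "B + r + 1"])
    fix y :: "real^'n" assume y: "B + r + 1 \<le> supn y"
    have "sball y r \<inter> - U = sball y r"
    proof -
      have "u \<notin> U" if "u \<in> sball y r" for u
      proof
        assume "u \<in> U"
        then have "supn u \<le> B" using B(2) supn_le_norm[of u] by force
        moreover have "supn y \<le> supn (y - u) + supn u" using supn_triangle[of "y - u" u] by simp
        moreover have "supn (y - u) \<le> r" using that supn_commute[of y u] by (simp add: sball_def)
        ultimately show False using y by linarith
      qed
      then show ?thesis by auto
    qed
    then show "outer_density U r y = 1" using measure_sball[of r y] assms(2) by (simp add: outer_density_def)
  qed (use B assms in auto)
qed

section \<open>Gaussian estimates and exit times\<close>

lemma wiener_event_prob:
  fixes P :: "real^'n \<Rightarrow> (real \<Rightarrow> real^'n) measure"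
  assumes P: "is_wiener P" and t: "0 < t" and E: "E \<in> sets borel"
  shows "emeasure (P x) {\<omega>\<in>paths. \<omega> t - \<omega> 0 \<in> E} = (\<integral>\<^sup>+y. ennreal (gauss_dens t y) * indicator E y \<partial>lborel)"
proof -
  have [measurable]: "gauss_dens s \<in> borel_measurable (borel :: (real^'n) measure)" for s
    unfolding gauss_dens_def by measurable
  note [measurable] = coord_measurable'[OF is_wienerD(2)[OF P]]
  have "emeasure (P x) {\<omega>\<in>paths. \<omega> t - \<omega> 0 \<in> E} = emeasure (distr (P x) borel (\<lambda>\<omega>. \<omega> t - \<omega> 0)) E"
    using E by (subst emeasure_distr) (auto simp: is_wienerD(3)[OF P] intro!: arg_cong[where f="emeasure (P x)"])
  also have "\<dots> = emeasure (gaussM t) E" using wiener_increment_law[OF P, of 0 t x] t by simp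
  also have "\<dots> = (\<integral>\<^sup>+y. ennreal (gauss_dens t y) * indicator E y \<partial>lborel)"
    unfolding gaussM_def using E by (subst emeasure_density) auto
  finally show ?thesis .
qed

text \<open>Minimum over \<open>B(0,r)\<close> of the Gaussian density at time \<open>r\<^sup>2\<close>, times \<open>(2r)\<^sup>d\<close>; independent of \<open>r\<close> by scaling.\<close>
definition gauss_const :: "'n itself \<Rightarrow> real" where
  "gauss_const _ = 2 ^ CARD('n) * ((2 * pi) powr (- real CARD('n) / 2) * exp (- real CARD('n) / 2))"

lemma gauss_const_pos: "0 < gauss_const TYPE('n)" by (simp add: gauss_const_def)

lemma gauss_dens_lower:
  fixes y :: "real^'n"
  assumes "0 < r" "supn y \<le> r"
  shows "gauss_const TYPE('n) / (2 * r) ^ CARD('n) \<le> gauss_dens (r\<^sup>2) y"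
proof -
  have "(2 * pi * r\<^sup>2) powr (- real CARD('n) / 2) = (2 * pi) powr (- real CARD('n) / 2) * (r\<^sup>2) powr (- real CARD('n) / 2)"
    using assms by (subst powr_mult[symmetric]) auto
  also have "(r\<^sup>2) powr (- real CARD('n) / 2) = inverse (r ^ CARD('n))"
  proof -
    have "(r\<^sup>2) powr (- real CARD('n) / 2) = r powr (- real CARD('n))"
      using assms by (simp add: powr_powr flip: powr_numeral)
    then show ?thesis using assms by (simp add: powr_minus powr_realpow)
  qed
  finally have 1: "(2 * pi * r\<^sup>2) powr (- real CARD('n) / 2) = (2 * pi) powr (- real CARD('n) / 2) * inverse (r ^ CARD('n))" .
  have "(norm y)\<^sup>2 \<le> real CARD('n) * r\<^sup>2"
  proof -
    have "(supn y)\<^sup>2 \<le> r\<^sup>2" using assms supn_nonneg[of y] by (intro power_mono) auto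
    then have "real CARD('n) * (supn y)\<^sup>2 \<le> real CARD('n) * r\<^sup>2" by (intro mult_left_mono) auto
    then show ?thesis using norm_le_supn[of y] by linarith
  qed
  then have "(norm y)\<^sup>2 / (2 * r\<^sup>2) \<le> real CARD('n) / 2"
    using assms by (simp add: divide_le_eq)
  then have 2: "exp (- real CARD('n) / 2) \<le> exp (- (norm y)\<^sup>2 / (2 * r\<^sup>2))" by simp
  have "gauss_const TYPE('n) / (2 * r) ^ CARD('n) = (2 * pi) powr (- real CARD('n) / 2) * inverse (r ^ CARD('n)) * exp (- real CARD('n) / 2)"
    using assms by (simp add: gauss_const_def power_mult_distrib field_simps)
  also have "\<dots> \<le> gauss_dens (r\<^sup>2) y"
    unfolding gauss_dens_def 1 using 2 assms by (intro mult_left_mono) auto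
  finally show ?thesis .
qed

text \<open>At time \<open>r\<^sup>2\<close> the Gaussian density is comparable to the uniform
  density on the ball of radius \<open>r\<close>, so the chance of being in \<open>V\<close> is at
  least a constant times the proportion of \<open>V\<close> there. The starting point is included in
  the event for later pathwise use.\<close>

lemma wiener_hits_set_prob:
  fixes P :: "real^'n \<Rightarrow> (real \<Rightarrow> real^'n) measure"
  assumes P: "is_wiener P" and r: "0 < r" and V: "V \<in> sets borel"
  shows "gauss_const TYPE('n) * (measure lborel (sball z r \<inter> V) / (2 * r) ^ CARD('n)) \<le> measure (P z) {\<omega>\<in>paths. \<omega> 0 = z \<and> \<omega> (r\<^sup>2) \<in> V}"
proof -
  interpret prob_space "P z" by (rule is_wienerD(1)[OF P])
  note [measurable] = coord_measurable'[OF is_wienerD(2)[OF P]]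
  define E where "E = (\<lambda>y. z + y) -` (sball z r \<inter> V)"
  have E: "E \<in> sets borel"
  proof -
    have "(\<lambda>y. z + y) \<in> borel_measurable borel" by measurable
    from measurable_sets[OF this, of "sball z r \<inter> V"] show ?thesis using V by (simp add: E_def)
  qed
  have mE: "emeasure lborel E = emeasure lborel (sball z r \<inter> V)"
  proof -
    have "emeasure lborel (sball z r \<inter> V) = emeasure (distr lborel borel ((+) z)) (sball z r \<inter> V)"
      by (simp add: lborel_distr_plus)
    also have "\<dots> = emeasure lborel E" using V by (subst emeasure_distr) (auto simp: E_def)
    finally show ?thesis ..
  qed
  let ?c = "gauss_const TYPE('n) / (2 * r) ^ CARD('n)"
  have c0: "0 \<le> ?c" using gauss_const_pos[where 'n='n] r by (simp add: less_imp_le)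
  have "ennreal (?c * measure lborel (sball z r \<inter> V)) = ennreal ?c * emeasure lborel (sball z r \<inter> V)"
    using emeasure_eq_measure2[OF sball_fmeasurable[OF V, of z r]] c0 by (simp only: ennreal_mult')
  also have "\<dots> = (\<integral>\<^sup>+y. ennreal ?c * indicator E y \<partial>lborel)"
    using E by (simp add: nn_integral_cmult mE)
  also have "\<dots> \<le> (\<integral>\<^sup>+y. ennreal (gauss_dens (r\<^sup>2) y) * indicator E y \<partial>lborel)"
  proof (intro nn_integral_mono)
    fix y :: "real^'n"
    show "ennreal ?c * indicator E y \<le> ennreal (gauss_dens (r\<^sup>2) y) * indicator E y"
    proof (cases "y \<in> E")
      case True
      then have "supn y \<le> r" by (simp add: E_def sball_def)
      from gauss_dens_lower[OF r this] show ?thesis using True by (simp add: ennreal_leI)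
    qed simp
  qed
  also have "\<dots> = emeasure (P z) {\<omega>\<in>paths. \<omega> (r\<^sup>2) - \<omega> 0 \<in> E}"
    by (rule wiener_event_prob[OF P _ E, symmetric]) (use r in simp)
  also have "\<dots> \<le> emeasure (P z) {\<omega>\<in>paths. \<omega> 0 = z \<and> \<omega> (r\<^sup>2) \<in> V}"
  proof (rule emeasure_mono_AE)
    show "AE \<omega> in P z. \<omega> \<in> {\<omega>\<in>paths. \<omega> (r\<^sup>2) - \<omega> 0 \<in> E} \<longrightarrow> \<omega> \<in> {\<omega>\<in>paths. \<omega> 0 = z \<and> \<omega> (r\<^sup>2) \<in> V}"
      using is_wienerD(4)[OF P, of z] by eventually_elim (auto simp: E_def)
    have "{\<omega>\<in>space (P z). \<omega> 0 = z \<and> \<omega> (r\<^sup>2) \<in> V} \<in> sets (P z)" using V by measurable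
    then show "{\<omega>\<in>paths. \<omega> 0 = z \<and> \<omega> (r\<^sup>2) \<in> V} \<in> sets (P z)" by (simp add: is_wienerD(3)[OF P])
  qed
  finally show ?thesis unfolding emeasure_eq_measure by simp
qed

definition exit_time :: "real \<Rightarrow> (real \<Rightarrow> real^'n) \<Rightarrow> real" where
  "exit_time M = first_time (exit_by {y. M \<le> supn y})"

definition exits :: "real \<Rightarrow> (real \<Rightarrow> real^'n) set" where
  "exits M = happens (exit_by {y. M \<le> supn y})"

lemma closed_supn_ge: "closed {y. M \<le> supn (y :: real^'n)}"
  by (intro closed_Collect_le continuous_on_const continuous_supn)

lemmas progress_exits = progress_exit[OF closed_supn_ge]

lemma exit_by_iff: "exit_by {y. M \<le> supn y} t \<omega> \<longleftrightarrow> (\<exists>s\<in>{0..t}. M \<le> supn (\<omega> s - \<omega> 0))"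
proof -
  have "hit_by F t (incr 0 \<omega>) \<longleftrightarrow> (\<exists>s\<in>{0..t}. \<omega> s - \<omega> 0 \<in> F)" for F
    unfolding hit_by_def by (intro bex_cong) (auto simp: incr_def)
  then show ?thesis by (simp add: exit_by_def)
qed

lemma exits_iff: "\<omega> \<in> exits M \<longleftrightarrow> \<omega> \<in> paths \<and> (\<exists>s\<ge>0. M \<le> supn (\<omega> s - \<omega> 0))"
  unfolding exits_def happens_def exit_by_iff by force

lemma exit_time_le: "\<omega> \<in> paths \<Longrightarrow> 0 \<le> s \<Longrightarrow> M \<le> supn (\<omega> s - \<omega> 0) \<Longrightarrow> exit_time M \<omega> \<le> s"
proof -
  assume a: "\<omega> \<in> paths" "0 \<le> s" "M \<le> supn (\<omega> s - \<omega> 0)"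
  then have e: "\<omega> \<in> exits M" by (auto simp: exits_iff)
  have "exit_by {y. M \<le> supn y} s \<omega>" unfolding exit_by_iff using a by (intro bexI[of _ s]) auto
  then show ?thesis unfolding exit_time_def
    using first_time_le_iff[OF progress_exits e[unfolded exits_def] a(2)] by simp
qed

lemma exit_time_nonneg: "\<omega> \<in> exits M \<Longrightarrow> 0 \<le> exit_time M \<omega>"
  unfolding exits_def exit_time_def by (rule first_time_nonneg)

lemma exit_time_ge:
  assumes "\<omega> \<in> exits M"
  shows "M \<le> supn (\<omega> (exit_time M \<omega>) - \<omega> 0)"
proof -
  have w: "\<omega> \<in> paths" using assms by (simp add: exits_iff)
  obtain s where s: "0 \<le> s" "s \<le> exit_time M \<omega>" "M \<le> supn (\<omega> s - \<omega> 0)"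
    using first_time_occurs[OF progress_exits assms[unfolded exits_def]]
    unfolding exit_time_def[symmetric] exit_by_iff by auto
  then have "s = exit_time M \<omega>" using exit_time_le[OF w s(1,3)] by simp
  then show ?thesis using s by simp
qed

text \<open>Strictly before the exit the bound is immediate; at the exit time it follows from left
  limits, and \<open>0 < M\<close> ensures that this time is positive.\<close>

lemma before_exit_time:
  assumes "\<omega> \<in> exits M" "0 < M" "0 \<le> s" "s \<le> exit_time M \<omega>"
  shows "supn (\<omega> s - \<omega> 0) \<le> M"
proof (cases "s < exit_time M \<omega>")
  case True
  have w: "\<omega> \<in> paths" using assms by (simp add: exits_iff)
  show ?thesis using exit_time_le[OF w assms(3), of M] True by linarith
next
  case False
  have w: "\<omega> \<in> paths" using assms by (simp add: exits_iff)
  have s: "s = exit_time M \<omega>" using False assms by simp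
  have s0: "0 < s"
  proof (rule ccontr)
    assume "\<not> 0 < s"
    then have "s = 0" using assms by simp
    then show False using exit_time_ge[OF assms(1)] s assms(2) by simp
  qed
  have c: "isCont (\<lambda>s. supn (\<omega> s - \<omega> 0)) s"
    by (rule isCont_o2[OF _ continuous_on_interior[OF continuous_supn]]) (auto intro!: continuous_intros pathsD(3)[OF w])
  then have "((\<lambda>s. supn (\<omega> s - \<omega> 0)) \<longlongrightarrow> supn (\<omega> s - \<omega> 0)) (at_left s)"
    unfolding isCont_def by (rule filterlim_at_split[THEN iffD1, THEN conjunct1])
  moreover have "\<forall>\<^sub>F u in at_left s. supn (\<omega> u - \<omega> 0) \<le> M"
    unfolding eventually_at_left[OF s0]
  proof (intro exI[of _ 0] conjI allI impI s0)
    fix u assume "0 < u" "u < s"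
    then show "supn (\<omega> u - \<omega> 0) \<le> M" using exit_time_le[OF w, of u M] s by linarith
  qed
  ultimately show ?thesis by (intro tendsto_upperbound) (auto simp: trivial_limit_at_left_real)
qed

lemma exit_time_measurable: "exit_time M \<in> borel_measurable pathM"
  unfolding exit_time_def by (rule first_time_measurable[OF progress_exits])

lemma exits_measurable: "exits M \<in> sets pathM"
  unfolding exits_def by (rule happens_measurable[OF progress_exits])

text \<open>Staying inside up to time \<open>n\<close> forces the position at time \<open>n\<close>
  into a fixed ball; since the Gaussian density is of order \<open>n powr (- d / 2)\<close>, this
  probability vanishes.\<close>

lemma wiener_AE_exits:
  fixes P :: "real^'n \<Rightarrow> (real \<Rightarrow> real^'n) measure"
  assumes P: "is_wiener P"
  shows "AE \<omega> in P x. \<omega> \<in> exits M"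
proof -
  interpret prob_space "P x" by (rule is_wienerD(1)[OF P])
  have ex: "exits M \<in> events" using exits_measurable is_wienerD(2)[OF P] by simp
  \<comment> \<open>Guarantees a nonnegative radius, since \<open>M\<close> is arbitrary.\<close>
  let ?M = "max M 1"
  have bound: "emeasure (P x) (space (P x) - exits M) \<le> ennreal ((2 * pi * real n) powr (- real CARD('n) / 2) * (2 * ?M) ^ CARD('n))" if "0 < n" for n :: nat
  proof -
    note [measurable] = coord_measurable'[OF is_wienerD(2)[OF P]]
    have "emeasure (P x) (space (P x) - exits M) \<le> emeasure (P x) {\<omega>\<in>paths. \<omega> (real n) - \<omega> 0 \<in> sball 0 ?M}"
    proof (rule emeasure_mono)
      show "space (P x) - exits M \<subseteq> {\<omega>\<in>paths. \<omega> (real n) - \<omega> 0 \<in> sball 0 ?M}"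
      proof
        fix \<omega> assume "\<omega> \<in> space (P x) - exits M"
        then have "\<omega> \<in> paths" "\<not> M \<le> supn (\<omega> (real n) - \<omega> 0)" by (auto simp: exits_iff is_wienerD(3)[OF P])
        then show "\<omega> \<in> {\<omega>\<in>paths. \<omega> (real n) - \<omega> 0 \<in> sball 0 ?M}" by (simp add: sball_def)
      qed
      have "{\<omega>\<in>space (P x). \<omega> (real n) - \<omega> 0 \<in> sball 0 ?M} \<in> sets (P x)" by measurable
      then show "{\<omega>\<in>paths. \<omega> (real n) - \<omega> 0 \<in> sball 0 ?M} \<in> sets (P x)" by (simp add: is_wienerD(3)[OF P])
    qed
    also have "\<dots> = (\<integral>\<^sup>+y. ennreal (gauss_dens (real n) y) * indicator (sball (0::real^'n) ?M) y \<partial>lborel)"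
      by (rule wiener_event_prob[OF P]) (use that in auto)
    also have "\<dots> \<le> (\<integral>\<^sup>+y. ennreal ((2 * pi * real n) powr (- real CARD('n) / 2)) * indicator (sball (0::real^'n) ?M) y \<partial>lborel)"
      by (intro nn_integral_mono mult_right_mono ennreal_leI) (auto simp: gauss_dens_def mult_left_le)
    also have "\<dots> = ennreal ((2 * pi * real n) powr (- real CARD('n) / 2)) * ennreal ((2 * ?M) ^ CARD('n))"
      by (subst nn_integral_cmult) (auto simp: emeasure_sball)
    finally show ?thesis by (simp add: ennreal_mult')
  qed
  have "(\<lambda>n. (2 * pi * real n) powr (- real CARD('n) / 2) * (2 * ?M) ^ CARD('n)) \<longlonglongrightarrow> 0"
  proof (rule tendsto_mult_left_zero)
    have "filterlim (\<lambda>n. 2 * pi * real n) at_top sequentially"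
      by (rule filterlim_tendsto_pos_mult_at_top[OF tendsto_const _ filterlim_real_sequentially]) simp
    then show "(\<lambda>n. (2 * pi * real n) powr (- real CARD('n) / 2)) \<longlonglongrightarrow> 0"
      by (intro tendsto_neg_powr) (auto simp: zero_less_card_finite)
  qed
  then have "(\<lambda>n. ennreal ((2 * pi * real n) powr (- real CARD('n) / 2) * (2 * ?M) ^ CARD('n))) \<longlonglongrightarrow> ennreal 0"
    by (rule tendsto_ennrealI)
  then have "emeasure (P x) (space (P x) - exits M) \<le> ennreal 0"
  proof (rule tendsto_lowerbound)
    show "\<forall>\<^sub>F n in sequentially. emeasure (P x) (space (P x) - exits M) \<le> ennreal ((2 * pi * real n) powr (- real CARD('n) / 2) * (2 * ?M) ^ CARD('n))"
      using eventually_gt_at_top[of 0] by eventually_elim (rule bound)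
  qed simp
  then have "emeasure (P x) (space (P x) - exits M) = 0" by simp
  then show ?thesis using ex
    by (intro AE_I[where N="space (P x) - exits M"]) auto
qed

lemma exit_event_measurable: "0 \<le> t \<Longrightarrow> {\<omega>\<in>paths. exit_by {y. M \<le> supn y} t \<omega>} \<in> sets pathM"
  by (rule progress_sets[OF progress_exits])

text \<open>For \<open>r = 1\<close> and start \<open>0\<close>, continuity makes the range on
  \<open>{0..1}\<close> bounded, so the exceptional events decrease to the empty set. Scaling and
  translation carry the bound to all \<open>r\<close> and \<open>x\<close> with the same
  \<open>C\<close>.\<close>

lemma wiener_sup_bound:
  fixes P :: "real^'n \<Rightarrow> (real \<Rightarrow> real^'n) measure"
  assumes P: "is_wiener P" and "0 < \<delta>"
  obtains C where "0 < C"
    "\<And>r x. 0 < r \<Longrightarrow> measure (P x) {\<omega>\<in>paths. exit_by {y. C * r \<le> supn y} (r\<^sup>2) \<omega>} \<le> \<delta>"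
proof -
  interpret prob_space "P 0" by (rule is_wienerD(1)[OF P])
  note mP = wiener_measurable_sets[OF P]
  define E where "E M t = {\<omega>\<in>paths. exit_by {y :: real^'n. M \<le> supn y} t \<omega>}" for M t
  have "(\<lambda>n. prob (E (real (Suc n)) 1)) \<longlonglongrightarrow> prob (\<Inter>n. E (real (Suc n)) 1)"
  proof (rule finite_Lim_measure_decseq)
    show "range (\<lambda>n. E (real (Suc n)) 1) \<subseteq> events"
      by (auto simp: E_def is_wienerD(2)[OF P] intro!: exit_event_measurable)
    show "decseq (\<lambda>n. E (real (Suc n)) 1)"
    proof (rule decseq_SucI)
      fix n
      show "E (real (Suc (Suc n))) 1 \<subseteq> E (real (Suc n)) 1"
      proof
        fix \<omega> assume "\<omega> \<in> E (real (Suc (Suc n))) 1"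
        then obtain s where s: "\<omega> \<in> paths" "s \<in> {0..1}" "real (Suc (Suc n)) \<le> supn (\<omega> s - \<omega> 0)"
          unfolding E_def exit_by_iff by blast
        then have "real (Suc n) \<le> supn (\<omega> s - \<omega> 0)" by simp
        then show "\<omega> \<in> E (real (Suc n)) 1" unfolding E_def exit_by_iff using s(1,2) by blast
      qed
    qed
  qed
  moreover have "(\<Inter>n. E (real (Suc n)) 1) = {}"
  proof (intro equals0I)
    fix \<omega> assume w: "\<omega> \<in> (\<Inter>n. E (real (Suc n)) 1)"
    then have p: "\<omega> \<in> paths" by (auto simp: E_def)
    have "continuous_on {0..1} (\<lambda>s. supn (\<omega> s - \<omega> 0))"
      by (intro continuous_on_compose2[OF continuous_supn] continuous_on_diff continuous_on_const
          continuous_on_subset[OF pathsD(1)[OF p]]) auto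
    then obtain u where u: "\<And>s. s \<in> {0..1} \<Longrightarrow> supn (\<omega> s - \<omega> 0) \<le> supn (\<omega> u - \<omega> 0)"
      using continuous_attains_sup[of "{0..1::real}"] by fastforce
    obtain n where n: "supn (\<omega> u - \<omega> 0) < real n" using reals_Archimedean2 by blast
    have "\<omega> \<in> E (real (Suc n)) 1" using w by blast
    then obtain s where "s \<in> {0..1}" "real (Suc n) \<le> supn (\<omega> s - \<omega> 0)" by (auto simp: E_def exit_by_iff)
    then show False using u[of s] n by simp
  qed
  ultimately have "(\<lambda>n. prob (E (real (Suc n)) 1)) \<longlonglongrightarrow> 0" by simp
  then have "\<forall>\<^sub>F n in sequentially. prob (E (real (Suc n)) 1) < \<delta>" using assms(2) by (rule order_tendstoD)
  then obtain n where n: "prob (E (real (Suc n)) 1) < \<delta>" by (auto simp: eventually_sequentially)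
  let ?C = "real (Suc n)"
  show ?thesis
  proof (rule that[of ?C])
    fix r :: real and x :: "real^'n" assume r: "0 < r"
    let ?\<phi> = "\<lambda>\<omega> s. (1 / r) *\<^sub>R \<omega> (r\<^sup>2 * s) :: real^'n"
    have phi: "?\<phi> \<in> measurable (P 0) pathM" unfolding mP by (rule scale_measurable)
    have Em: "E M t \<in> sets pathM" if "0 \<le> t" for M t unfolding E_def by (rule exit_event_measurable[OF that])
    have "?\<phi> \<omega> \<in> E ?C 1 \<longleftrightarrow> \<omega> \<in> E (?C * r) (r\<^sup>2)" if w: "\<omega> \<in> paths" for \<omega>
    proof -
      have fp: "?\<phi> \<omega> \<in> paths" using measurable_space[OF phi] w is_wienerD(3)[OF P] by auto
      have iff: "?C \<le> supn (?\<phi> \<omega> s - ?\<phi> \<omega> 0) \<longleftrightarrow> ?C * r \<le> supn (\<omega> (r\<^sup>2 * s) - \<omega> 0)" for s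
      proof -
        have "?\<phi> \<omega> s - ?\<phi> \<omega> 0 = (1 / r) *\<^sub>R (\<omega> (r\<^sup>2 * s) - \<omega> 0)" by (simp add: scaleR_diff_right)
        then have "supn (?\<phi> \<omega> s - ?\<phi> \<omega> 0) = supn (\<omega> (r\<^sup>2 * s) - \<omega> 0) / r" using r by (simp add: supn_scaleR)
        then show ?thesis using r by (simp add: pos_le_divide_eq del: of_nat_Suc)
      qed
      have img: "(\<lambda>s. r\<^sup>2 * s) ` {0..1} = {0..r\<^sup>2}"
        using r by (simp add: image_mult_atLeastAtMost)
      have "?\<phi> \<omega> \<in> E ?C 1 \<longleftrightarrow> (\<exists>s\<in>{0..1}. ?C * r \<le> supn (\<omega> (r\<^sup>2 * s) - \<omega> 0))"
        unfolding E_def mem_Collect_eq exit_by_iff iff using fp by simp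
      also have "\<dots> \<longleftrightarrow> (\<exists>u\<in>(\<lambda>s. r\<^sup>2 * s) ` {0..1}. ?C * r \<le> supn (\<omega> u - \<omega> 0))" by blast
      finally show ?thesis unfolding img E_def mem_Collect_eq exit_by_iff using w by simp
    qed
    then have eq: "?\<phi> -` E ?C 1 \<inter> space (P 0) = E (?C * r) (r\<^sup>2)"
      by (auto simp: is_wienerD(3)[OF P] E_def)
    have "measure (P 0) (E ?C 1) = measure (distr (P 0) pathM ?\<phi>) (E ?C 1)"
      by (simp only: wiener_scale[OF P r])
    also have "\<dots> = measure (P 0) (E (?C * r) (r\<^sup>2))"
      by (subst measure_distr[OF phi Em]) (simp_all only: eq zero_le_one)
    finally have 1: "measure (P 0) (E (?C * r) (r\<^sup>2)) \<le> \<delta>" using n by simp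
    have tr: "(\<lambda>\<omega> s. (x - 0) + \<omega> s) \<in> measurable (P 0) pathM"
      unfolding mP by (rule plus_measurable) auto
    have "(\<lambda>\<omega> s. (x - 0) + \<omega> s) -` E (?C * r) (r\<^sup>2) \<inter> space (P 0) = E (?C * r) (r\<^sup>2)"
      using plus_paths[where y=x] by (auto simp: is_wienerD(3)[OF P] E_def exit_by_iff)
    then have "measure (P x) (E (?C * r) (r\<^sup>2)) = measure (P 0) (E (?C * r) (r\<^sup>2))"
      unfolding wiener_translate[OF P, of x 0] using Em by (subst measure_distr[OF tr]) auto
    then show "measure (P x) {\<omega>\<in>paths. exit_by {y. ?C * r \<le> supn y} (r\<^sup>2) \<omega>} \<le> \<delta>" using 1 by (simp add: E_def)
  qed simp
qed

section \<open>Killing functionals\<close>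

text \<open>\<open>K t\<close> is the survival weight up to time \<open>t\<close> and \<open>Kinf\<close> the total one: the indicator of
  \<open>H\<^sub>\<Sigma> > t\<close> for hard obstacles, \<open>exp (- \<integral>\<^sub>0\<^sup>t V (X\<^sub>s) ds)\<close> for soft ones.\<close>
definition killing :: "(real \<Rightarrow> (real \<Rightarrow> real^'n) \<Rightarrow> real) \<Rightarrow> ((real \<Rightarrow> real^'n) \<Rightarrow> real) \<Rightarrow> bool" where
  "killing K Kinf \<longleftrightarrow>
     (\<forall>\<omega>\<in>paths. \<forall>t. 0 \<le> K t \<omega> \<and> K t \<omega> \<le> 1) \<and> (\<forall>\<omega>\<in>paths. 0 \<le> Kinf \<omega> \<and> Kinf \<omega> \<le> 1) \<and>
     (\<lambda>(t, \<omega>). K t \<omega>) \<in> borel_measurable (borel \<Otimes>\<^sub>M pathM) \<and> Kinf \<in> borel_measurable pathM \<and>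
     (\<forall>\<omega>\<in>paths. \<forall>s\<ge>0. \<forall>t\<ge>0. K (s + t) \<omega> \<le> K s \<omega> * K t (pshift s \<omega>)) \<and>
     (\<forall>\<omega>\<in>paths. \<forall>s\<ge>0. Kinf \<omega> \<le> K s \<omega> * Kinf (pshift s \<omega>)) \<and>
     (\<forall>\<omega>\<in>paths. \<forall>\<omega>'\<in>paths. \<forall>t\<ge>0. agree t \<omega> \<omega>' \<longrightarrow> K t \<omega> = K t \<omega>')"

text \<open>The common form of the two obstacle classes: from the boundary of \<open>U\<close>, a
  fraction \<open>\<eta>\<close> of the mass is lost before the path moves by
  \<open>\<epsilon>\<close>.\<close>

definition trap :: "(real^'n \<Rightarrow> (real \<Rightarrow> real^'n) measure) \<Rightarrow> (real \<Rightarrow> (real \<Rightarrow> real^'n) \<Rightarrow> real)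
    \<Rightarrow> (real^'n) set \<Rightarrow> real \<Rightarrow> real \<Rightarrow> bool" where
  "trap P K U \<epsilon> \<eta> \<longleftrightarrow> (\<forall>y\<in>frontier U. (\<integral>\<omega>. K (exit_time \<epsilon> \<omega>) \<omega> \<partial>P y) \<le> 1 - \<eta>)"

lemma killingD:
  assumes "killing K Kinf"
  shows "\<omega> \<in> paths \<Longrightarrow> 0 \<le> K t \<omega> \<and> K t \<omega> \<le> 1" "\<omega> \<in> paths \<Longrightarrow> 0 \<le> Kinf \<omega> \<and> Kinf \<omega> \<le> 1"
    "(\<lambda>(t, \<omega>). K t \<omega>) \<in> borel_measurable (borel \<Otimes>\<^sub>M pathM)" "Kinf \<in> borel_measurable pathM"
    "\<omega> \<in> paths \<Longrightarrow> 0 \<le> s \<Longrightarrow> 0 \<le> t \<Longrightarrow> K (s + t) \<omega> \<le> K s \<omega> * K t (pshift s \<omega>)"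
    "\<omega> \<in> paths \<Longrightarrow> 0 \<le> s \<Longrightarrow> Kinf \<omega> \<le> K s \<omega> * Kinf (pshift s \<omega>)"
    "\<omega> \<in> paths \<Longrightarrow> \<omega>' \<in> paths \<Longrightarrow> 0 \<le> t \<Longrightarrow> agree t \<omega> \<omega>' \<Longrightarrow> K t \<omega> = K t \<omega>'"
proof -
  note k1 = assms[unfolded killing_def, THEN conjunct1]
  note k2 = assms[unfolded killing_def, THEN conjunct2]
  note k3 = k2[THEN conjunct2] and k4 = k2[THEN conjunct2, THEN conjunct2]
  note k5 = k4[THEN conjunct2] and k6 = k4[THEN conjunct2, THEN conjunct2]
  note k7 = k6[THEN conjunct2]
  show "\<omega> \<in> paths \<Longrightarrow> 0 \<le> K t \<omega> \<and> K t \<omega> \<le> 1" by (rule k1[rule_format])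
  show "\<omega> \<in> paths \<Longrightarrow> 0 \<le> Kinf \<omega> \<and> Kinf \<omega> \<le> 1" by (rule k2[THEN conjunct1, rule_format])
  show "(\<lambda>(t, \<omega>). K t \<omega>) \<in> borel_measurable (borel \<Otimes>\<^sub>M pathM)" by (rule k3[THEN conjunct1])
  show "Kinf \<in> borel_measurable pathM" by (rule k4[THEN conjunct1])
  show "\<omega> \<in> paths \<Longrightarrow> 0 \<le> s \<Longrightarrow> 0 \<le> t \<Longrightarrow> K (s + t) \<omega> \<le> K s \<omega> * K t (pshift s \<omega>)"
    by (rule k5[THEN conjunct1, rule_format])
  show "\<omega> \<in> paths \<Longrightarrow> 0 \<le> s \<Longrightarrow> Kinf \<omega> \<le> K s \<omega> * Kinf (pshift s \<omega>)"
    by (rule k6[THEN conjunct1, rule_format])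
  show "\<omega> \<in> paths \<Longrightarrow> \<omega>' \<in> paths \<Longrightarrow> 0 \<le> t \<Longrightarrow> agree t \<omega> \<omega>' \<Longrightarrow> K t \<omega> = K t \<omega>'"
    by (rule k7[rule_format])
qed

lemma killing_mono:
  assumes "killing K Kinf" "\<omega> \<in> paths" "0 \<le> s" "s \<le> t"
  shows "K t \<omega> \<le> K s \<omega>"
proof -
  have "K (s + (t - s)) \<omega> \<le> K s \<omega> * K (t - s) (pshift s \<omega>)" by (rule killingD(5)[OF assms(1)]) (use assms in auto)
  also have "\<dots> \<le> K s \<omega> * 1"
    using killingD(1)[OF assms(1) assms(2), of s] killingD(1)[OF assms(1) pshift_paths[OF assms(2)], of "t - s" s] by (intro mult_left_mono) auto
  finally show ?thesis by simp
qed

text \<open>Submultiplicativity with the first factor bounded by \<open>1\<close>. It compares a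
  trial completed inside a longer time window with the weight of the whole window.\<close>

lemma killing_shift:
  assumes "killing K Kinf" "\<omega> \<in> paths" "0 \<le> s" "0 \<le> t" "s + t \<le> u"
  shows "K u \<omega> \<le> K t (pshift s \<omega>)"
proof -
  have "K u \<omega> \<le> K (s + t) \<omega>" by (rule killing_mono[OF assms(1,2)]) (use assms in auto)
  also have "\<dots> \<le> K s \<omega> * K t (pshift s \<omega>)" by (rule killingD(5)[OF assms(1-4)])
  also have "\<dots> \<le> 1 * K t (pshift s \<omega>)"
    using killingD(1)[OF assms(1) assms(2), of s] killingD(1)[OF assms(1) pshift_paths[OF assms(2)], of t s] by (intro mult_right_mono) auto
  finally show ?thesis by simp
qed

lemma killing_measurable:
  assumes "killing K Kinf" "T \<in> borel_measurable pathM"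
  shows "(\<lambda>\<omega>. K (T \<omega>) \<omega>) \<in> borel_measurable pathM"
  using measurable_compose[OF measurable_Pair[OF assms(2) measurable_ident] killingD(3)[OF assms(1)]] by simp

lemma wiener_integral_mono:
  fixes P :: "real^'n \<Rightarrow> (real \<Rightarrow> real^'n) measure"
  assumes P: "is_wiener P"
    and f: "f \<in> borel_measurable pathM" "\<And>\<omega>. \<omega> \<in> paths \<Longrightarrow> 0 \<le> f \<omega> \<and> f \<omega> \<le> (B::real)"
    and g: "g \<in> borel_measurable pathM" "\<And>\<omega>. \<omega> \<in> paths \<Longrightarrow> 0 \<le> g \<omega> \<and> g \<omega> \<le> (B'::real)"
    and le: "AE \<omega> in P x. f \<omega> \<le> g \<omega>"
  shows "(\<integral>\<omega>. f \<omega> \<partial>P x) \<le> (\<integral>\<omega>. g \<omega> \<partial>P x)"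
  by (rule integral_mono_AE[OF wiener_integrable(1)[OF P f] wiener_integrable(1)[OF P g] le])

text \<open>The total weight splits at \<open>T\<close> into the weight accumulated so far, which is
  known at \<open>T\<close>, and the weight of the future, to which the strong Markov property
  applies.\<close>

lemma killing_restart:
  fixes P :: "real^'n \<Rightarrow> (real \<Rightarrow> real^'n) measure"
  assumes P: "is_wiener P" and k: "killing K Kinf" and st: "stopping A T" and A: "AE \<omega> in P x. \<omega> \<in> A"
    and b: "b \<in> borel_measurable pathM" "\<And>\<omega>. \<omega> \<in> paths \<Longrightarrow> 0 \<le> b \<omega> \<and> b \<omega> \<le> B"
    and le: "\<And>\<omega>. \<omega> \<in> A \<Longrightarrow> (\<integral>\<omega>'. Kinf \<omega>' \<partial>P (\<omega> (T \<omega>))) \<le> b \<omega>"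
  shows "(\<integral>\<omega>. Kinf \<omega> \<partial>P x) \<le> (\<integral>\<omega>. indicator A \<omega> * (K (T \<omega>) \<omega> * b \<omega>) \<partial>P x)"
proof -
  have Km: "(\<lambda>\<omega>. K (T \<omega>) \<omega>) \<in> borel_measurable pathM" by (rule killing_measurable[OF k stoppingD(2)[OF st]])
  have ps: "(\<lambda>\<omega>. pshift (T \<omega>) \<omega>) \<in> measurable pathM (pathM :: (real \<Rightarrow> real^'n) measure)"
    by (rule pshift_measurable) (use stoppingD(2)[OF st] in auto)
  have "(\<integral>\<omega>. Kinf \<omega> \<partial>P x) \<le> (\<integral>\<omega>. indicator A \<omega> * (K (T \<omega>) \<omega> * Kinf (pshift (T \<omega>) \<omega>)) \<partial>P x)"
  proof (rule wiener_integral_mono[OF P])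
    show "Kinf \<in> borel_measurable pathM" by (rule killingD(4)[OF k])
    show "0 \<le> Kinf \<omega> \<and> Kinf \<omega> \<le> 1" if "\<omega> \<in> paths" for \<omega> by (rule killingD(2)[OF k that])
    show "(\<lambda>\<omega>. indicator A \<omega> * (K (T \<omega>) \<omega> * Kinf (pshift (T \<omega>) \<omega>))) \<in> borel_measurable pathM"
      by (intro borel_measurable_times Km borel_measurable_indicator stoppingD(1)[OF st] measurable_compose[OF ps killingD(4)[OF k]])
    show "0 \<le> indicator A \<omega> * (K (T \<omega>) \<omega> * Kinf (pshift (T \<omega>) \<omega>)) \<and> indicator A \<omega> * (K (T \<omega>) \<omega> * Kinf (pshift (T \<omega>) \<omega>)) \<le> 1"
      if "\<omega> \<in> paths" for \<omega>
      using killingD(1)[OF k that, of "T \<omega>"] killingD(2)[OF k pshift_paths[OF that], of "T \<omega>"]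
      by (auto simp: indicator_def mult_le_one)
    show "AE \<omega> in P x. Kinf \<omega> \<le> indicator A \<omega> * (K (T \<omega>) \<omega> * Kinf (pshift (T \<omega>) \<omega>))"
      using A
    proof eventually_elim
      case (elim \<omega>)
      then show ?case using killingD(6)[OF k stoppingD(4)[OF st elim] stoppingD(3)[OF st elim]] by simp
    qed
  qed
  also have "\<dots> \<le> (\<integral>\<omega>. indicator A \<omega> * (K (T \<omega>) \<omega> * b \<omega>) \<partial>P x)"
  proof (rule strong_markov_le[OF P st Km _ _ killingD(4)[OF k] _ b le])
    show "0 \<le> K (T \<omega>) \<omega> \<and> K (T \<omega>) \<omega> \<le> 1" "0 \<le> Kinf \<omega> \<and> Kinf \<omega> \<le> 1" if "\<omega> \<in> paths" for \<omega>
      using killingD(1,2)[OF k that] by auto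
    fix \<omega> \<omega>' assume w: "\<omega> \<in> A" "\<omega>' \<in> paths" "agree (T \<omega>) \<omega> \<omega>'"
    show "K (T \<omega>') \<omega>' = K (T \<omega>) \<omega>"
      using killingD(7)[OF k stoppingD(4)[OF st w(1)] w(2) stoppingD(3)[OF st w(1)] w(3)] stoppingD(6)[OF st w] by simp
  qed
  finally show ?thesis .
qed

text \<open>Whether \<open>\<Psi>\<close> has preceded \<open>\<Phi>\<close> is decided by the path
  up to the first time of \<open>\<Phi>\<close>. The version with \<open>\<le>\<close> serves a
  boundary hit strictly before an exit, the one with \<open><\<close> serves half times that do not
  exceed the counting time.\<close>

lemma stopping_before:
  assumes p: "progress \<Phi>" "progress \<Psi>"
  shows "stopping (happens \<Phi> - {\<omega>\<in>happens \<Psi>. first_time \<Psi> \<omega> \<le> first_time \<Phi> \<omega>}) (first_time \<Phi>)"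
    and "stopping (happens \<Phi> - {\<omega>\<in>happens \<Psi>. first_time \<Psi> \<omega> < first_time \<Phi> \<omega>}) (first_time \<Phi>)"
proof -
  note m = first_time_measurable[OF p(1)] first_time_measurable[OF p(2)]
  have *: "stopping (happens \<Phi> - {\<omega>\<in>happens \<Psi>. R (first_time \<Psi> \<omega>) (first_time \<Phi> \<omega>)}) (first_time \<Phi>)"
    if m: "happens \<Phi> - {\<omega>\<in>happens \<Psi>. R (first_time \<Psi> \<omega>) (first_time \<Phi> \<omega>)} \<in> sets pathM"
      and R: "\<And>a b. R a b \<Longrightarrow> a \<le> b" for R
    unfolding stopping_def
  proof (intro conjI ballI impI)
    have dir: "R (first_time \<Psi> \<omega>') (first_time \<Phi> \<omega>') \<and> \<omega>' \<in> happens \<Psi>"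
      if "\<omega> \<in> happens \<Phi>" "\<omega>' \<in> paths" "agree (first_time \<Phi> \<omega>) \<omega> \<omega>'" "\<omega> \<in> happens \<Psi>" "R (first_time \<Psi> \<omega>) (first_time \<Phi> \<omega>)" for \<omega> \<omega>'
      using first_time_agree[OF p(1) that(1,2,3)] first_time_agree[OF p(2) that(4,2) agree_mono[OF that(3) R[OF that(5)]]] that(5) by simp
    fix \<omega> assume w: "\<omega> \<in> happens \<Phi> - {\<omega>\<in>happens \<Psi>. R (first_time \<Psi> \<omega>) (first_time \<Phi> \<omega>)}"
    then show "0 \<le> first_time \<Phi> \<omega>" by (intro first_time_nonneg) simp
    fix \<omega>' assume w': "\<omega>' \<in> paths" "agree (first_time \<Phi> \<omega>) \<omega> \<omega>'"
    have wp: "\<omega> \<in> happens \<Phi>" "\<omega> \<in> paths" using w by (auto simp: happens_def)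
    note a = first_time_agree[OF p(1) wp(1) w']
    then show "first_time \<Phi> \<omega>' = first_time \<Phi> \<omega>" by simp
    have "agree (first_time \<Phi> \<omega>') \<omega>' \<omega>" using a w' by (simp add: agree_sym)
    then show "\<omega>' \<in> happens \<Phi> - {\<omega>\<in>happens \<Psi>. R (first_time \<Psi> \<omega>) (first_time \<Phi> \<omega>)}"
      using dir[of \<omega>' \<omega>] a w wp by blast
  qed (use m first_time_measurable[OF p(1)] in auto)
  have 1: "happens \<Phi> - happens \<Psi> \<inter> {\<omega>\<in>space pathM. first_time \<Psi> \<omega> \<le> first_time \<Phi> \<omega>} \<in> sets pathM"
    "happens \<Phi> - happens \<Psi> \<inter> {\<omega>\<in>space pathM. first_time \<Psi> \<omega> < first_time \<Phi> \<omega>} \<in> sets pathM"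
    by (intro sets.Diff sets.Int happens_measurable p borel_measurable_le borel_measurable_less m)+
  have 2: "happens \<Phi> - {\<omega>\<in>happens \<Psi>. R (first_time \<Psi> \<omega>) (first_time \<Phi> \<omega>)} =
    happens \<Phi> - happens \<Psi> \<inter> {\<omega>\<in>space pathM. R (first_time \<Psi> \<omega>) (first_time \<Phi> \<omega>)}" for R
    by (auto simp: happens_def)
  show "stopping (happens \<Phi> - {\<omega>\<in>happens \<Psi>. first_time \<Psi> \<omega> \<le> first_time \<Phi> \<omega>}) (first_time \<Phi>)"
    by (rule *[of "(\<le>)"]) (unfold 2, use 1 in auto)
  show "stopping (happens \<Phi> - {\<omega>\<in>happens \<Psi>. first_time \<Psi> \<omega> < first_time \<Phi> \<omega>}) (first_time \<Phi>)"
    by (rule *[of "(<)"]) (unfold 2, use 1 in auto)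
qed

lemma path_crosses_frontier:
  assumes "\<omega> \<in> paths" "0 \<le> t" "\<omega> 0 \<in> U" "\<omega> t \<notin> U"
  shows "hit_by (frontier U) t \<omega>"
proof -
  have "connected (\<omega> ` {0..t})"
    by (intro connected_continuous_image continuous_on_subset[OF pathsD(1)[OF assms(1)]]) auto
  moreover have "\<omega> ` {0..t} \<inter> U \<noteq> {}" using assms by force
  moreover have "\<omega> ` {0..t} - U \<noteq> {}" using assms by force
  ultimately have "\<omega> ` {0..t} \<inter> frontier U \<noteq> {}" by (rule connected_Int_frontier)
  then show ?thesis by (auto simp: hit_by_def)
qed

text \<open>With probability at least \<open>p\<close> the path is outside \<open>U\<close> at time
  \<open>r\<^sup>2\<close>, and at most \<open>p / 2\<close> of this is lost to excursions beyond
  \<open>C * r\<close>. On the rest it crosses the boundary within distance \<open>C * r\<close>,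
  and the trap then removes the fraction \<open>\<eta>\<close>.\<close>

lemma trial_from_inside:
  fixes P :: "real^'n \<Rightarrow> (real \<Rightarrow> real^'n) measure"
  assumes P: "is_wiener P" and k: "killing K Kinf" and tr: "trap P K U \<epsilon> \<eta>" and U: "U \<in> sets borel"
    and \<eta>: "0 < \<eta>" "\<eta> < 1" and r: "0 < \<epsilon>" "\<epsilon> \<le> r" and C: "0 < C"
    and sup: "measure (P z) {\<omega>\<in>paths. exit_by {y. C * r \<le> supn y} (r\<^sup>2) \<omega>} \<le> p / 2"
    and z: "z \<in> U" and p: "p \<le> gauss_const TYPE('n) * outer_density U r z"
  shows "(\<integral>\<omega>. K (exit_time ((C + 1) * r) \<omega>) \<omega> \<partial>P z) \<le> 1 - \<eta> * p / 2"
proof -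
  interpret prob_space "P z" by (rule is_wienerD(1)[OF P])
  note mP = wiener_measurable_sets[OF P]
  note sP = is_wienerD(2)[OF P]
  have r0: "0 < r" using r by simp
  have F: "closed (frontier U)" by (rule frontier_closed)
  let ?\<Phi> = "hit_by (frontier U)" and ?\<Psi> = "exit_by {y :: real^'n. C * r \<le> supn y}"
  note p\<Phi> = progress_hit[OF F] and p\<Psi> = progress_exits[of "C * r"]
  define A where "A = happens ?\<Phi> - {\<omega>\<in>happens ?\<Psi>. first_time ?\<Psi> \<omega> \<le> first_time ?\<Phi> \<omega>}"
  define T where "T = first_time ?\<Phi>"
  have st: "stopping A T" unfolding A_def T_def by (rule stopping_before(1)[OF p\<Phi> p\<Psi>])
  have As: "A \<in> events" using stoppingD(1)[OF st] sP by simp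
  have T_small: "supn (\<omega> s - \<omega> 0) < C * r" if "\<omega> \<in> A" "0 \<le> s" "s \<le> T \<omega>" for \<omega> s
  proof (rule ccontr)
    assume "\<not> ?thesis"
    then have c: "C * r \<le> supn (\<omega> s - \<omega> 0)" by simp
    have w: "\<omega> \<in> paths" by (rule stoppingD(4)[OF st that(1)])
    have "\<omega> \<in> exits (C * r)" using w c that(2) by (auto simp: exits_iff)
    moreover have "exit_time (C * r) \<omega> \<le> T \<omega>" using exit_time_le[OF w that(2) c] that(3) by simp
    ultimately show False using that(1) unfolding A_def exits_def exit_time_def T_def by blast
  qed
  have PA: "p / 2 \<le> prob A"
  proof -
    let ?G = "{\<omega>\<in>paths. \<omega> 0 = z \<and> \<omega> (r\<^sup>2) \<in> - U}" and ?E = "{\<omega>\<in>paths. ?\<Psi> (r\<^sup>2) \<omega>}"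
    have E: "?E \<in> events" using exit_event_measurable[of "r\<^sup>2" "C * r"] sP by simp
    have "p \<le> gauss_const TYPE('n) * (measure lborel (sball z r \<inter> - U) / (2 * r) ^ CARD('n))" using p by (simp add: outer_density_def)
    also have "\<dots> \<le> prob ?G" by (rule wiener_hits_set_prob[OF P r0 borel_comp[OF U]])
    also have "\<dots> \<le> prob (A \<union> ?E)"
    proof (rule finite_measure_mono)
      show "?G \<subseteq> A \<union> ?E"
      proof
        fix \<omega> assume w: "\<omega> \<in> ?G"
        show "\<omega> \<in> A \<union> ?E"
        proof (cases "\<omega> \<in> ?E")
          case False
          have h: "?\<Phi> (r\<^sup>2) \<omega>" by (rule path_crosses_frontier) (use w z in auto)
          have hp: "\<omega> \<in> happens ?\<Phi>" unfolding happens_def using h w by (intro CollectI conjI exI[of _ "r\<^sup>2"]) auto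
          have Tr: "first_time ?\<Phi> \<omega> \<le> r\<^sup>2" using first_time_le_iff[OF p\<Phi> hp, of "r\<^sup>2"] h by simp
          have "\<not> first_time ?\<Psi> \<omega> \<le> r\<^sup>2" if "\<omega> \<in> happens ?\<Psi>"
            using first_time_le_iff[OF p\<Psi> that, of "r\<^sup>2"] False w by simp
          then have "\<omega> \<in> A" unfolding A_def using hp Tr by force
          then show ?thesis by blast
        qed blast
      qed
    qed (use As E in auto)
    also have "\<dots> \<le> prob A + prob ?E" using As E by (rule measure_Un_le)
    finally show ?thesis using sup by simp
  qed
  let ?f = "\<lambda>\<omega>. K (exit_time \<epsilon> \<omega>) \<omega>"
  let ?S = "exit_time ((C + 1) * r)"
  have fm: "?f \<in> borel_measurable pathM" by (rule killing_measurable[OF k exit_time_measurable])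
  have ps: "(\<lambda>\<omega>. pshift (T \<omega>) \<omega>) \<in> measurable pathM (pathM :: (real \<Rightarrow> real^'n) measure)"
    by (rule pshift_measurable) (use stoppingD(2)[OF st] in auto)
  have iA: "indicator A \<in> borel_measurable pathM" by (rule borel_measurable_indicator[OF stoppingD(1)[OF st]])
  \<comment> \<open>The extra \<open>1\<close> in \<open>C + 1\<close> leaves a distance of at least
    \<open>r \<ge> \<epsilon>\<close> between the boundary hit and the exit, so the trap finishes in
    time.\<close>
  have key: "K (?S \<omega>) \<omega> \<le> ?f (pshift (T \<omega>) \<omega>)" if A: "\<omega> \<in> A" and e: "\<omega> \<in> exits ((C + 1) * r)" for \<omega>
  proof -
    have w: "\<omega> \<in> paths" by (rule stoppingD(4)[OF st A])
    have T0: "0 \<le> T \<omega>" by (rule stoppingD(3)[OF st A])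
    have S1: "(C + 1) * r \<le> supn (\<omega> (?S \<omega>) - \<omega> 0)" by (rule exit_time_ge[OF e])
    have TS: "T \<omega> < ?S \<omega>"
    proof (rule ccontr)
      assume "\<not> ?thesis"
      then have "supn (\<omega> (?S \<omega>) - \<omega> 0) < C * r" using T_small[OF A exit_time_nonneg[OF e]] by simp
      then show False using S1 r0 by (simp add: algebra_simps)
    qed
    have "supn (\<omega> (?S \<omega>) - \<omega> 0) \<le> supn (\<omega> (?S \<omega>) - \<omega> (T \<omega>)) + supn (\<omega> (T \<omega>) - \<omega> 0)" by (rule supn_triangle_diff)
    then have "\<epsilon> \<le> supn (\<omega> (?S \<omega>) - \<omega> (T \<omega>))"
      using S1 T_small[OF A T0 order_refl] r by (simp add: algebra_simps)
    then have m: "\<epsilon> \<le> supn (pshift (T \<omega>) \<omega> (?S \<omega> - T \<omega>) - pshift (T \<omega>) \<omega> 0)" using TS by (simp add: pshift_def)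
    have e': "pshift (T \<omega>) \<omega> \<in> exits \<epsilon>" using m TS pshift_paths[OF w] by (auto simp: exits_iff intro!: exI[of _ "?S \<omega> - T \<omega>"])
    have "exit_time \<epsilon> (pshift (T \<omega>) \<omega>) \<le> ?S \<omega> - T \<omega>" by (rule exit_time_le[OF pshift_paths[OF w] _ m]) (use TS in simp)
    then show ?thesis using exit_time_nonneg[OF e'] by (intro killing_shift[OF k w T0]) auto
  qed
  have fp: "0 \<le> ?f \<omega> \<and> ?f \<omega> \<le> 1" if "\<omega> \<in> paths" for \<omega> using killingD(1)[OF k that] .
  have m2: "(\<lambda>\<omega>. indicator A \<omega> * (1 * ?f (pshift (T \<omega>) \<omega>))) \<in> borel_measurable pathM"
    using measurable_compose[OF ps fm] by (intro borel_measurable_times iA) auto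
  have b2: "0 \<le> indicator A \<omega> * (1 * ?f (pshift (T \<omega>) \<omega>)) \<and> indicator A \<omega> * (1 * ?f (pshift (T \<omega>) \<omega>)) \<le> 1" if "\<omega> \<in> paths" for \<omega>
    using fp[OF pshift_paths[OF that]] by (auto simp: indicator_def)
  \<comment> \<open>Off \<open>A\<close> the weight is bounded by \<open>1\<close>, on
    \<open>A\<close> by the weight of the trap started at the boundary.\<close>
  have "(\<integral>\<omega>. K (?S \<omega>) \<omega> \<partial>P z) \<le> (\<integral>\<omega>. (1 - indicator A \<omega>) + indicator A \<omega> * (1 * ?f (pshift (T \<omega>) \<omega>)) \<partial>P z)"
  proof (rule wiener_integral_mono[OF P killing_measurable[OF k exit_time_measurable]])
    show "0 \<le> K (?S \<omega>) \<omega> \<and> K (?S \<omega>) \<omega> \<le> 1" if "\<omega> \<in> paths" for \<omega> using killingD(1)[OF k that] .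
    show "(\<lambda>\<omega>. (1 - indicator A \<omega>) + indicator A \<omega> * (1 * ?f (pshift (T \<omega>) \<omega>))) \<in> borel_measurable pathM"
      by (intro borel_measurable_add m2 borel_measurable_diff iA borel_measurable_const)
    show "0 \<le> (1 - indicator A \<omega>) + indicator A \<omega> * (1 * ?f (pshift (T \<omega>) \<omega>)) \<and> (1 - indicator A \<omega>) + indicator A \<omega> * (1 * ?f (pshift (T \<omega>) \<omega>)) \<le> 1"
      if "\<omega> \<in> paths" for \<omega> using fp[OF pshift_paths[OF that]] by (auto simp: indicator_def)
    show "AE \<omega> in P z. K (?S \<omega>) \<omega> \<le> (1 - indicator A \<omega>) + indicator A \<omega> * (1 * ?f (pshift (T \<omega>) \<omega>))"
      using wiener_AE_exits[OF P, of "(C + 1) * r" z]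
    proof eventually_elim
      case (elim \<omega>)
      then have w: "\<omega> \<in> paths" by (simp add: exits_iff)
      show ?case using key[OF _ elim] killingD(1)[OF k w, of "?S \<omega>"] by (auto simp: indicator_def)
    qed
  qed
  also have "\<dots> = (\<integral>\<omega>. 1 - indicator A \<omega> \<partial>P z) + (\<integral>\<omega>. indicator A \<omega> * (1 * ?f (pshift (T \<omega>) \<omega>)) \<partial>P z)"
  proof (rule Bochner_Integration.integral_add[OF _ wiener_integrable(1)[OF P m2 b2]])
    show "integrable (P z) (\<lambda>\<omega>. 1 - indicator A \<omega> :: real)"
      by (rule wiener_integrable(1)[OF P borel_measurable_diff[OF borel_measurable_const iA], where B=1])
         (simp add: indicator_def)
  qed
  also have "(\<integral>\<omega>. 1 - indicator A \<omega> \<partial>P z) = 1 - prob A"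
  proof -
    have "integrable (P z) (indicator A :: _ \<Rightarrow> real)"
      by (rule wiener_integrable(1)[OF P iA, where B=1]) (simp add: indicator_def)
    then show ?thesis using As by (subst Bochner_Integration.integral_diff) (auto simp: prob_space)
  qed
  also have "(\<integral>\<omega>. indicator A \<omega> * (1 * ?f (pshift (T \<omega>) \<omega>)) \<partial>P z) \<le> (\<integral>\<omega>. indicator A \<omega> * (1 * (1 - \<eta>)) \<partial>P z)"
  proof (rule strong_markov_le[OF P st _ _ _ fm])
    fix \<omega> assume "\<omega> \<in> A"
    then have "\<omega> \<in> happens ?\<Phi>" by (simp add: A_def)
    then have "\<omega> (T \<omega>) \<in> frontier U" unfolding T_def by (rule first_time_hit_in[OF F])
    then show "(\<integral>\<omega>'. ?f \<omega>' \<partial>P (\<omega> (T \<omega>))) \<le> 1 - \<eta>" using tr by (simp add: trap_def)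
  qed (use fp \<eta> in auto)
  also have "(\<integral>\<omega>. indicator A \<omega> * (1 * (1 - \<eta>)) \<partial>P z) = prob A * (1 - \<eta>)" using As by simp
  finally have "(\<integral>\<omega>. K (?S \<omega>) \<omega> \<partial>P z) \<le> 1 - \<eta> * prob A" by (simp add: algebra_simps)
  moreover have "\<eta> * (p / 2) \<le> \<eta> * prob A" using PA \<eta> by (intro mult_left_mono) auto
  ultimately show ?thesis by simp
qed

text \<open>A point outside \<open>U\<close> is treated by exchanging \<open>U\<close> with its
  complement: the boundary is the same and the density \<open>s\<close> becomes
  \<open>1 - s\<close>.\<close>

lemma trial:
  fixes P :: "real^'n \<Rightarrow> (real \<Rightarrow> real^'n) measure"
  assumes P: "is_wiener P" and \<eta>: "0 < \<eta>" "\<eta> < 1" and \<alpha>: "0 < \<alpha>" "\<alpha> \<le> 1/2"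
  obtains C c where "1 \<le> C" "0 < c" "c < 1"
    "\<And>K Kinf U \<epsilon> r z. killing K Kinf \<Longrightarrow> trap P K U \<epsilon> \<eta> \<Longrightarrow> U \<in> sets borel \<Longrightarrow> 0 < \<epsilon> \<Longrightarrow> \<epsilon> \<le> r \<Longrightarrow>
       \<alpha> \<le> outer_density U r z \<Longrightarrow> outer_density U r z \<le> 1 - \<alpha> \<Longrightarrow> (\<integral>\<omega>. K (exit_time (C * r) \<omega>) \<omega> \<partial>P z) \<le> 1 - c"
proof -
  \<comment> \<open>The lower bound for the chance of changing sides; the cut at \<open>1\<close>
    ensures \<open>c < 1\<close>.\<close>
  let ?p = "min 1 (gauss_const TYPE('n) * \<alpha>)"
  have p0: "0 < ?p" using gauss_const_pos[where 'n='n] \<alpha> by simp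
  obtain C where C: "0 < C" "\<And>r x. 0 < r \<Longrightarrow> measure (P x) {\<omega>\<in>paths. exit_by {y. C * r \<le> supn y} (r\<^sup>2) \<omega>} \<le> ?p / 2"
    using wiener_sup_bound[OF P, of "?p / 2"] p0 by auto
  show ?thesis
  proof (rule that[of "C + 1" "\<eta> * ?p / 2"])
    show "1 \<le> C + 1" using C by simp
    show "0 < \<eta> * ?p / 2" using p0 \<eta> by simp
    have "\<eta> * ?p \<le> 1 * 1" using \<eta> p0 by (intro mult_mono) auto
    then show "\<eta> * ?p / 2 < 1" by simp
    fix K Kinf U \<epsilon> r z
    assume k: "killing K Kinf" and tr: "trap P K U \<epsilon> \<eta>" and U: "U \<in> sets borel" and r: "0 < \<epsilon>" "\<epsilon> \<le> r"
      and s: "\<alpha> \<le> outer_density U r z" "outer_density U r z \<le> 1 - \<alpha>"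
    have r0: "0 < r" using r by simp
    show "(\<integral>\<omega>. K (exit_time ((C + 1) * r) \<omega>) \<omega> \<partial>P z) \<le> 1 - \<eta> * ?p / 2"
    proof (cases "z \<in> U")
      case True
      show ?thesis
      proof (rule trial_from_inside[OF P k tr U \<eta> r C(1) C(2)[OF r0] True])
        have "gauss_const TYPE('n) * \<alpha> \<le> gauss_const TYPE('n) * outer_density U r z" using s(1) gauss_const_pos[where 'n='n] by (intro mult_left_mono) auto
        then show "?p \<le> gauss_const TYPE('n) * outer_density U r z" by simp
      qed
    next
      case False
      have tr': "trap P K (- U) \<epsilon> \<eta>" using tr by (simp add: trap_def frontier_complement)
      show ?thesis
      proof (rule trial_from_inside[OF P k tr' borel_comp[OF U] \<eta> r C(1) C(2)[OF r0]])
        show "z \<in> - U" using False by simp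
        have "gauss_const TYPE('n) * \<alpha> \<le> gauss_const TYPE('n) * (1 - outer_density U r z)" using s(2) gauss_const_pos[where 'n='n] by (intro mult_left_mono) auto
        then show "?p \<le> gauss_const TYPE('n) * outer_density (- U) r z" unfolding outer_density_compl[OF U r0] by simp
      qed
    qed
  qed
qed

text \<open>A trial displaces the path, so the induction cannot stay at \<open>x\<close>. It runs
  over all starting points whose distance from \<open>x\<close> is at most every remaining scale;
  separation by \<open>L\<close> keeps the end point of a trial in the range required by the next
  scale.\<close>

lemma resonance:
  fixes P :: "real^'n \<Rightarrow> (real \<Rightarrow> real^'n) measure"
  assumes P: "is_wiener P" and \<eta>: "0 < \<eta>" "\<eta> < 1" and \<alpha>: "0 < \<alpha>" "\<alpha> \<le> 1/2"
  obtains L c where "1 \<le> L" "0 < c" "c < 1"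
    "\<And>K Kinf U \<epsilon> R x. killing K Kinf \<Longrightarrow> trap P K U \<epsilon> \<eta> \<Longrightarrow> U \<in> sets borel \<Longrightarrow> 0 < \<epsilon> \<Longrightarrow> finite R \<Longrightarrow>
       (\<And>r. r \<in> R \<Longrightarrow> \<epsilon> \<le> r \<and> \<alpha> \<le> outer_density U r x \<and> outer_density U r x \<le> 1 - \<alpha>) \<Longrightarrow>
       (\<And>r r'. r \<in> R \<Longrightarrow> r' \<in> R \<Longrightarrow> r < r' \<Longrightarrow> L * r \<le> r') \<Longrightarrow>
       (\<integral>\<omega>. Kinf \<omega> \<partial>P x) \<le> (1 - c) ^ card R"
proof -
  \<comment> \<open>From a point within \<open>r\<close> of \<open>x\<close> the trial uses radius
    \<open>2 * r\<close>, so that its ball contains the ball of radius \<open>r\<close> around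
    \<open>x\<close>. The ratio of radii costs a factor \<open>(1/2) ^ d\<close>.\<close>
  define \<alpha>' where "\<alpha>' = (1/2) ^ CARD('n) * \<alpha>"
  have "(1/2) ^ CARD('n) * \<alpha> \<le> 1 * (1/2)" using \<alpha> by (intro mult_mono power_le_one) auto
  then have \<alpha>': "0 < \<alpha>'" "\<alpha>' \<le> 1/2" using \<alpha> by (auto simp: \<alpha>'_def)
  obtain C c where C: "1 \<le> C" "0 < c" "c < 1" and
    trial: "\<And>K Kinf U \<epsilon> r z. killing K Kinf \<Longrightarrow> trap P K U \<epsilon> \<eta> \<Longrightarrow> U \<in> sets borel \<Longrightarrow> 0 < \<epsilon> \<Longrightarrow> \<epsilon> \<le> r \<Longrightarrow>
       \<alpha>' \<le> outer_density U r z \<Longrightarrow> outer_density U r z \<le> 1 - \<alpha>' \<Longrightarrow> (\<integral>\<omega>. K (exit_time (C * r) \<omega>) \<omega> \<partial>P z) \<le> 1 - c"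
    using trial[OF P \<eta> \<alpha>'] by blast
  show ?thesis
  \<comment> \<open>Initial distance at most \<open>r\<close> plus displacement at most
    \<open>C * (2 * r)\<close>: this total must not exceed the next scale.\<close>
  proof (rule that[of "2 * C + 1" c])
    show "1 \<le> 2 * C + 1" using C by simp
    fix K Kinf U \<epsilon> R x
    assume k: "killing K Kinf" and tr: "trap P K U \<epsilon> \<eta>" and U: "U \<in> sets borel" and \<epsilon>: "0 < \<epsilon>" and "finite R"
      and R: "\<And>r. r \<in> R \<Longrightarrow> \<epsilon> \<le> r \<and> \<alpha> \<le> outer_density U r x \<and> outer_density U r x \<le> 1 - \<alpha>"
      and sep: "\<And>r r'. r \<in> R \<Longrightarrow> r' \<in> R \<Longrightarrow> r < r' \<Longrightarrow> (2 * C + 1) * r \<le> r'"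
    have "\<forall>y. (\<forall>r\<in>R. supn (y - x) \<le> r) \<longrightarrow> (\<integral>\<omega>. Kinf \<omega> \<partial>P y) \<le> (1 - c) ^ card R"
      using \<open>finite R\<close> R sep
    \<comment> \<open>The rule adds a new smallest scale. Its trial is performed first, and the
      hypothesis then handles the larger scales.\<close>
    proof (induction R rule: finite_linorder_min_induct)
      case empty
      show ?case
      proof (intro allI impI)
        fix y
        interpret prob_space "P y" by (rule is_wienerD(1)[OF P])
        have "(\<integral>\<omega>. Kinf \<omega> \<partial>P y) \<le> (\<integral>\<omega>. 1 \<partial>P y)"
          by (rule wiener_integral_mono[OF P killingD(4)[OF k] killingD(2)[OF k]])
             (use killingD(2)[OF k] in \<open>auto simp: is_wienerD(3)[OF P] intro!: AE_I2\<close>)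
        then show "(\<integral>\<omega>. Kinf \<omega> \<partial>P y) \<le> (1 - c) ^ card ({} :: real set)" by (simp add: prob_space)
      qed
    next
      case (insert r R)
      have IH: "(\<integral>\<omega>. Kinf \<omega> \<partial>P y) \<le> (1 - c) ^ card R" if "\<forall>r\<in>R. supn (y - x) \<le> r" for y
        using insert.IH insert.prems that by blast
      have r: "\<epsilon> \<le> r" "\<alpha> \<le> outer_density U r x" "outer_density U r x \<le> 1 - \<alpha>" using insert.prems(1)[of r] by auto
      have r0: "0 < r" using r(1) \<epsilon> by simp
      show ?case
      proof (intro allI impI)
        fix y assume y: "\<forall>r'\<in>insert r R. supn (y - x) \<le> r'"
        have sx: "supn (x - y) + r \<le> 2 * r" using y supn_commute[of x y] by simp
        have rr: "r / (2 * r) = 1 / 2" using r0 by simp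
        have "(\<integral>\<omega>. K (exit_time (C * (2 * r)) \<omega>) \<omega> \<partial>P y) \<le> 1 - c"
          by (rule trial[OF k tr U \<epsilon>])
             (use outer_density_between[OF U r0 sx r(2,3)] r r0 in \<open>auto simp: \<alpha>'_def rr\<close>)
        \<comment> \<open>The starting point is only almost surely \<open>y\<close>; placing it in
          the event makes the distance estimates valid on all of \<open>?A\<close>.\<close>
        let ?T = "exit_time (C * (2 * r))" and ?A = "exits (C * (2 * r)) \<inter> {\<omega>\<in>paths. \<omega> 0 = y}"
        have CR: "0 < C * (2 * r)" using C r0 by simp
        have st0: "stopping (exits (C * (2 * r))) ?T" unfolding exits_def exit_time_def by (rule stopping_first_time[OF progress_exits])
        have st: "stopping ?A ?T"
          unfolding stopping_def
        proof (intro conjI ballI impI)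
          note [measurable] = coord_measurable
          have "{\<omega>\<in>space (pathM :: (real \<Rightarrow> real^'n) measure). \<omega> 0 = y} \<in> sets pathM" by measurable
          then show "?A \<in> sets pathM" using exits_measurable by auto
          show "?T \<in> borel_measurable pathM" by (rule exit_time_measurable)
          fix \<omega> assume w: "\<omega> \<in> ?A"
          then show T0: "0 \<le> ?T \<omega>" using stoppingD(3)[OF st0] by blast
          fix \<omega>' assume w': "\<omega>' \<in> paths" "agree (?T \<omega>) \<omega> \<omega>'"
          have "\<omega> 0 = \<omega>' 0" using w'(2) T0 by (simp add: agree_def)
          then show "\<omega>' \<in> ?A" using stoppingD(5)[OF st0] w w' by auto
          show "?T \<omega>' = ?T \<omega>" using stoppingD(6)[OF st0] w w' by blast
        qed
        have "(\<integral>\<omega>. Kinf \<omega> \<partial>P y) \<le> (\<integral>\<omega>. indicator ?A \<omega> * (K (?T \<omega>) \<omega> * (1 - c) ^ card R) \<partial>P y)"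
        proof (rule killing_restart[OF P k st])
          show "AE \<omega> in P y. \<omega> \<in> ?A"
            using wiener_AE_exits[OF P, of "C * (2 * r)" y] is_wienerD(4)[OF P, of y]
            by eventually_elim (auto simp: exits_iff)
          show "(\<lambda>\<omega>. (1 - c) ^ card R) \<in> borel_measurable pathM" by simp
          show "0 \<le> (1 - c) ^ card R \<and> (1 - c) ^ card R \<le> 1" using C by (simp add: power_le_one)
          fix \<omega> assume w: "\<omega> \<in> ?A"
          have "supn (\<omega> (?T \<omega>) - \<omega> 0) \<le> C * (2 * r)"
            by (rule before_exit_time) (use w CR stoppingD(3)[OF st w] in auto)
          then have d: "supn (\<omega> (?T \<omega>) - x) \<le> (2 * C + 1) * r"
            using supn_triangle_diff[of "\<omega> (?T \<omega>)" x y] w y by (auto simp: algebra_simps)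
          show "(\<integral>\<omega>'. Kinf \<omega>' \<partial>P (\<omega> (?T \<omega>))) \<le> (1 - c) ^ card R"
          proof (rule IH, rule ballI)
            fix r' assume r': "r' \<in> R"
            have "(2 * C + 1) * r \<le> r'" using insert.prems(2)[of r r'] insert.hyps r' by auto
            then show "supn (\<omega> (?T \<omega>) - x) \<le> r'" using d by simp
          qed
        qed
        also have "\<dots> \<le> (\<integral>\<omega>. K (?T \<omega>) \<omega> * (1 - c) ^ card R \<partial>P y)"
        proof (rule wiener_integral_mono[OF P])
          have Km: "(\<lambda>\<omega>. K (?T \<omega>) \<omega>) \<in> borel_measurable pathM" by (rule killing_measurable[OF k exit_time_measurable])
          have q: "0 \<le> (1 - c) ^ card R" "(1 - c) ^ card R \<le> 1" using C by (auto simp: power_le_one)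
          show "(\<lambda>\<omega>. indicator ?A \<omega> * (K (?T \<omega>) \<omega> * (1 - c) ^ card R)) \<in> borel_measurable pathM"
            by (intro borel_measurable_times borel_measurable_indicator Km borel_measurable_const stoppingD(1)[OF st])
          show "(\<lambda>\<omega>. K (?T \<omega>) \<omega> * (1 - c) ^ card R) \<in> borel_measurable pathM"
            by (intro borel_measurable_times Km borel_measurable_const)
          have Kq: "0 \<le> K (?T \<omega>) \<omega> * (1 - c) ^ card R \<and> K (?T \<omega>) \<omega> * (1 - c) ^ card R \<le> 1" if "\<omega> \<in> paths" for \<omega>
            using killingD(1)[OF k that, of "?T \<omega>"] q by (auto intro: mult_le_one)
          then show "0 \<le> K (?T \<omega>) \<omega> * (1 - c) ^ card R \<and> K (?T \<omega>) \<omega> * (1 - c) ^ card R \<le> 1" if "\<omega> \<in> paths" for \<omega>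
            using that by blast
          show "0 \<le> indicator ?A \<omega> * (K (?T \<omega>) \<omega> * (1 - c) ^ card R) \<and> indicator ?A \<omega> * (K (?T \<omega>) \<omega> * (1 - c) ^ card R) \<le> 1" if "\<omega> \<in> paths" for \<omega>
            using Kq[OF that] by (auto simp: indicator_def)
          show "AE \<omega> in P y. indicator ?A \<omega> * (K (?T \<omega>) \<omega> * (1 - c) ^ card R) \<le> K (?T \<omega>) \<omega> * (1 - c) ^ card R"
            using Kq by (intro AE_I2) (auto simp: indicator_def is_wienerD(3)[OF P])
        qed
        also have "\<dots> = (\<integral>\<omega>. K (?T \<omega>) \<omega> \<partial>P y) * (1 - c) ^ card R" by simp
        also have "\<dots> \<le> (1 - c) * (1 - c) ^ card R"
          by (rule mult_right_mono) (use \<open>(\<integral>\<omega>. K (exit_time (C * (2 * r)) \<omega>) \<omega> \<partial>P y) \<le> 1 - c\<close> C in auto)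
        also have "\<dots> = (1 - c) ^ card (insert r R)" using insert.hyps by (subst card_insert_disjoint) auto
        finally show "(\<integral>\<omega>. Kinf \<omega> \<partial>P y) \<le> (1 - c) ^ card (insert r R)" .
      qed
    qed
    then show "(\<integral>\<omega>. Kinf \<omega> \<partial>P x) \<le> (1 - c) ^ card R" using R \<epsilon> by (auto dest!: spec[of _ x]) force
  qed (use C in auto)
qed

section \<open>The multi-scale argument\<close>

text \<open>Finiteness of \<open>R\<close> is essential for right-closedness: each event that has
  not occurred by \<open>t\<close> is still absent at some later time, and the least of these
  finitely many times works for all.\<close>

lemma progress_count:
  fixes \<Phi> :: "'r \<Rightarrow> real \<Rightarrow> (real \<Rightarrow> real^'n) \<Rightarrow> bool"
  assumes R: "finite R" and p: "\<And>r. r \<in> R \<Longrightarrow> progress (\<Phi> r)"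
  shows "progress (\<lambda>t \<omega>. m \<le> card {r\<in>R. \<Phi> r t \<omega>})"
proof (rule progressI)
  fix \<omega> :: "real \<Rightarrow> real^'n" and s t :: real assume w: "\<omega> \<in> paths" and st: "0 \<le> s" "s \<le> t" and h: "m \<le> card {r\<in>R. \<Phi> r s \<omega>}"
  have "{r\<in>R. \<Phi> r s \<omega>} \<subseteq> {r\<in>R. \<Phi> r t \<omega>}" using progressD(1)[OF p w st] by blast
  then have "card {r\<in>R. \<Phi> r s \<omega>} \<le> card {r\<in>R. \<Phi> r t \<omega>}" by (rule card_mono[rotated]) (use R in simp)
  then show "m \<le> card {r\<in>R. \<Phi> r t \<omega>}" by (rule order_trans[OF h])
next
  fix \<omega> :: "real \<Rightarrow> real^'n" and t :: real assume w: "\<omega> \<in> paths" and t: "t \<ge> 0" and h: "\<And>s. s > t \<Longrightarrow> m \<le> card {r\<in>R. \<Phi> r s \<omega>}"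
  define S where "S = {r\<in>R. \<not> \<Phi> r t \<omega>}"
  have "\<exists>s. s > t \<and> \<not> \<Phi> r s \<omega>" if "r \<in> S" for r
  proof (rule ccontr)
    assume "\<not> ?thesis"
    then have "\<Phi> r t \<omega>" using progressD(2)[OF p w t, of r] that by (auto simp: S_def)
    then show False using that by (simp add: S_def)
  qed
  then obtain u where u: "\<And>r. r \<in> S \<Longrightarrow> u r > t \<and> \<not> \<Phi> r (u r) \<omega>" by metis
  define s where "s = Min (insert (t + 1) (u ` S))"
  have fS: "finite S" using R by (simp add: S_def)
  have s: "s > t" unfolding s_def using fS u by (subst Min_gr_iff) auto
  have sle: "s \<le> u r" if "r \<in> S" for r unfolding s_def using fS that by (intro Min_le) auto
  have "{r\<in>R. \<Phi> r s \<omega>} \<subseteq> {r\<in>R. \<Phi> r t \<omega>}"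
  proof
    fix r assume r: "r \<in> {r\<in>R. \<Phi> r s \<omega>}"
    show "r \<in> {r\<in>R. \<Phi> r t \<omega>}"
    proof (rule ccontr)
      assume "r \<notin> {r\<in>R. \<Phi> r t \<omega>}"
      then have rS: "r \<in> S" using r by (simp add: S_def)
      have "\<Phi> r (u r) \<omega>" using progressD(1)[OF p w _ sle[OF rS]] r s t by auto
      then show False using u[OF rS] by simp
    qed
  qed
  then have "card {r\<in>R. \<Phi> r s \<omega>} \<le> card {r\<in>R. \<Phi> r t \<omega>}" by (rule card_mono[rotated]) (use R in simp)
  then show "m \<le> card {r\<in>R. \<Phi> r t \<omega>}" by (rule order_trans[OF h[OF s]])
next
  fix \<omega> \<omega>' :: "real \<Rightarrow> real^'n" and t :: real
  assume a: "\<omega> \<in> paths" "\<omega>' \<in> paths" "t \<ge> 0" "agree t \<omega> \<omega>'" and h: "m \<le> card {r\<in>R. \<Phi> r t \<omega>}"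
  have "{r\<in>R. \<Phi> r t \<omega>} = {r\<in>R. \<Phi> r t \<omega>'}" using progressD(3)[OF p a] by blast
  then show "m \<le> card {r\<in>R. \<Phi> r t \<omega>'}" using h by simp
next
  fix t :: real assume t: "t \<ge> 0"
  have m: "(\<lambda>\<omega>. \<Sum>r\<in>R. indicator {\<omega>\<in>paths. \<Phi> r t \<omega>} \<omega> :: real) \<in> borel_measurable pathM"
    by (intro borel_measurable_sum borel_measurable_indicator progress_sets p t)
  have "(\<Sum>r\<in>R. indicator {\<omega>\<in>paths. \<Phi> r t \<omega>} \<omega> :: real) = real (card {r\<in>R. \<Phi> r t \<omega>})" if "\<omega> \<in> paths" for \<omega>
    using R that by (simp add: indicator_def of_bool_def sum.If_cases Int_def)
  then have "{\<omega>\<in>paths. m \<le> card {r\<in>R. \<Phi> r t \<omega>}} = {\<omega>\<in>space pathM. real m \<le> (\<Sum>r\<in>R. indicator {\<omega>\<in>paths. \<Phi> r t \<omega>} \<omega>)}"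
    by auto
  also have "\<dots> \<in> sets pathM" using borel_measurable_le[OF borel_measurable_const m] .
  finally show "{\<omega>\<in>paths. m \<le> card {r\<in>R. \<Phi> r t \<omega>}} \<in> sets pathM" .
qed

lemma stopping_Int_start:
  fixes A :: "(real \<Rightarrow> real^'n) set"
  assumes st: "stopping A T"
  shows "stopping (A \<inter> {\<omega>\<in>paths. \<omega> 0 = y}) T"
  unfolding stopping_def
proof (intro conjI ballI impI)
  note [measurable] = coord_measurable
  have "{\<omega>\<in>space (pathM :: (real \<Rightarrow> real^'n) measure). \<omega> 0 = y} \<in> sets pathM" by measurable
  then show "A \<inter> {\<omega>\<in>paths. \<omega> 0 = y} \<in> sets pathM" using stoppingD(1)[OF st] by auto
  show "T \<in> borel_measurable pathM" by (rule stoppingD(2)[OF st])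
  fix \<omega> assume w: "\<omega> \<in> A \<inter> {\<omega>\<in>paths. \<omega> 0 = y}"
  then show T0: "0 \<le> T \<omega>" using stoppingD(3)[OF st] by blast
  fix \<omega>' assume w': "\<omega>' \<in> paths" "agree (T \<omega>) \<omega> \<omega>'"
  have "\<omega> 0 = \<omega>' 0" using w'(2) T0 by (simp add: agree_def)
  then show "\<omega>' \<in> A \<inter> {\<omega>\<in>paths. \<omega> 0 = y}" using stoppingD(5)[OF st] w w' by auto
  show "T \<omega>' = T \<omega>" using stoppingD(6)[OF st] w w' by blast
qed

definition half_by :: "(real^'n) set \<Rightarrow> real \<Rightarrow> real \<Rightarrow> (real \<Rightarrow> real^'n) \<Rightarrow> bool" where
  "half_by U r = hit_by {y. 1/2 \<le> outer_density U r y}"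

lemma closed_half:
  fixes U :: "(real^'n) set"
  assumes "U \<in> sets borel" "0 < r"
  shows "closed {y. 1/2 \<le> outer_density U r y}"
  by (intro closed_Collect_le continuous_on_const continuous_outer_density assms)

text \<open>Before \<open>t\<close> the density stays below \<open>1/2\<close>, and continuity along
  the path extends the non-strict bound to \<open>t\<close>. It thus also covers a scale that
  reaches \<open>1/2\<close> exactly at \<open>t\<close>.\<close>

lemma outer_density_le_half_until:
  fixes U :: "(real^'n) set"
  assumes U: "U \<in> sets borel" "0 < r" and w: "\<omega> \<in> paths" and t: "0 \<le> t" and 0: "outer_density U r (\<omega> 0) \<le> 1/2"
    and n: "\<And>s. 0 \<le> s \<Longrightarrow> s < t \<Longrightarrow> \<not> half_by U r s \<omega>"
  shows "outer_density U r (\<omega> t) \<le> 1/2"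
proof (cases "t = 0")
  case False
  then have t0: "0 < t" using t by simp
  have c: "isCont (\<lambda>s. outer_density U r (\<omega> s)) t"
    by (rule isCont_o2[OF pathsD(3)[OF w] continuous_on_interior[OF continuous_outer_density[OF U]]]) simp
  then have "((\<lambda>s. outer_density U r (\<omega> s)) \<longlongrightarrow> outer_density U r (\<omega> t)) (at_left t)"
    unfolding isCont_def by (rule filterlim_at_split[THEN iffD1, THEN conjunct1])
  moreover have "\<forall>\<^sub>F s in at_left t. outer_density U r (\<omega> s) \<le> 1/2"
    unfolding eventually_at_left[OF t0]
  proof (intro exI[of _ 0] conjI allI impI t0)
    fix s assume s: "0 < s" "s < t"
    show "outer_density U r (\<omega> s) \<le> 1/2"
    proof (rule ccontr)
      assume "\<not> ?thesis"
      then have "half_by U r s \<omega>" unfolding half_by_def hit_by_def using s by (intro bexI[of _ s]) auto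
      then show False using n[of s] s by simp
    qed
  qed
  ultimately show ?thesis by (intro tendsto_upperbound) (auto simp: trivial_limit_at_left_real)
qed (use 0 in simp)

lemma outer_density_at_half_time:
  fixes U :: "(real^'n) set"
  assumes U: "U \<in> sets borel" "0 < r" and w: "\<omega> \<in> happens (half_by U r)" and 0: "outer_density U r (\<omega> 0) \<le> 1/2"
  shows "outer_density U r (\<omega> (first_time (half_by U r) \<omega>)) = 1/2"
proof (rule antisym)
  have p: "progress (half_by U r)" unfolding half_by_def by (rule progress_hit[OF closed_half[OF U]])
  show "outer_density U r (\<omega> (first_time (half_by U r) \<omega>)) \<le> 1/2"
  proof (rule outer_density_le_half_until[where t="first_time (half_by U r) \<omega>", OF U])
    show "0 \<le> first_time (half_by U r) \<omega>" by (rule first_time_nonneg[OF w])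
    show "outer_density U r (\<omega> 0) \<le> 1/2" by (rule 0)
    show "\<omega> \<in> paths" using w by (simp add: happens_def)
    show "\<not> half_by U r s \<omega>" if "0 \<le> s" "s < first_time (half_by U r) \<omega>" for s
      using first_time_le_iff[OF p w that(1)] that(2) by simp
  qed
  show "1/2 \<le> outer_density U r (\<omega> (first_time (half_by U r) \<omega>))"
    using first_time_hit_in[OF closed_half[OF U] w[unfolded half_by_def]] by (simp add: half_by_def)
qed

text \<open>The path leaves every ball almost surely, and far from the bounded set the density is
  \<open>1\<close>.\<close>

lemma wiener_AE_half:
  fixes P :: "real^'n \<Rightarrow> (real \<Rightarrow> real^'n) measure"
  assumes P: "is_wiener P" and U: "U \<in> sets borel" "bounded U" "0 < r"
  shows "AE \<omega> in P x. \<omega> \<in> happens (half_by U r)"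
proof -
  obtain M where M: "0 < M" "\<And>y. M \<le> supn y \<Longrightarrow> outer_density U r y = 1" using outer_density_far[OF U(2,3)] by blast
  show ?thesis
    using wiener_AE_exits[OF P, of "M + supn x" x] is_wienerD(4)[OF P, of x]
  proof eventually_elim
    case (elim \<omega>)
    then obtain s where s: "\<omega> \<in> paths" "0 \<le> s" "M + supn x \<le> supn (\<omega> s - x)" by (auto simp: exits_iff)
    have "supn (\<omega> s - x) \<le> supn (\<omega> s) + supn x" using supn_triangle[of "\<omega> s" "- x"] supn_minus[of x] by simp
    then have "M \<le> supn (\<omega> s)" using s by linarith
    then have "outer_density U r (\<omega> s) = 1" by (rule M(2))
    then have "half_by U r s \<omega>" unfolding half_by_def hit_by_def using s(2) by (intro bexI[of _ s]) auto
    then show ?case unfolding happens_def using s by blast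
  qed
qed

text \<open>Several events may occur at the same instant, so more than \<open>m\<close> may have
  occurred at the first time itself. Only the count strictly before is controlled; there, finitely
  many witness times have a common upper bound, their maximum.\<close>

lemma few_before_first_time:
  assumes R: "finite R" and p: "\<And>r. r \<in> R \<Longrightarrow> progress (\<Phi> r)" and m: "0 < m"
    and w: "\<omega> \<in> happens (\<lambda>t \<omega>. m \<le> card {r\<in>R. \<Phi> r t \<omega>})"
  shows "card {r\<in>R. \<exists>t. 0 \<le> t \<and> t < first_time (\<lambda>t \<omega>. m \<le> card {r\<in>R. \<Phi> r t \<omega>}) \<omega> \<and> \<Phi> r t \<omega>} < m"
proof -
  let ?\<Psi> = "\<lambda>t \<omega>. m \<le> card {r\<in>R. \<Phi> r t \<omega>}"
  let ?\<tau> = "first_time ?\<Psi> \<omega>"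
  let ?S = "{r\<in>R. \<exists>t. 0 \<le> t \<and> t < ?\<tau> \<and> \<Phi> r t \<omega>}"
  have w': "\<omega> \<in> paths" using w by (simp add: happens_def)
  have pc: "progress ?\<Psi>" by (rule progress_count[OF R p])
  have "\<forall>r\<in>?S. \<exists>t. 0 \<le> t \<and> t < ?\<tau> \<and> \<Phi> r t \<omega>" by blast
  from bchoice[OF this] obtain u where u: "\<And>r. r \<in> ?S \<Longrightarrow> 0 \<le> u r \<and> u r < ?\<tau> \<and> \<Phi> r (u r) \<omega>" by blast
  show ?thesis
  proof (cases "?S = {}")
    case True then show ?thesis using m by (simp only: card.empty)
  next
    case False
    have fS: "finite ?S" using R by simp
    define t where "t = Max (u ` ?S)"
    have "t \<in> u ` ?S" unfolding t_def using fS False by (intro Max_in) auto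
    then have t: "0 \<le> t" "t < ?\<tau>" using u by auto
    have "?S \<subseteq> {r\<in>R. \<Phi> r t \<omega>}"
    proof
      fix r assume r: "r \<in> ?S"
      have "u r \<le> t" unfolding t_def using fS r by (intro Max_ge) auto
      then have "\<Phi> r t \<omega>" using progressD(1)[OF p w', of r "u r" t] u[OF r] r by blast
      then show "r \<in> {r\<in>R. \<Phi> r t \<omega>}" using r by blast
    qed
    then have "card ?S \<le> card {r\<in>R. \<Phi> r t \<omega>}" using R by (intro card_mono) auto
    moreover have "\<not> ?\<Psi> t \<omega>" using first_time_le_iff[OF pc w t(1)] t(2) by simp
    ultimately show ?thesis by simp
  qed
qed

text \<open>The induction step with its inputs abstracted: \<open>trial\<close> is the loss at a
  half point, \<open>many\<close> the bound already known for \<open>m\<close> scales,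
  \<open>reson\<close> the bound at a point near which many scales are at half density.\<close>

lemma solidification_step:
  fixes P :: "real^'n \<Rightarrow> (real \<Rightarrow> real^'n) measure"
  assumes P: "is_wiener P" and k: "killing K Kinf" and U: "U \<in> sets borel" "bounded U"
    and R: "finite R" "card R = 2 * m" "0 < m" "\<And>r. r \<in> R \<Longrightarrow> 0 < r \<and> outer_density U r x \<le> 1/2"
    and c: "0 < c" "c < 1" and C: "1 \<le> C"
    and trial: "\<And>r z. r \<in> R \<Longrightarrow> outer_density U r z = 1/2 \<Longrightarrow> (\<integral>\<omega>. K (exit_time (C * r) \<omega>) \<omega> \<partial>P z) \<le> 1 - c"
    and many: "\<And>R' z. R' \<subseteq> R \<Longrightarrow> m \<le> card R' \<Longrightarrow> (\<And>r. r \<in> R' \<Longrightarrow> outer_density U r z \<le> 1/2) \<Longrightarrow> (\<integral>\<omega>. Kinf \<omega> \<partial>P z) \<le> a"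
    and reson: "\<And>R' z y. R' \<subseteq> R \<Longrightarrow> c * real m / 2 \<le> real (card R') \<Longrightarrow>
       (\<And>r. r \<in> R' \<Longrightarrow> outer_density U r (y r) = 1/2 \<and> supn (y r - z) \<le> C * r) \<Longrightarrow> (\<integral>\<omega>. Kinf \<omega> \<partial>P z) \<le> \<rho>"
    and a: "0 \<le> a" "a \<le> 1" and \<rho>: "0 \<le> \<rho>" "\<rho> \<le> 1"
  shows "(\<integral>\<omega>. Kinf \<omega> \<partial>P x) \<le> (1 - c / 4) * a + \<rho>"
proof -
  interpret prob_space "P x" by (rule is_wienerD(1)[OF P])
  note sP = is_wienerD(2)[OF P]
  have p: "progress (half_by U r)" if "r \<in> R" for r
    unfolding half_by_def by (rule progress_hit[OF closed_half]) (use U R(4) that in auto)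
  define \<Psi> where "\<Psi> = (\<lambda>t \<omega>. m \<le> card {r\<in>R. half_by U r t \<omega>})"
  have p\<Psi>: "progress \<Psi>" unfolding \<Psi>_def by (rule progress_count[OF R(1) p])
  define \<tau> where "\<tau> = first_time \<Psi>"
  define T where "T r = first_time (half_by U r)" for r
  define D where "D r = happens (half_by U r)" for r
  define A where "A = happens \<Psi> \<inter> {\<omega>\<in>paths. \<omega> 0 = x}"
  \<comment> \<open>The event \<open>T r \<le> \<tau>\<close>, written as the complement of
    \<open>\<tau> < T r\<close> so that it is known at time \<open>T r\<close> and a trial can be
    started there.\<close>
  define Ar where "Ar r = (D r - {\<omega>\<in>happens \<Psi>. \<tau> \<omega> < T r \<omega>}) \<inter> {\<omega>\<in>paths. \<omega> 0 = x}" for r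
  have stA: "stopping A \<tau>" unfolding A_def \<tau>_def by (intro stopping_Int_start stopping_first_time p\<Psi>)
  have stAr: "stopping (Ar r) (T r)" if "r \<in> R" for r
    unfolding Ar_def D_def T_def \<tau>_def by (intro stopping_Int_start stopping_before(2) p\<Psi> p that)
  have Tm: "T r \<in> borel_measurable pathM" if "r \<in> R" for r unfolding T_def by (rule first_time_measurable[OF p[OF that]])
  have \<tau>m: "\<tau> \<in> borel_measurable pathM" unfolding \<tau>_def by (rule first_time_measurable[OF p\<Psi>])
  \<comment> \<open>The started scales whose half point is still within \<open>C * r\<close> at time
    \<open>\<tau>\<close>; for these a trial need not have been completed.\<close>
  define N where "N r = Ar r \<inter> {\<omega>\<in>space pathM. supn (\<omega> (T r \<omega>) - \<omega> (\<tau> \<omega>)) \<le> C * r}" for r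
  have Nm: "N r \<in> sets pathM" if "r \<in> R" for r
  proof -
    have "(\<lambda>\<omega>. \<omega> (T r \<omega>) - \<omega> (\<tau> \<omega>)) \<in> borel_measurable (pathM :: (real \<Rightarrow> real^'n) measure)"
      by (intro borel_measurable_diff measurable_eval[OF measurable_ident_sets[OF refl]] Tm[OF that] \<tau>m)
    then have "(\<lambda>\<omega>. supn (\<omega> (T r \<omega>) - \<omega> (\<tau> \<omega>))) \<in> borel_measurable (pathM :: (real \<Rightarrow> real^'n) measure)"
      by (rule measurable_compose[OF _ borel_measurable_continuous_onI[OF continuous_supn]])
    from borel_measurable_le[OF this borel_measurable_const] show ?thesis
      unfolding N_def using stoppingD(1)[OF stAr[OF that]] by blast
  qed
  define near where "near \<omega> = (\<Sum>r\<in>R. indicator (N r) \<omega> :: real)" for \<omega>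
  define num where "num \<omega> = (\<Sum>r\<in>R. indicator (Ar r) \<omega> :: real)" for \<omega>
  have card_sum: "(\<Sum>r\<in>R. indicator (B r) \<omega> :: real) = real (card {r\<in>R. \<omega> \<in> B r})" for B :: "real \<Rightarrow> (real \<Rightarrow> real^'n) set" and \<omega>
    using R(1) by (simp add: indicator_def of_bool_def sum.If_cases Int_def)
  have nearm: "near \<in> borel_measurable pathM"
    unfolding near_def by (intro borel_measurable_sum borel_measurable_indicator Nm)
  have numm: "num \<in> borel_measurable pathM"
    unfolding num_def by (intro borel_measurable_sum borel_measurable_indicator stoppingD(1)[OF stAr])
  \<comment> \<open>Enough near scales to apply \<open>reson\<close> at time \<open>\<tau>\<close>.
    The threshold \<open>c * m / 2\<close> is half of the gain \<open>c * m\<close> that the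
    averaging below produces.\<close>
  define G where "G = {\<omega>\<in>space pathM. c * real m / 2 \<le> near \<omega>}"
  have Gm: "G \<in> sets pathM" unfolding G_def using borel_measurable_le[OF borel_measurable_const nearm] .
  have Am: "A \<in> sets pathM" by (rule stoppingD(1)[OF stA])
  have Km: "(\<lambda>\<omega>. K (\<tau> \<omega>) \<omega>) \<in> borel_measurable pathM" by (rule killing_measurable[OF k \<tau>m])
  have Ap: "\<omega> \<in> paths \<and> \<omega> 0 = x \<and> \<omega> \<in> happens \<Psi>" if "\<omega> \<in> A" for \<omega> using that by (simp add: A_def)
  have Ar_half: "outer_density U r (\<omega> (T r \<omega>)) = 1/2" if "r \<in> R" "\<omega> \<in> Ar r" for r \<omega>
    unfolding T_def by (rule outer_density_at_half_time) (use U R(4)[OF that(1)] that(2) in \<open>auto simp: Ar_def D_def\<close>)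
  have Ar_iff: "\<omega> \<in> Ar r \<longleftrightarrow> half_by U r (\<tau> \<omega>) \<omega>" if A: "\<omega> \<in> A" and r: "r \<in> R" for \<omega> r
  proof
    have \<tau>0: "0 \<le> \<tau> \<omega>" using stoppingD(3)[OF stA A] .
    {
      assume h: "\<omega> \<in> Ar r"
      then have d: "\<omega> \<in> happens (half_by U r)" "T r \<omega> \<le> \<tau> \<omega>" using Ap[OF A] by (auto simp: Ar_def D_def)
      show "half_by U r (\<tau> \<omega>) \<omega>" using first_time_le_iff[OF p[OF r] d(1) \<tau>0] d(2) by (simp add: T_def)
    }
    assume h: "half_by U r (\<tau> \<omega>) \<omega>"
    then have d: "\<omega> \<in> happens (half_by U r)" unfolding happens_def using Ap[OF A] \<tau>0 by blast
    have "T r \<omega> \<le> \<tau> \<omega>" using first_time_le_iff[OF p[OF r] d \<tau>0] h by (simp add: T_def)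
    then show "\<omega> \<in> Ar r" using d Ap[OF A] by (auto simp: Ar_def D_def)
  qed
  have Ar_le: "T r \<omega> \<le> \<tau> \<omega>" if "\<omega> \<in> A" "\<omega> \<in> Ar r" for \<omega> r
    using that Ap[OF that(1)] by (auto simp: Ar_def)
  have num_ge: "real m \<le> num \<omega>" if A: "\<omega> \<in> A" for \<omega>
  proof -
    have "\<Psi> (\<tau> \<omega>) \<omega>" unfolding \<tau>_def by (rule first_time_occurs[OF p\<Psi>]) (use Ap[OF A] in simp)
    then have "m \<le> card {r\<in>R. half_by U r (\<tau> \<omega>) \<omega>}" by (simp add: \<Psi>_def)
    also have "{r\<in>R. half_by U r (\<tau> \<omega>) \<omega>} = {r\<in>R. \<omega> \<in> Ar r}" using Ar_iff[OF A] by blast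
    finally show ?thesis unfolding num_def card_sum by simp
  qed
  have num_le: "num \<omega> \<le> 2 * real m" and num0: "0 \<le> num \<omega>" for \<omega>
  proof -
    have "card {r\<in>R. \<omega> \<in> Ar r} \<le> card R" by (rule card_mono) (use R(1) in auto)
    then show "num \<omega> \<le> 2 * real m" unfolding num_def card_sum using R(2) by simp
    show "0 \<le> num \<omega>" unfolding num_def card_sum by simp
  qed
  have AE_A: "AE \<omega> in P x. \<omega> \<in> A"
  proof -
    have "AE \<omega> in P x. \<forall>r\<in>R. \<omega> \<in> happens (half_by U r)"
      by (rule AE_finite_allI[OF R(1)], rule wiener_AE_half[OF P U]) (use R(4) in auto)
    then show ?thesis using is_wienerD(4)[OF P, of x]
    proof (eventually_elim)
      case (elim \<omega>)
      have "R \<noteq> {}" using R(2,3) by auto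
      then obtain r0 where "r0 \<in> R" by blast
      then have w: "\<omega> \<in> paths" using elim(1) by (auto simp: happens_def)
      have tr: "T r \<omega> \<le> Max ((\<lambda>r. T r \<omega>) ` R)" if "r \<in> R" for r using R(1) that by (intro Max_ge) auto
      define t where "t = Max ((\<lambda>r. T r \<omega>) ` R)"
      have "0 \<le> T r0 \<omega>" unfolding T_def by (rule first_time_nonneg) (use elim(1) \<open>r0 \<in> R\<close> in blast)
      then have t0: "0 \<le> t" using tr[OF \<open>r0 \<in> R\<close>] by (simp add: t_def)
      have "half_by U r t \<omega>" if "r \<in> R" for r
        using first_time_le_iff[OF p[OF that] _ t0] tr[OF that] elim(1) that by (auto simp: T_def t_def)
      then have "{r\<in>R. half_by U r t \<omega>} = R" by blast
      then have "\<Psi> t \<omega>" unfolding \<Psi>_def using R(2) by simp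
      then show ?case unfolding A_def happens_def using w t0 elim(2) by blast
    qed
  qed
  \<comment> \<open>Bound for survival after \<open>\<tau>\<close>: \<open>\<rho>\<close> at a
    resonance point, and \<open>a\<close> otherwise.\<close>
  define b where "b \<omega> = a * (1 - indicator G \<omega>) + \<rho>" for \<omega> :: "real \<Rightarrow> real^'n"
  have bm: "b \<in> borel_measurable pathM"
    unfolding b_def by (intro borel_measurable_add borel_measurable_times borel_measurable_diff borel_measurable_const borel_measurable_indicator Gm)
  have b01: "0 \<le> b \<omega> \<and> b \<omega> \<le> 2" for \<omega> using a \<rho> by (auto simp: b_def indicator_def)
  have bound: "(\<integral>\<omega>'. Kinf \<omega>' \<partial>P (\<omega> (\<tau> \<omega>))) \<le> b \<omega>" if A: "\<omega> \<in> A" for \<omega>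
  proof (cases "\<omega> \<in> G")
    case True
    have "(\<integral>\<omega>'. Kinf \<omega>' \<partial>P (\<omega> (\<tau> \<omega>))) \<le> \<rho>"
    proof (rule reson)
      show "{r\<in>R. \<omega> \<in> N r} \<subseteq> R" by blast
      show "c * real m / 2 \<le> real (card {r\<in>R. \<omega> \<in> N r})" using True unfolding G_def near_def card_sum by simp
      show "outer_density U r (\<omega> (T r \<omega>)) = 1/2 \<and> supn (\<omega> (T r \<omega>) - \<omega> (\<tau> \<omega>)) \<le> C * r" if "r \<in> {r\<in>R. \<omega> \<in> N r}" for r
        using that Ar_half[of r \<omega>] by (auto simp: N_def)
    qed
    then show ?thesis using True by (simp add: b_def)
  next
    case False
    have w: "\<omega> \<in> paths" "\<omega> 0 = x" "\<omega> \<in> happens \<Psi>" using Ap[OF A] by auto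
    \<comment> \<open>Fewer than \<open>m\<close> of the \<open>2 * m\<close> scales reached half
      density strictly before \<open>\<tau>\<close>; the others, including those reaching it at
      \<open>\<tau>\<close>, have density at most \<open>1/2\<close> there.\<close>
    let ?S = "{r\<in>R. \<exists>t. 0 \<le> t \<and> t < \<tau> \<omega> \<and> half_by U r t \<omega>}"
    have S: "card ?S < m"
      using few_before_first_time[OF R(1) p R(3) w(3)[unfolded \<Psi>_def]] by (simp add: \<tau>_def \<Psi>_def)
    have "(\<integral>\<omega>'. Kinf \<omega>' \<partial>P (\<omega> (\<tau> \<omega>))) \<le> a"
    proof (rule many)
      show "R - ?S \<subseteq> R" by blast
      have "card (R - ?S) = card R - card ?S" by (rule card_Diff_subset) (use R(1) in auto)
      then show "m \<le> card (R - ?S)" using S R(2) by simp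
      fix r assume r: "r \<in> R - ?S"
      show "outer_density U r (\<omega> (\<tau> \<omega>)) \<le> 1/2"
        by (rule outer_density_le_half_until[OF U(1) _ w(1) stoppingD(3)[OF stA A]]) (use r R(4)[of r] w(2) in auto)
    qed
    then show ?thesis using False \<rho> by (simp add: b_def)
  qed
  have step1: "(\<integral>\<omega>. Kinf \<omega> \<partial>P x) \<le> (\<integral>\<omega>. indicator A \<omega> * (K (\<tau> \<omega>) \<omega> * b \<omega>) \<partial>P x)"
    by (rule killing_restart[OF P k stA AE_A bm b01 bound])
  \<comment> \<open>The weight surviving until \<open>\<tau>\<close> without resonance; the factor
    \<open>1 - c / 4\<close> comes from its expectation.\<close>
  define Y where "Y \<omega> = indicator A \<omega> * (K (\<tau> \<omega>) \<omega> * (1 - indicator G \<omega>))" for \<omega>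
  have Ym: "Y \<in> borel_measurable pathM"
    unfolding Y_def by (intro borel_measurable_times borel_measurable_diff borel_measurable_const borel_measurable_indicator Gm Am Km)
  have Y01: "0 \<le> Y \<omega> \<and> Y \<omega> \<le> 1" if "\<omega> \<in> paths" for \<omega>
    using killingD(1)[OF k that, of "\<tau> \<omega>"] by (auto simp: Y_def indicator_def)
  have iY: "integrable (P x) Y" by (rule wiener_integrable(1)[OF P Ym Y01])
  have "(\<integral>\<omega>. indicator A \<omega> * (K (\<tau> \<omega>) \<omega> * b \<omega>) \<partial>P x) \<le> (\<integral>\<omega>. a * Y \<omega> + \<rho> \<partial>P x)"
  proof (rule wiener_integral_mono[OF P, where B=2 and B'=2])
    show "(\<lambda>\<omega>. indicator A \<omega> * (K (\<tau> \<omega>) \<omega> * b \<omega>)) \<in> borel_measurable pathM"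
      by (intro borel_measurable_times borel_measurable_indicator Am Km bm)
    show "(\<lambda>\<omega>. a * Y \<omega> + \<rho>) \<in> borel_measurable pathM"
      by (intro borel_measurable_add borel_measurable_times borel_measurable_const Ym)
    fix \<omega> :: "real \<Rightarrow> real^'n" assume w: "\<omega> \<in> paths"
    have "K (\<tau> \<omega>) \<omega> * b \<omega> \<le> 1 * 2" using killingD(1)[OF k w, of "\<tau> \<omega>"] b01[of \<omega>] by (intro mult_mono) auto
    then show "0 \<le> indicator A \<omega> * (K (\<tau> \<omega>) \<omega> * b \<omega>) \<and> indicator A \<omega> * (K (\<tau> \<omega>) \<omega> * b \<omega>) \<le> 2"
      using killingD(1)[OF k w, of "\<tau> \<omega>"] b01[of \<omega>] by (auto simp: indicator_def)
    have "a * Y \<omega> \<le> 1 * 1" using a Y01[OF w] by (intro mult_mono) auto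
    then show "0 \<le> a * Y \<omega> + \<rho> \<and> a * Y \<omega> + \<rho> \<le> 2" using a \<rho> Y01[OF w] by auto
  next
    show "AE \<omega> in P x. indicator A \<omega> * (K (\<tau> \<omega>) \<omega> * b \<omega>) \<le> a * Y \<omega> + \<rho>"
    proof (rule AE_I2)
      fix \<omega> assume "\<omega> \<in> space (P x)"
      then have w: "\<omega> \<in> paths" using is_wienerD(3)[OF P] by simp
      have "indicator A \<omega> * (K (\<tau> \<omega>) \<omega> * b \<omega>) = a * Y \<omega> + (indicator A \<omega> * K (\<tau> \<omega>) \<omega>) * \<rho>"
        by (simp add: Y_def b_def algebra_simps)
      also have "(indicator A \<omega> * K (\<tau> \<omega>) \<omega>) * \<rho> \<le> 1 * \<rho>"
        using killingD(1)[OF k w, of "\<tau> \<omega>"] \<rho> by (intro mult_right_mono) (auto simp: indicator_def)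
      finally show "indicator A \<omega> * (K (\<tau> \<omega>) \<omega> * b \<omega>) \<le> a * Y \<omega> + \<rho>" by simp
    qed
  qed
  also have "\<dots> = a * (\<integral>\<omega>. Y \<omega> \<partial>P x) + \<rho>" using iY by (simp add: prob_space)
  finally have step2: "(\<integral>\<omega>. Kinf \<omega> \<partial>P x) \<le> a * (\<integral>\<omega>. Y \<omega> \<partial>P x) + \<rho>" using step1 by simp

  \<comment> \<open>The weight of the complete trial at scale \<open>r\<close>, whether or not it
    ends before \<open>\<tau>\<close>; the strong Markov property at \<open>T r\<close> gives its
    expectation the factor \<open>1 - c\<close>.\<close>
  define Z where "Z r \<omega> = indicator (Ar r) \<omega> * (1 * K (exit_time (C * r) (pshift (T r \<omega>) \<omega>)) (pshift (T r \<omega>) \<omega>))" for r \<omega>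
  have fm: "(\<lambda>\<omega>. K (exit_time (C * r) \<omega>) \<omega>) \<in> borel_measurable pathM" for r by (rule killing_measurable[OF k exit_time_measurable])
  have Zm: "Z r \<in> borel_measurable pathM" if "r \<in> R" for r
  proof -
    have ps: "(\<lambda>\<omega>. pshift (T r \<omega>) \<omega>) \<in> measurable pathM (pathM :: (real \<Rightarrow> real^'n) measure)"
      by (rule pshift_measurable) (use Tm[OF that] in auto)
    show ?thesis unfolding Z_def
      by (intro borel_measurable_times borel_measurable_const borel_measurable_indicator stoppingD(1)[OF stAr[OF that]] measurable_compose[OF ps fm])
  qed
  have Z01: "0 \<le> Z r \<omega> \<and> Z r \<omega> \<le> 1" if "\<omega> \<in> paths" for r \<omega>
    using killingD(1)[OF k pshift_paths[OF that], of "exit_time (C * r) (pshift (T r \<omega>) \<omega>)" "T r \<omega>"] by (auto simp: Z_def indicator_def)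
  have iZ: "integrable (P x) (Z r)" if "r \<in> R" for r by (rule wiener_integrable(1)[OF P Zm[OF that] Z01])
  have iAr: "integrable (P x) (indicator (Ar r) :: _ \<Rightarrow> real)" if "r \<in> R" for r
    by (rule wiener_integrable(1)[OF P borel_measurable_indicator[OF stoppingD(1)[OF stAr[OF that]]], where B=1]) (simp add: indicator_def)
  have EZ: "(\<integral>\<omega>. Z r \<omega> \<partial>P x) \<le> (1 - c) * (\<integral>\<omega>. indicator (Ar r) \<omega> \<partial>P x)" if r: "r \<in> R" for r
  proof -
    have "(\<integral>\<omega>. Z r \<omega> \<partial>P x) \<le> (\<integral>\<omega>. indicator (Ar r) \<omega> * (1 * (1 - c)) \<partial>P x)"
      unfolding Z_def
    proof (rule strong_markov_le[OF P stAr[OF r] _ _ _ fm])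
      fix \<omega> assume w: "\<omega> \<in> Ar r"
      show "(\<integral>\<omega>'. K (exit_time (C * r) \<omega>') \<omega>' \<partial>P (\<omega> (T r \<omega>))) \<le> 1 - c"
        by (rule trial[OF r Ar_half[OF r w]])
    qed (use killingD(1)[OF k] c in auto)
    then show ?thesis by (simp add: mult.commute)
  qed
  \<comment> \<open>If the path is farther than \<open>C * r\<close> from its half point at time
    \<open>\<tau>\<close>, the trial has ended by then, and its killing is contained in the killing
    up to \<open>\<tau>\<close>.\<close>
  have Zge: "K (\<tau> \<omega>) \<omega> \<le> Z r \<omega>" if A: "\<omega> \<in> A" and r: "r \<in> R" "\<omega> \<in> Ar r" "\<omega> \<notin> N r" for \<omega> r
  proof -
    have w: "\<omega> \<in> paths" using Ap[OF A] by simp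
    have T0: "0 \<le> T r \<omega>" "T r \<omega> \<le> \<tau> \<omega>" using stoppingD(3)[OF stAr[OF r(1)] r(2)] Ar_le[OF A r(2)] by auto
    have "C * r \<le> supn (\<omega> (T r \<omega>) - \<omega> (\<tau> \<omega>))" using r w by (auto simp: N_def)
    then have far: "C * r \<le> supn (pshift (T r \<omega>) \<omega> (\<tau> \<omega> - T r \<omega>) - pshift (T r \<omega>) \<omega> 0)"
      using T0 supn_commute[of "\<omega> (T r \<omega>)" "\<omega> (\<tau> \<omega>)"] by (simp add: pshift_def)
    have e: "pshift (T r \<omega>) \<omega> \<in> exits (C * r)"
      using far T0 pshift_paths[OF w] by (auto simp: exits_iff intro!: exI[of _ "\<tau> \<omega> - T r \<omega>"])
    have "exit_time (C * r) (pshift (T r \<omega>) \<omega>) \<le> \<tau> \<omega> - T r \<omega>"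
      by (rule exit_time_le[OF pshift_paths[OF w] _ far]) (use T0 in simp)
    then have "K (\<tau> \<omega>) \<omega> \<le> K (exit_time (C * r) (pshift (T r \<omega>) \<omega>)) (pshift (T r \<omega>) \<omega>)"
      using exit_time_nonneg[OF e] by (intro killing_shift[OF k w T0(1)]) auto
    then show ?thesis using r(2) by (simp add: Z_def)
  qed
  \<comment> \<open>Count \<open>Y\<close> once per scale. The \<open>2 * m - num\<close> scales not
    yet started contribute at most \<open>1\<close> each; off \<open>G\<close> the near ones
    contribute at most \<open>c * m / 2\<close> in total, and each remaining one at most
    \<open>Z r\<close>. On \<open>G\<close> the weight \<open>Y\<close> is \<open>0\<close>.\<close>
  have pointwise: "2 * real m * Y \<omega> \<le> 2 * real m - num \<omega> + (\<Sum>r\<in>R. Z r \<omega>) + c * real m / 2" if A: "\<omega> \<in> A" for \<omega>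
  proof -
    have w: "\<omega> \<in> paths" using Ap[OF A] by simp
    have Y: "0 \<le> Y \<omega>" "Y \<omega> \<le> 1" using Y01[OF w] by auto
    have "num \<omega> * Y \<omega> \<le> (\<Sum>r\<in>R. Z r \<omega>) + c * real m / 2"
    proof (cases "\<omega> \<in> G")
      case True
      then show ?thesis using Z01[OF w] c by (simp add: Y_def sum_nonneg)
    next
      case False
      then have YK: "Y \<omega> = K (\<tau> \<omega>) \<omega>" using A by (simp add: Y_def)
      have nr: "near \<omega> \<le> c * real m / 2" using False w by (simp add: G_def)
      have "(num \<omega> - near \<omega>) * Y \<omega> = (\<Sum>r\<in>R. (indicator (Ar r) \<omega> - indicator (N r) \<omega>) * Y \<omega>)"
        by (simp add: num_def near_def sum_subtractf sum_distrib_right left_diff_distrib)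
      also have "\<dots> \<le> (\<Sum>r\<in>R. Z r \<omega>)"
      proof (rule sum_mono)
        fix r assume r: "r \<in> R"
        show "(indicator (Ar r) \<omega> - indicator (N r) \<omega>) * Y \<omega> \<le> Z r \<omega>"
        proof (cases "\<omega> \<in> Ar r \<and> \<omega> \<notin> N r")
          case True then show ?thesis using Zge[OF A r] YK by simp
        next
          case False
          then have "indicator (Ar r) \<omega> - indicator (N r) \<omega> = (0::real)" by (auto simp: N_def indicator_def)
          then show ?thesis using Z01[OF w, of r] by simp
        qed
      qed
      finally have "num \<omega> * Y \<omega> \<le> (\<Sum>r\<in>R. Z r \<omega>) + near \<omega> * Y \<omega>" by (simp add: left_diff_distrib)
      also have "near \<omega> * Y \<omega> \<le> near \<omega> * 1"
        by (rule mult_left_mono) (use Y in \<open>auto simp: near_def sum_nonneg\<close>)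
      finally show ?thesis using nr by simp
    qed
    moreover have "(2 * real m - num \<omega>) * Y \<omega> \<le> (2 * real m - num \<omega>) * 1"
      using num_le[of \<omega>] Y by (intro mult_left_mono) auto
    ultimately show ?thesis by (simp add: left_diff_distrib)
  qed
  have inum: "integrable (P x) num" unfolding num_def using iAr by (intro Bochner_Integration.integrable_sum) auto
  have "(\<integral>\<omega>. 2 * real m * Y \<omega> \<partial>P x) \<le> (\<integral>\<omega>. 2 * real m - num \<omega> + (\<Sum>r\<in>R. Z r \<omega>) + c * real m / 2 \<partial>P x)"
  proof (rule integral_mono_AE)
    show "integrable (P x) (\<lambda>\<omega>. 2 * real m * Y \<omega>)" using iY by simp
    show "integrable (P x) (\<lambda>\<omega>. 2 * real m - num \<omega> + (\<Sum>r\<in>R. Z r \<omega>) + c * real m / 2)"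
      using inum iZ by (intro Bochner_Integration.integrable_add Bochner_Integration.integrable_diff integrable_const Bochner_Integration.integrable_sum) auto
    show "AE \<omega> in P x. 2 * real m * Y \<omega> \<le> 2 * real m - num \<omega> + (\<Sum>r\<in>R. Z r \<omega>) + c * real m / 2"
      using AE_A by eventually_elim (rule pointwise)
  qed
  also have "\<dots> = 2 * real m - (\<integral>\<omega>. num \<omega> \<partial>P x) + (\<Sum>r\<in>R. \<integral>\<omega>. Z r \<omega> \<partial>P x) + c * real m / 2"
    using inum iZ by (simp add: Bochner_Integration.integral_sum prob_space)
  also have "(\<Sum>r\<in>R. \<integral>\<omega>. Z r \<omega> \<partial>P x) \<le> (\<Sum>r\<in>R. (1 - c) * (\<integral>\<omega>. indicator (Ar r) \<omega> \<partial>P x))"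
    by (rule sum_mono) (rule EZ)
  also have "(\<Sum>r\<in>R. (1 - c) * (\<integral>\<omega>. indicator (Ar r) \<omega> \<partial>P x)) = (1 - c) * (\<integral>\<omega>. num \<omega> \<partial>P x)"
    unfolding num_def using iAr by (subst Bochner_Integration.integral_sum) (auto simp: sum_distrib_left)
  finally have main: "2 * real m * (\<integral>\<omega>. Y \<omega> \<partial>P x) \<le> 2 * real m - c * (\<integral>\<omega>. num \<omega> \<partial>P x) + c * real m / 2"
    by (simp add: algebra_simps)
  \<comment> \<open>With \<open>num\<close> at least \<open>m\<close> in the mean, the gain
    \<open>c * m\<close> exceeds the error \<open>c * m / 2\<close>; dividing the difference by
    \<open>2 * m\<close> gives \<open>c / 4\<close>.\<close>
  have "real m \<le> (\<integral>\<omega>. num \<omega> \<partial>P x)"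
  proof -
    have "(\<integral>\<omega>. real m \<partial>P x) \<le> (\<integral>\<omega>. num \<omega> \<partial>P x)"
      by (rule integral_mono_AE[OF _ inum]) (use AE_A in \<open>auto elim!: eventually_mono intro: num_ge\<close>)
    then show ?thesis by (simp add: prob_space)
  qed
  then have "c * real m \<le> c * (\<integral>\<omega>. num \<omega> \<partial>P x)" using c by (intro mult_left_mono) auto
  then have "2 * real m * (\<integral>\<omega>. Y \<omega> \<partial>P x) \<le> 2 * real m * (1 - c / 4)" using main by (simp add: algebra_simps)
  then have "(\<integral>\<omega>. Y \<omega> \<partial>P x) \<le> 1 - c / 4" using R(3) by (simp add: mult_le_cancel_left_pos)
  then have "a * (\<integral>\<omega>. Y \<omega> \<partial>P x) \<le> a * (1 - c / 4)" using a by (intro mult_left_mono) auto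
  then show ?thesis using step2 by (simp add: mult.commute)
qed

text \<open>Induction on the power of \<open>1 - c / 8\<close>: the number of scales is first
  enlarged for the resonance bound and then doubled. The thresholds depend on none of the obstacle,
  the set, \<open>\<epsilon>\<close> or the starting point, so the quantifiers over these stay
  inside the induction hypothesis.\<close>

lemma solidification:
  fixes P :: "real^'n \<Rightarrow> (real \<Rightarrow> real^'n) measure"
  assumes P: "is_wiener P" and \<eta>: "0 < \<eta>" "\<eta> < 1" and \<delta>: "0 < \<delta>"
  obtains J :: nat and L :: real where "1 \<le> L"
    "\<And>K Kinf U \<epsilon> R x. killing K Kinf \<Longrightarrow> trap P K U \<epsilon> \<eta> \<Longrightarrow> U \<in> sets borel \<Longrightarrow> bounded U \<Longrightarrow> 0 < \<epsilon> \<Longrightarrow>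
       finite R \<Longrightarrow> J \<le> card R \<Longrightarrow> (\<And>r. r \<in> R \<Longrightarrow> \<epsilon> \<le> r \<and> outer_density U r x \<le> 1/2) \<Longrightarrow>
       (\<And>r r'. r \<in> R \<Longrightarrow> r' \<in> R \<Longrightarrow> r < r' \<Longrightarrow> L * r \<le> r') \<Longrightarrow> (\<integral>\<omega>. Kinf \<omega> \<partial>P x) \<le> \<delta>"
proof -
  obtain C c where C: "1 \<le> C" "0 < c" "c < 1" and
    trial: "\<And>K Kinf U \<epsilon> r z. killing K Kinf \<Longrightarrow> trap P K U \<epsilon> \<eta> \<Longrightarrow> U \<in> sets borel \<Longrightarrow> 0 < \<epsilon> \<Longrightarrow> \<epsilon> \<le> r \<Longrightarrow>
       1/2 \<le> outer_density U r z \<Longrightarrow> outer_density U r z \<le> 1 - 1/2 \<Longrightarrow> (\<integral>\<omega>. K (exit_time (C * r) \<omega>) \<omega> \<partial>P z) \<le> 1 - c"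
    using trial[OF P \<eta>, of "1/2"] by auto
  \<comment> \<open>A half point of radius \<open>r\<close> within \<open>C * r\<close> of
    \<open>z\<close> has its ball inside the ball of radius \<open>(C + 1) * r\<close> around
    \<open>z\<close>; its density \<open>1/2\<close> is diluted by the ratio of volumes.\<close>
  define \<alpha> where "\<alpha> = (1 / (C + 1)) ^ CARD('n) * (1/2)"
  have "(1 / (C + 1)) ^ CARD('n) \<le> 1" using C by (intro power_le_one) auto
  then have \<alpha>: "0 < \<alpha>" "\<alpha> \<le> 1/2" using C by (auto simp: \<alpha>_def)
  obtain L c2 where L: "1 \<le> L" "0 < c2" "c2 < 1" and
    reson: "\<And>K Kinf U \<epsilon> R x. killing K Kinf \<Longrightarrow> trap P K U \<epsilon> \<eta> \<Longrightarrow> U \<in> sets borel \<Longrightarrow> 0 < \<epsilon> \<Longrightarrow> finite R \<Longrightarrow>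
       (\<And>r. r \<in> R \<Longrightarrow> \<epsilon> \<le> r \<and> \<alpha> \<le> outer_density U r x \<and> outer_density U r x \<le> 1 - \<alpha>) \<Longrightarrow>
       (\<And>r r'. r \<in> R \<Longrightarrow> r' \<in> R \<Longrightarrow> r < r' \<Longrightarrow> L * r \<le> r') \<Longrightarrow>
       (\<integral>\<omega>. Kinf \<omega> \<partial>P x) \<le> (1 - c2) ^ card R"
    using resonance[OF P \<eta> \<alpha>] by blast
  let ?q = "1 - c / 8"
  have "\<exists>J::nat. \<forall>K Kinf U \<epsilon> R x. killing K Kinf \<longrightarrow> trap P K U \<epsilon> \<eta> \<longrightarrow> U \<in> sets borel \<longrightarrow> bounded U \<longrightarrow> 0 < \<epsilon> \<longrightarrow>
       finite R \<longrightarrow> J \<le> card R \<longrightarrow> (\<forall>r\<in>R. \<epsilon> \<le> r \<and> outer_density U r x \<le> 1/2) \<longrightarrow>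
       (\<forall>r\<in>R. \<forall>r'\<in>R. r < r' \<longrightarrow> L * r \<le> r') \<longrightarrow> (\<integral>\<omega>. Kinf \<omega> \<partial>P x) \<le> ?q ^ n" for n
  proof (induction n)
    case 0
    show ?case
    proof (intro exI allI impI)
      fix K and Kinf :: "(real \<Rightarrow> real^'n) \<Rightarrow> real" and x :: "real^'n" assume k: "killing K Kinf"
      interpret prob_space "P x" by (rule is_wienerD(1)[OF P])
      have "(\<integral>\<omega>. Kinf \<omega> \<partial>P x) \<le> (\<integral>\<omega>. 1 \<partial>P x)"
        by (rule wiener_integral_mono[OF P killingD(4)[OF k] killingD(2)[OF k]])
           (use killingD(2)[OF k] in \<open>auto simp: is_wienerD(3)[OF P] intro!: AE_I2\<close>)
      then show "(\<integral>\<omega>. Kinf \<omega> \<partial>P x) \<le> ?q ^ 0" by (simp add: prob_space)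
    qed
  next
    case (Suc n)
    then obtain J :: nat where J: "\<And>K Kinf U \<epsilon> R x. killing K Kinf \<Longrightarrow> trap P K U \<epsilon> \<eta> \<Longrightarrow> U \<in> sets borel \<Longrightarrow> bounded U \<Longrightarrow> 0 < \<epsilon> \<Longrightarrow>
       finite R \<Longrightarrow> J \<le> card R \<Longrightarrow> (\<forall>r\<in>R. \<epsilon> \<le> r \<and> outer_density U r x \<le> 1/2) \<Longrightarrow>
       (\<forall>r\<in>R. \<forall>r'\<in>R. r < r' \<longrightarrow> L * r \<le> r') \<Longrightarrow> (\<integral>\<omega>. Kinf \<omega> \<partial>P x) \<le> ?q ^ n" by blast
    have q: "0 < ?q" "?q \<le> 1" using C by auto
    \<comment> \<open>Chosen so that \<open>(1 - c / 4) * q ^ n + \<rho>\<close> is exactly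
      \<open>q ^ (n + 1)\<close> for \<open>q = 1 - c / 8\<close>.\<close>
    define \<rho> where "\<rho> = c / 8 * ?q ^ n"
    have qn: "0 < ?q ^ n" "?q ^ n \<le> 1" using q by (auto simp: power_le_one)
    have "c / 8 * ?q ^ n \<le> 1 * 1" using C qn by (intro mult_mono) auto
    then have \<rho>: "0 < \<rho>" "\<rho> \<le> 1" using C qn by (auto simp: \<rho>_def)
    \<comment> \<open>\<open>k0\<close> resonant scales push survival below \<open>\<rho>\<close>.
      Then \<open>m\<close> is taken so large that \<open>c * m / 2\<close> near scales are at least
      \<open>k0\<close>.\<close>
    obtain k0 where k0: "(1 - c2) ^ k0 < \<rho>" using real_arch_pow_inv[OF \<rho>(1), of "1 - c2"] L by auto
    obtain m0 :: nat where m0: "2 * real k0 / c \<le> real m0" using real_arch_simple by blast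
    define m where "m = max (max J m0) 1"
    have m: "J \<le> m" "0 < m" "real k0 \<le> c * real m / 2"
    proof -
      show "J \<le> m" "0 < m" by (auto simp: m_def)
      have "2 * real k0 / c \<le> real m" using m0 by (simp add: m_def)
      then show "real k0 \<le> c * real m / 2" using C by (simp add: pos_divide_le_eq mult.commute)
    qed
    show ?case
    proof (intro exI[of _ "2 * m"] allI impI)
      fix K and Kinf :: "(real \<Rightarrow> real^'n) \<Rightarrow> real" and U \<epsilon> R and x :: "real^'n"
      assume k: "killing K Kinf" and tr: "trap P K U \<epsilon> \<eta>" and U: "U \<in> sets borel" "bounded U" and \<epsilon>: "0 < \<epsilon>"
        and R0: "finite R" "2 * m \<le> card R" "\<forall>r\<in>R. \<epsilon> \<le> r \<and> outer_density U r x \<le> 1/2" "\<forall>r\<in>R. \<forall>r'\<in>R. r < r' \<longrightarrow> L * r \<le> r'"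
      \<comment> \<open>The averaging step works with exactly \<open>2 * m\<close> scales; surplus
        ones are discarded.\<close>
      obtain R1 where R1: "R1 \<subseteq> R" "card R1 = 2 * m" by (rule obtain_subset_with_card_n[OF R0(2)])
      have fR1: "finite R1" using R1 R0(1) finite_subset by blast
      have R1p: "\<epsilon> \<le> r \<and> outer_density U r x \<le> 1/2" if "r \<in> R1" for r using R0(3) R1 that by blast
      have sep: "L * r \<le> r'" if "r \<in> R1" "r' \<in> R1" "r < r'" for r r' using R0(4) R1 that by blast
      have "(\<integral>\<omega>. Kinf \<omega> \<partial>P x) \<le> (1 - c / 4) * ?q ^ n + \<rho>"
      proof (rule solidification_step[OF P k U fR1 R1(2) m(2) _ C(2,3,1)])
        show "0 < r \<and> outer_density U r x \<le> 1/2" if "r \<in> R1" for r using R1p[OF that] \<epsilon> by auto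
        show "(\<integral>\<omega>. K (exit_time (C * r) \<omega>) \<omega> \<partial>P z) \<le> 1 - c" if "r \<in> R1" "outer_density U r z = 1/2" for r z
        proof (rule trial[OF k tr U(1) \<epsilon>])
          show "\<epsilon> \<le> r" using R1p[OF that(1)] by blast
          show "1/2 \<le> outer_density U r z" "outer_density U r z \<le> 1 - 1/2" using that(2) by simp_all
        qed
        show "(\<integral>\<omega>. Kinf \<omega> \<partial>P z) \<le> ?q ^ n" if "R' \<subseteq> R1" "m \<le> card R'" "\<And>r. r \<in> R' \<Longrightarrow> outer_density U r z \<le> 1/2" for R' z
        proof (rule J[OF k tr U \<epsilon>])
          show "finite R'" using that(1) fR1 finite_subset by blast
          show "J \<le> card R'" using that(2) m(1) by simp
          show "\<forall>r\<in>R'. \<epsilon> \<le> r \<and> outer_density U r z \<le> 1 / 2" using that(1,3) R1p by blast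
          show "\<forall>r\<in>R'. \<forall>r'\<in>R'. r < r' \<longrightarrow> L * r \<le> r'" using that(1) sep by blast
        qed
        show "(\<integral>\<omega>. Kinf \<omega> \<partial>P z) \<le> \<rho>"
          if "R' \<subseteq> R1" "c * real m / 2 \<le> real (card R')" and y: "\<And>r. r \<in> R' \<Longrightarrow> outer_density U r (y r) = 1/2 \<and> supn (y r - z) \<le> C * r" for R' z y
        proof -
          have fR': "finite R'" using that(1) fR1 finite_subset by blast
          \<comment> \<open>All near scales are enlarged by the same factor, which preserves their
            number and the separation by \<open>L\<close>.\<close>
          let ?f = "\<lambda>r. (C + 1) * r"
          have inj: "inj_on ?f R'" using C by (auto simp: inj_on_def)
          have "(\<integral>\<omega>. Kinf \<omega> \<partial>P z) \<le> (1 - c2) ^ card (?f ` R')"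
          proof (rule reson[OF k tr U(1) \<epsilon>])
            show "finite (?f ` R')" using fR' by simp
            fix s assume "s \<in> ?f ` R'"
            then obtain r where r: "s = (C + 1) * r" "r \<in> R'" by blast
            have re: "\<epsilon> \<le> r" "0 < r" using R1p[of r] r(2) that(1) \<epsilon> by auto
            have "1 * r \<le> (C + 1) * r" using C re by (intro mult_right_mono) auto
            then have 1: "\<epsilon> \<le> s" using re r(1) by linarith
            have d: "supn (y r - z) + r \<le> s" using y[OF r(2)] r(1) by (simp add: algebra_simps)
            have rs: "r / s = 1 / (C + 1)" using re r(1) by simp
            have "1/2 \<le> outer_density U r (y r)" "outer_density U r (y r) \<le> 1 - 1/2" using y[OF r(2)] by auto
            from outer_density_between[OF U(1) re(2) d this] show "\<epsilon> \<le> s \<and> \<alpha> \<le> outer_density U s z \<and> outer_density U s z \<le> 1 - \<alpha>"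
              using 1 by (simp add: rs \<alpha>_def)
          next
            fix s s' assume s: "s \<in> ?f ` R'" "s' \<in> ?f ` R'" "s < s'"
            then obtain r r' where r: "s = (C + 1) * r" "r \<in> R'" "s' = (C + 1) * r'" "r' \<in> R'" by blast
            have "r < r'" using s(3) r C by (simp add: mult_less_cancel_left_pos)
            then have "L * r \<le> r'" using sep that(1) r by blast
            then have "(C + 1) * (L * r) \<le> (C + 1) * r'" using C by (intro mult_left_mono) auto
            then show "L * s \<le> s'" using r by (simp add: mult_ac)
          qed
          also have "card (?f ` R') = card R'" by (rule card_image[OF inj])
          also have "(1 - c2) ^ card R' \<le> (1 - c2) ^ k0"
            by (rule power_decreasing) (use that(2) m(3) L in auto)
          finally show ?thesis using k0 by simp
        qed
      qed (use qn \<rho> in auto)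
      also have "(1 - c / 4) * ?q ^ n + \<rho> = ?q ^ Suc n" by (simp add: \<rho>_def algebra_simps)
      finally show "(\<integral>\<omega>. Kinf \<omega> \<partial>P x) \<le> ?q ^ Suc n" .
    qed
  qed
  note ex = this
  obtain n where n: "?q ^ n < \<delta>" using real_arch_pow_inv[OF \<delta>, of ?q] C by auto
  obtain J :: nat where J: "\<forall>K Kinf U \<epsilon> R x. killing K Kinf \<longrightarrow> trap P K U \<epsilon> \<eta> \<longrightarrow> U \<in> sets borel \<longrightarrow> bounded U \<longrightarrow> 0 < \<epsilon> \<longrightarrow>
       finite R \<longrightarrow> J \<le> card R \<longrightarrow> (\<forall>r\<in>R. \<epsilon> \<le> r \<and> outer_density U r x \<le> 1/2) \<longrightarrow>
       (\<forall>r\<in>R. \<forall>r'\<in>R. r < r' \<longrightarrow> L * r \<le> r') \<longrightarrow> (\<integral>\<omega>. Kinf \<omega> \<partial>P x) \<le> ?q ^ n"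
    using ex[of n] by (elim exE)
  show ?thesis
  proof (rule that[OF L(1), of J])
    fix K and Kinf :: "(real \<Rightarrow> real^'n) \<Rightarrow> real" and U \<epsilon> R and x :: "real^'n"
    assume "killing K Kinf" "trap P K U \<epsilon> \<eta>" "U \<in> sets borel" "bounded U" "0 < \<epsilon>" "finite R" "J \<le> card R"
      and R: "\<And>r. r \<in> R \<Longrightarrow> \<epsilon> \<le> r \<and> outer_density U r x \<le> 1/2" "\<And>r r'. r \<in> R \<Longrightarrow> r' \<in> R \<Longrightarrow> r < r' \<Longrightarrow> L * r \<le> r'"
    then have "(\<integral>\<omega>. Kinf \<omega> \<partial>P x) \<le> ?q ^ n"
      by (intro J[rule_format, of K Kinf U \<epsilon> R x]) assumption+
    then show "(\<integral>\<omega>. Kinf \<omega> \<partial>P x) \<le> \<delta>" using n by simp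
  qed
qed

section \<open>Hard obstacles\<close>

lemma Inf_times_eq:
  fixes Q :: "real \<Rightarrow> bool"
  shows "Inf {ereal s | s. 0 \<le> s \<and> Q s} = \<infinity> \<longleftrightarrow> (\<forall>s\<ge>0. \<not> Q s)"
proof
  assume h: "Inf {ereal s | s. 0 \<le> s \<and> Q s} = \<infinity>"
  show "\<forall>s\<ge>0. \<not> Q s"
  proof (intro allI impI notI)
    fix s assume "0 \<le> s" "Q s"
    then have "Inf {ereal s | s. 0 \<le> s \<and> Q s} \<le> ereal s" by (intro Inf_lower) blast
    then show False using h by simp
  qed
next
  assume "\<forall>s\<ge>0. \<not> Q s"
  then have "{ereal s | s. 0 \<le> s \<and> Q s} = {}" by blast
  then show "Inf {ereal s | s. 0 \<le> s \<and> Q s} = \<infinity>" by (simp only: Inf_empty top_ereal_def)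
qed

lemma Inf_times_attained:
  fixes Q :: "real \<Rightarrow> bool"
  assumes "0 \<le> t" "Q t" "\<And>s. 0 \<le> s \<Longrightarrow> Q s \<Longrightarrow> t \<le> s"
  shows "Inf {ereal s | s. 0 \<le> s \<and> Q s} = ereal t"
proof (rule antisym)
  show "Inf {ereal s | s. 0 \<le> s \<and> Q s} \<le> ereal t" by (rule Inf_lower) (use assms in blast)
  show "ereal t \<le> Inf {ereal s | s. 0 \<le> s \<and> Q s}" by (rule Inf_greatest) (use assms(3) in auto)
qed

lemma happens_hit_iff: "\<omega> \<in> happens (hit_by F) \<longleftrightarrow> \<omega> \<in> paths \<and> (\<exists>s\<ge>0. \<omega> s \<in> F)"
  unfolding happens_def hit_by_def by force

text \<open>For a closed set the infimum is attained, which links the extended-real times of the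
  statement with the real first times and the event \<open>happens\<close>.\<close>

lemma hit_eq:
  assumes "closed F" "\<omega> \<in> paths"
  shows "hit F \<omega> = (if \<omega> \<in> happens (hit_by F) then ereal (first_time (hit_by F) \<omega>) else \<infinity>)"
proof (cases "\<omega> \<in> happens (hit_by F)")
  case True
  have "hit F \<omega> = ereal (first_time (hit_by F) \<omega>)"
    unfolding hit_def
  proof (rule Inf_times_attained)
    show "0 \<le> first_time (hit_by F) \<omega>" by (rule first_time_nonneg[OF True])
    show "\<omega> (first_time (hit_by F) \<omega>) \<in> F" by (rule first_time_hit_in[OF assms(1) True])
    fix s assume s: "0 \<le> s" "\<omega> s \<in> F"
    show "first_time (hit_by F) \<omega> \<le> s"
    proof (rule ccontr)
      assume "\<not> ?thesis"
      then have "s < first_time (hit_by F) \<omega>" by simp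
      then show False using before_first_time_hit[OF assms(1) True s(1)] s(2) by blast
    qed
  qed
  then show ?thesis using True by simp
next
  case False
  then have "hit F \<omega> = \<infinity>" unfolding hit_def Inf_times_eq using assms(2) by (simp add: happens_hit_iff)
  then show ?thesis using False by simp
qed

lemma tau_eq:
  assumes "\<omega> \<in> paths"
  shows "tau r \<omega> = (if \<omega> \<in> exits r then ereal (exit_time r \<omega>) else \<infinity>)"
proof (cases "\<omega> \<in> exits r")
  case True
  have "tau r \<omega> = ereal (exit_time r \<omega>)"
    unfolding tau_def by (rule Inf_times_attained) (use exit_time_nonneg[OF True] exit_time_ge[OF True] exit_time_le[OF assms] in auto)
  then show ?thesis using True by simp
next
  case False
  then have "tau r \<omega> = \<infinity>" unfolding tau_def Inf_times_eq using assms by (simp add: exits_iff)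
  then show ?thesis using False by simp
qed

lemma tau_pos: "0 < r \<Longrightarrow> \<omega> \<in> paths \<Longrightarrow> 0 < tau r \<omega>"
proof (subst tau_eq, assumption, cases "\<omega> \<in> exits r")
  assume r: "0 < r" and e: "\<omega> \<in> exits r"
  have "exit_time r \<omega> \<noteq> 0" using exit_time_ge[OF e] r by auto
  then have "0 < exit_time r \<omega>" using exit_time_nonneg[OF e] by simp
  then show "0 < (if \<omega> \<in> exits r then ereal (exit_time r \<omega>) else \<infinity>)" using e by simp
qed simp

lemma hit_less_tau_measurable:
  fixes F :: "(real^'n) set"
  assumes F: "closed F"
  shows "{\<omega>\<in>paths. hit F \<omega> < tau r \<omega>} \<in> sets pathM"
proof -
  note m = first_time_measurable[OF progress_hit[OF F]] exit_time_measurable[of r]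
  have "{\<omega>\<in>paths. hit F \<omega> < tau r \<omega>} =
    happens (hit_by F) \<inter> ((space pathM - exits r) \<union> {\<omega>\<in>space pathM. first_time (hit_by F) \<omega> < exit_time r \<omega>})"
    by (auto simp: hit_eq[OF F] tau_eq happens_def split: if_splits)
  also have "\<dots> \<in> sets pathM"
    by (intro sets.Int sets.Un sets.Diff sets.top happens_measurable progress_hit F exits_measurable borel_measurable_less m)
  finally show ?thesis .
qed

definition hardK :: "(real^'n) set \<Rightarrow> real \<Rightarrow> (real \<Rightarrow> real^'n) \<Rightarrow> real" where
  "hardK F t \<omega> = (if hit_by F t \<omega> then 0 else 1)"

definition hardKinf :: "(real^'n) set \<Rightarrow> (real \<Rightarrow> real^'n) \<Rightarrow> real" where
  "hardKinf F \<omega> = (if \<exists>s\<ge>0. \<omega> s \<in> F then 0 else 1)"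

lemma hit_by_shift: "0 \<le> s \<Longrightarrow> hit_by F t (pshift s \<omega>) \<Longrightarrow> hit_by F (s + t) \<omega>"
  unfolding hit_by_def pshift_def by (elim bexE, rule_tac x="s + sa" in bexI) (auto simp: max_absorb1)

lemma killing_hard:
  fixes F :: "(real^'n) set"
  assumes F: "closed F"
  shows "killing (hardK F) (hardKinf F)"
  unfolding killing_def
proof (intro conjI ballI allI impI)
  let ?H = "happens (hit_by F)" and ?T = "first_time (hit_by F)"
  note p = progress_hit[OF F]
  have H: "?H \<in> sets pathM" by (rule happens_measurable[OF p])
  \<comment> \<open>Joint measurability comes from writing the hit by time \<open>t\<close> as
    \<open>T \<le> t\<close>, a comparison of two measurable functions of time and path.\<close>
  let ?B = "(snd -` ?H \<inter> space (borel \<Otimes>\<^sub>M pathM)) \<inter> {q\<in>space (borel \<Otimes>\<^sub>M pathM). ?T (snd q) \<le> fst q}"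
  have B: "?B \<in> sets (borel \<Otimes>\<^sub>M pathM)"
    by (intro sets.Int measurable_sets[OF measurable_snd H] borel_measurable_le measurable_fst
        measurable_compose[OF measurable_snd first_time_measurable[OF p]])
  show "(\<lambda>(t, \<omega>). hardK F t \<omega>) \<in> borel_measurable (borel \<Otimes>\<^sub>M pathM)"
  proof (rule measurable_cong[THEN iffD1])
    show "(\<lambda>q. 1 - indicator ?B q :: real) \<in> borel_measurable (borel \<Otimes>\<^sub>M pathM)"
      by (intro borel_measurable_diff borel_measurable_const borel_measurable_indicator B)
    fix q assume q: "q \<in> space ((borel :: real measure) \<Otimes>\<^sub>M (pathM :: (real \<Rightarrow> real^'n) measure))"
    obtain t \<omega> where tw: "q = (t, \<omega>)" by (cases q)
    have w: "\<omega> \<in> paths" using q tw by (simp add: space_pair_measure)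
    have "hit_by F t \<omega> \<longleftrightarrow> q \<in> ?B"
    proof (cases "0 \<le> t")
      case True
      show ?thesis
      proof
        assume h: "hit_by F t \<omega>"
        then have "\<omega> \<in> ?H" unfolding happens_def using w True by blast
        then show "q \<in> ?B" using first_time_le_iff[OF p _ True, of \<omega>] h q tw by simp
      next
        assume "q \<in> ?B"
        then show "hit_by F t \<omega>" using first_time_le_iff[OF p _ True, of \<omega>] tw by simp
      qed
    \<comment> \<open>For negative \<open>t\<close> the interval \<open>{0..t}\<close> is empty, and
      first times are nonnegative: both descriptions are false.\<close>
    next
      case False
      then have "\<not> hit_by F t \<omega>" by (simp add: hit_by_def)
      moreover have "q \<notin> ?B" using first_time_nonneg[of \<omega> "hit_by F"] False tw by auto
      ultimately show ?thesis by simp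
    qed
    then show "1 - indicator ?B q = (case q of (t, \<omega>) \<Rightarrow> hardK F t \<omega>)" using tw by (simp add: hardK_def)
  qed
  show "hardKinf F \<in> borel_measurable pathM"
  proof (rule measurable_cong[THEN iffD1])
    show "(\<lambda>q. 1 - indicator ?H q :: real) \<in> borel_measurable pathM"
      by (intro borel_measurable_diff borel_measurable_const borel_measurable_indicator H)
    show "1 - indicator ?H \<omega> = hardKinf F \<omega>" if "\<omega> \<in> space pathM" for \<omega>
      using that by (simp add: hardKinf_def indicator_def happens_hit_iff)
  qed
  fix \<omega> :: "real \<Rightarrow> real^'n" assume w: "\<omega> \<in> paths"
  show "hardK F (s + t) \<omega> \<le> hardK F s \<omega> * hardK F t (pshift s \<omega>)" if "0 \<le> s" "0 \<le> t" for s t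
    using hit_by_shift[of s F t \<omega>] hit_by_mono[of s "s + t" F \<omega>] that by (auto simp: hardK_def)
  show "hardKinf F \<omega> \<le> hardK F s \<omega> * hardKinf F (pshift s \<omega>)" if "0 \<le> s" for s
  proof (cases "hardKinf F \<omega> = 0")
    case True then show ?thesis by (simp add: hardK_def hardKinf_def)
  next
    case False
    then have n: "\<And>u. 0 \<le> u \<Longrightarrow> \<omega> u \<notin> F" by (auto simp: hardKinf_def split: if_splits)
    then have "\<not> hit_by F s \<omega>" by (auto simp: hit_by_def)
    moreover have "\<not> (\<exists>u\<ge>0. pshift s \<omega> u \<in> F)" using n that by (simp add: pshift_def)
    ultimately show ?thesis by (simp add: hardK_def hardKinf_def)
  qed
  show "hardK F t \<omega> = hardK F t \<omega>'" if "agree t \<omega> \<omega>'" for t \<omega>'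
    using hit_by_agree[OF that, of F] hit_by_agree[OF agree_sym[OF that], of F] unfolding hardK_def by auto
qed (auto simp: hardK_def hardKinf_def)

text \<open>A hit before the exit has happened by the exit time, so there the weight is at most the
  indicator that no such hit occurred.\<close>

lemma trap_hard:
  fixes P :: "real^'n \<Rightarrow> (real \<Rightarrow> real^'n) measure"
  assumes P: "is_wiener P" and S: "\<Sigma> \<in> Scls P U \<epsilon> \<eta>"
  shows "trap P (hardK \<Sigma>) U \<epsilon> \<eta>"
  unfolding trap_def
proof
  fix y assume y: "y \<in> frontier U"
  interpret prob_space "P y" by (rule is_wienerD(1)[OF P])
  have F: "closed \<Sigma>" using S by (auto simp: Scls_def intro: compact_imp_closed)
  note k = killing_hard[OF F]
  let ?B = "{\<omega>\<in>paths. hit \<Sigma> \<omega> < tau \<epsilon> \<omega>}"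
  have B: "?B \<in> sets pathM" by (rule hit_less_tau_measurable[OF F])
  have pB: "\<eta> \<le> prob ?B" using S y by (simp add: Scls_def is_wienerD(3)[OF P])
  have iB: "indicator ?B \<in> borel_measurable pathM" by (rule borel_measurable_indicator[OF B])
  have "(\<integral>\<omega>. hardK \<Sigma> (exit_time \<epsilon> \<omega>) \<omega> \<partial>P y) \<le> (\<integral>\<omega>. 1 - indicator ?B \<omega> \<partial>P y)"
  proof (rule wiener_integral_mono[OF P killing_measurable[OF k exit_time_measurable] killingD(1)[OF k] borel_measurable_diff[OF borel_measurable_const iB], where B'=1])
    show "AE \<omega> in P y. hardK \<Sigma> (exit_time \<epsilon> \<omega>) \<omega> \<le> 1 - indicator ?B \<omega>"
      using wiener_AE_exits[OF P, of \<epsilon> y]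
    proof eventually_elim
      case (elim \<omega>)
      then have w: "\<omega> \<in> paths" by (simp add: exits_iff)
      show ?case
      proof (cases "\<omega> \<in> ?B")
        case True
        then have h: "\<omega> \<in> happens (hit_by \<Sigma>)" "first_time (hit_by \<Sigma>) \<omega> < exit_time \<epsilon> \<omega>"
          using elim by (auto simp: hit_eq[OF F w] tau_eq[OF w] split: if_splits)
        then have "hit_by \<Sigma> (exit_time \<epsilon> \<omega>) \<omega>"
          using first_time_le_iff[OF progress_hit[OF F] h(1) exit_time_nonneg[OF elim]] by simp
        then show ?thesis using True by (simp add: hardK_def)
      qed (simp add: hardK_def)
    qed
  qed (auto simp: indicator_def)
  also have "\<dots> = 1 - prob ?B"
  proof -
    have "integrable (P y) (indicator ?B :: _ \<Rightarrow> real)"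
      by (rule wiener_integrable(1)[OF P iB, where B=1]) (simp add: indicator_def)
    then show ?thesis using B is_wienerD(2)[OF P] by (subst Bochner_Integration.integral_diff) (auto simp: prob_space)
  qed
  finally show "(\<integral>\<omega>. hardK \<Sigma> (exit_time \<epsilon> \<omega>) \<omega> \<partial>P y) \<le> 1 - \<eta>" using pB by simp
qed

lemma hit_infinite_measurable:
  assumes F: "closed F"
  shows "{\<omega>\<in>paths. hit F \<omega> = \<infinity>} \<in> sets pathM"
proof -
  have "{\<omega>\<in>paths. hit F \<omega> = \<infinity>} = space pathM - happens (hit_by F)" by (auto simp: hit_eq[OF F] happens_def split: if_splits)
  then show ?thesis using sets.compl_sets[OF happens_measurable[OF progress_hit[OF F]]] by (simp only:)
qed

lemma measure_hit_infinite:
  fixes P :: "real^'n \<Rightarrow> (real \<Rightarrow> real^'n) measure"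
  assumes P: "is_wiener P" and F: "closed \<Sigma>"
  shows "measure (P x) {\<omega>\<in>space (P x). hit \<Sigma> \<omega> = \<infinity>} = (\<integral>\<omega>. hardKinf \<Sigma> \<omega> \<partial>P x)"
proof -
  let ?B = "{\<omega>\<in>paths. hit \<Sigma> \<omega> = \<infinity>}"
  have B: "?B \<in> sets (P x)" using hit_infinite_measurable[OF F] is_wienerD(2)[OF P] by simp
  have "(\<integral>\<omega>. hardKinf \<Sigma> \<omega> \<partial>P x) = (\<integral>\<omega>. indicator ?B \<omega> \<partial>P x)"
    by (rule Bochner_Integration.integral_cong)
       (auto simp: hardKinf_def hit_eq[OF F] happens_hit_iff is_wienerD(3)[OF P] indicator_def split: if_splits)
  moreover have "?B \<inter> paths = ?B" by blast
  ultimately show ?thesis using B by (simp add: is_wienerD(3)[OF P])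
qed

section \<open>Soft obstacles\<close>

text \<open>The exponential \<open>exp (- I)\<close> on \<open>[0, \<infinity>]\<close>, with value
  \<open>0\<close> at infinity. Separated from the time integral, it turns additivity of the latter
  into multiplicativity.\<close>

definition neg_exp :: "ennreal \<Rightarrow> real" where
  "neg_exp I = (if I = \<infinity> then 0 else exp (- enn2real I))"

definition time_integral :: "(real^'n \<Rightarrow> real) \<Rightarrow> ereal \<Rightarrow> (real \<Rightarrow> real^'n) \<Rightarrow> ennreal" where
  "time_integral V T \<omega> = (\<integral>\<^sup>+ s. indicator {s. 0 \<le> s \<and> ereal s < T} s * ennreal (V (\<omega> s)) \<partial>lborel)"

lemma exp_neg_int_eq: "exp_neg_int V T \<omega> = neg_exp (time_integral V T \<omega>)"
  by (simp add: exp_neg_int_def neg_exp_def time_integral_def Let_def)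

lemma neg_exp_bounds: "0 \<le> neg_exp I \<and> neg_exp I \<le> 1"
  by (simp add: neg_exp_def)

lemma neg_exp_add: "neg_exp (I + J) = neg_exp I * neg_exp J"
  by (auto simp: neg_exp_def enn2real_plus exp_add[symmetric] less_top)

lemma neg_exp_measurable: "neg_exp \<in> borel_measurable borel"
  unfolding neg_exp_def by measurable

lemma path_V_measurable:
  fixes V :: "real^'n \<Rightarrow> real"
  assumes "V \<in> borel_measurable borel" "\<omega> \<in> paths"
  shows "(\<lambda>s. ennreal (V (\<omega> s))) \<in> borel_measurable borel"
  using measurable_compose[OF borel_measurable_continuous_onI[OF pathsD(1)[OF assms(2)]] assms(1)] by measurable

text \<open>The time interval is cut at \<open>s\<close> and the second part is moved back to start
  at \<open>0\<close>. With an extended-real \<open>T\<close> the same identity serves finite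
  horizons and the total integral.\<close>

lemma time_integral_add:
  fixes V :: "real^'n \<Rightarrow> real"
  assumes V: "V \<in> borel_measurable borel" and w: "\<omega> \<in> paths" and s: "0 \<le> s" and T: "0 \<le> T"
  shows "time_integral V (ereal s + T) \<omega> = time_integral V (ereal s) \<omega> + time_integral V T (pshift s \<omega>)"
proof -
  note [measurable] = path_V_measurable[OF V w] path_V_measurable[OF V pshift_paths[OF w]]
  let ?f = "\<lambda>u. indicator {u. s \<le> u \<and> ereal u < ereal s + T} u * ennreal (V (\<omega> u))"
  have split: "indicator {u. 0 \<le> u \<and> ereal u < ereal s + T} u * ennreal (V (\<omega> u)) =
      indicator {u. 0 \<le> u \<and> ereal u < ereal s} u * ennreal (V (\<omega> u)) + ?f u" for u
  proof -
    have "ereal u < ereal s + T" if "u < s"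
    proof -
      have "ereal u < ereal s" using that by simp
      also have "\<dots> \<le> ereal s + T" using add_left_mono[OF T, of "ereal s"] by simp
      finally show ?thesis .
    qed
    then show ?thesis using s by (cases "u < s") (auto simp: indicator_def)
  qed
  have "(\<integral>\<^sup>+u. ?f u \<partial>lborel) = (\<integral>\<^sup>+u. ?f u \<partial>distr lborel borel ((+) s))"
    by (simp add: lborel_distr_plus)
  also have "\<dots> = (\<integral>\<^sup>+v. ?f (s + v) \<partial>lborel)"
    by (rule nn_integral_distr) auto
  also have "\<dots> = time_integral V T (pshift s \<omega>)"
    unfolding time_integral_def
  proof (rule nn_integral_cong)
    fix v :: real
    have "ereal (s + v) < ereal s + T \<longleftrightarrow> ereal v < T" by (cases T) auto
    then show "?f (s + v) = indicator {s. 0 \<le> s \<and> ereal s < T} v * ennreal (V (pshift s \<omega> v))"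
      by (auto simp: indicator_def pshift_def max_absorb1)
  qed
  finally have 1: "(\<integral>\<^sup>+u. ?f u \<partial>lborel) = time_integral V T (pshift s \<omega>)" .
  have "time_integral V (ereal s + T) \<omega> = (\<integral>\<^sup>+u. indicator {u. 0 \<le> u \<and> ereal u < ereal s} u * ennreal (V (\<omega> u)) + ?f u \<partial>lborel)"
    unfolding time_integral_def split ..
  also have "\<dots> = time_integral V (ereal s) \<omega> + (\<integral>\<^sup>+u. ?f u \<partial>lborel)"
    unfolding time_integral_def by (rule nn_integral_add) auto
  finally show ?thesis using 1 by simp
qed

lemma time_integral_measurable:
  fixes V :: "real^'n \<Rightarrow> real"
  assumes V: "V \<in> borel_measurable borel" and T: "T \<in> borel_measurable N" and W: "W \<in> measurable N pathM"
  shows "(\<lambda>x. time_integral V (T x) (W x)) \<in> borel_measurable N"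
  unfolding time_integral_def
proof (rule lborel.borel_measurable_nn_integral)
  have e: "(\<lambda>q. W (fst q) (snd q)) \<in> borel_measurable (N \<Otimes>\<^sub>M lborel)"
    by (rule measurable_eval[OF measurable_compose[OF measurable_fst W]]) measurable
  note [measurable] = measurable_compose[OF e V] measurable_compose[OF measurable_fst T]
  have "(\<lambda>q. indicator {q\<in>space (N \<Otimes>\<^sub>M lborel). 0 \<le> snd q \<and> ereal (snd q) < T (fst q)} q * ennreal (V (W (fst q) (snd q)))) \<in> borel_measurable (N \<Otimes>\<^sub>M lborel)"
    by (intro borel_measurable_times_ennreal borel_measurable_indicator) measurable
  then show "(\<lambda>(x, s). indicator {s. 0 \<le> s \<and> ereal s < T x} s * ennreal (V (W x s))) \<in> borel_measurable (N \<Otimes>\<^sub>M lborel)"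
    by (rule measurable_cong[THEN iffD1, rotated]) (auto simp: indicator_def)
qed

lemma exp_neg_int_measurable:
  fixes V :: "real^'n \<Rightarrow> real"
  assumes V: "V \<in> borel_measurable borel" and T: "T \<in> borel_measurable N" and W: "W \<in> measurable N pathM"
  shows "(\<lambda>x. exp_neg_int V (T x) (W x)) \<in> borel_measurable N"
  unfolding exp_neg_int_eq by (rule measurable_compose[OF time_integral_measurable[OF assms] neg_exp_measurable])

text \<open>Additivity of the time integral gives the two submultiplicative conditions with
  equality; agreement up to \<open>t\<close> fixes the integrand on the time interval before
  \<open>t\<close>.\<close>

lemma killing_soft:
  fixes V :: "real^'n \<Rightarrow> real"
  assumes V: "V \<in> borel_measurable borel"
  shows "killing (\<lambda>t. exp_neg_int V (ereal t)) (exp_neg_int V \<infinity>)"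
  unfolding killing_def
proof (intro conjI ballI allI impI)
  show "(\<lambda>(t, \<omega>). exp_neg_int V (ereal t) \<omega>) \<in> borel_measurable (borel \<Otimes>\<^sub>M pathM)"
    unfolding case_prod_beta by (rule exp_neg_int_measurable[OF V _ measurable_snd]) measurable
  show "exp_neg_int V \<infinity> \<in> borel_measurable pathM"
    by (rule exp_neg_int_measurable[OF V]) auto
  fix \<omega> :: "real \<Rightarrow> real^'n" assume w: "\<omega> \<in> paths"
  show "exp_neg_int V (ereal (s + t)) \<omega> \<le> exp_neg_int V (ereal s) \<omega> * exp_neg_int V (ereal t) (pshift s \<omega>)" if "0 \<le> s" "0 \<le> t" for s t
    using time_integral_add[OF V w that(1), of "ereal t"] that by (simp add: exp_neg_int_eq neg_exp_add)
  show "exp_neg_int V \<infinity> \<omega> \<le> exp_neg_int V (ereal s) \<omega> * exp_neg_int V \<infinity> (pshift s \<omega>)" if "0 \<le> s" for s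
    using time_integral_add[OF V w that(1), of \<infinity>] that by (simp add: exp_neg_int_eq neg_exp_add)
  fix \<omega>' :: "real \<Rightarrow> real^'n" and t :: real assume a: "agree t \<omega> \<omega>'"
  have "time_integral V (ereal t) \<omega> = time_integral V (ereal t) \<omega>'"
    unfolding time_integral_def by (rule nn_integral_cong) (use a in \<open>auto simp: indicator_def agree_def\<close>)
  then show "exp_neg_int V (ereal t) \<omega> = exp_neg_int V (ereal t) \<omega>'" by (simp add: exp_neg_int_eq)
qed (auto simp: exp_neg_int_eq neg_exp_bounds)

lemma tau_measurable: "tau r \<in> borel_measurable pathM"
proof (rule measurable_cong[THEN iffD2, OF tau_eq])
  have "(\<lambda>\<omega>. ereal (exit_time r \<omega>)) \<in> borel_measurable pathM" using exit_time_measurable by measurable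
  then show "(\<lambda>\<omega>. if \<omega> \<in> exits r then ereal (exit_time r \<omega>) else \<infinity>) \<in> borel_measurable pathM"
    by (rule measurable_If_set[OF _ _ sets.Int[OF exits_measurable sets.top]]) auto
qed simp

lemma trap_soft:
  fixes P :: "real^'n \<Rightarrow> (real \<Rightarrow> real^'n) measure"
  assumes P: "is_wiener P" and V: "V \<in> Vcls P U \<epsilon> \<eta>"
  shows "trap P (\<lambda>t. exp_neg_int V (ereal t)) U \<epsilon> \<eta>"
  unfolding trap_def
proof
  fix y assume y: "y \<in> frontier U"
  have Vm: "V \<in> borel_measurable borel" using V by (simp add: Vcls_def)
  have "(\<integral>\<omega>. exp_neg_int V (ereal (exit_time \<epsilon> \<omega>)) \<omega> \<partial>P y) \<le> (\<integral>\<omega>. exp_neg_int V (tau \<epsilon> \<omega>) \<omega> \<partial>P y)"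
  proof (rule wiener_integral_mono[OF P, where B=1 and B'=1])
    show "(\<lambda>\<omega>. exp_neg_int V (ereal (exit_time \<epsilon> \<omega>)) \<omega>) \<in> borel_measurable pathM"
      by (rule exp_neg_int_measurable[OF Vm]) (use exit_time_measurable in measurable)
    show "(\<lambda>\<omega>. exp_neg_int V (tau \<epsilon> \<omega>) \<omega>) \<in> borel_measurable pathM"
      by (rule exp_neg_int_measurable[OF Vm tau_measurable]) simp
    show "AE \<omega> in P y. exp_neg_int V (ereal (exit_time \<epsilon> \<omega>)) \<omega> \<le> exp_neg_int V (tau \<epsilon> \<omega>) \<omega>"
      using wiener_AE_exits[OF P, of \<epsilon> y] by eventually_elim (simp add: tau_eq exits_iff[THEN iffD1, THEN conjunct1])
  qed (auto simp: exp_neg_int_eq neg_exp_bounds)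
  also have "\<dots> \<le> 1 - \<eta>" using V y by (simp add: Vcls_def)
  finally show "(\<integral>\<omega>. exp_neg_int V (ereal (exit_time \<epsilon> \<omega>)) \<omega> \<partial>P y) \<le> 1 - \<eta>" .
qed

section \<open>Translations\<close>

lemma translate_measurable: "(\<lambda>\<omega> s. a + \<omega> s) \<in> measurable pathM (pathM :: (real \<Rightarrow> real^'n) measure)"
  by (rule plus_measurable) auto

lemma wiener_translate_measure:
  fixes P :: "real^'n \<Rightarrow> (real \<Rightarrow> real^'n) measure"
  assumes P: "is_wiener P" and B: "B \<in> sets pathM" and eq: "\<And>\<omega>. \<omega> \<in> paths \<Longrightarrow> (\<lambda>s. a + \<omega> s) \<in> B \<longleftrightarrow> \<omega> \<in> C" and C: "C \<subseteq> paths"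
  shows "measure (P (a + y)) B = measure (P y) C"
proof -
  have m: "(\<lambda>\<omega> s. ((a + y) - y) + \<omega> s) \<in> measurable (P y) pathM"
    unfolding wiener_measurable_sets[OF P] by (rule translate_measurable)
  have "(\<lambda>\<omega> s. ((a + y) - y) + \<omega> s) -` B \<inter> space (P y) = C"
    using eq C by (auto simp: is_wienerD(3)[OF P])
  then show ?thesis unfolding wiener_translate[OF P, of "a + y" y] using B by (subst measure_distr[OF m]) auto
qed

lemma wiener_translate_integral:
  fixes P :: "real^'n \<Rightarrow> (real \<Rightarrow> real^'n) measure"
  assumes P: "is_wiener P" and f: "f \<in> borel_measurable pathM" and eq: "\<And>\<omega>. \<omega> \<in> paths \<Longrightarrow> f (\<lambda>s. a + \<omega> s) = (g \<omega> :: real)"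
  shows "(\<integral>\<omega>. f \<omega> \<partial>P (a + y)) = (\<integral>\<omega>. g \<omega> \<partial>P y)"
proof -
  have m: "(\<lambda>\<omega> s. ((a + y) - y) + \<omega> s) \<in> measurable (P y) pathM"
    unfolding wiener_measurable_sets[OF P] by (rule translate_measurable)
  have "(\<integral>\<omega>. f \<omega> \<partial>P (a + y)) = (\<integral>\<omega>. f (\<lambda>s. ((a + y) - y) + \<omega> s) \<partial>P y)"
    unfolding wiener_translate[OF P, of "a + y" y] by (rule integral_distr[OF m]) (use f in simp)
  also have "\<dots> = (\<integral>\<omega>. g \<omega> \<partial>P y)"
    by (rule Bochner_Integration.integral_cong) (use eq in \<open>auto simp: is_wienerD(3)[OF P]\<close>)
  finally show ?thesis .
qed

lemma translate_borel:
  fixes U :: "(real^'n) set"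
  assumes "U \<in> sets borel" shows "(+) a ` U \<in> sets borel"
proof -
  have "(\<lambda>z. - a + z) \<in> borel_measurable borel" by measurable
  from measurable_sets[OF this assms] have "(\<lambda>z. - a + z) -` U \<in> sets borel" by simp
  also have "(\<lambda>z. - a + z) -` U = (+) a ` U" by (auto simp: image_iff algebra_simps intro!: exI bexI[of _ "_ - a"])
  finally show ?thesis .
qed

lemma outer_density_translate:
  fixes U :: "(real^'n) set"
  assumes U: "U \<in> sets borel"
  shows "outer_density ((+) a ` U) r (a + x) = outer_density U r x"
proof -
  have U': "(+) a ` U \<in> sets borel" by (rule translate_borel[OF U])
  have "emeasure lborel (sball (a + x) r \<inter> - (+) a ` U) = emeasure (distr lborel borel ((+) a)) (sball (a + x) r \<inter> - (+) a ` U)"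
    by (simp add: lborel_distr_plus)
  also have "\<dots> = emeasure lborel ((+) a -` (sball (a + x) r \<inter> - (+) a ` U))"
    using U' by (subst emeasure_distr) auto
  also have "(+) a -` (sball (a + x) r \<inter> - (+) a ` U) = sball x r \<inter> - U"
    by (auto simp: sball_def)
  finally show ?thesis by (simp add: outer_density_def measure_def)
qed

lemma Ucls_translate:
  assumes "U \<in> Ucls l A" "x \<in> A"
  shows "(+) (- x) ` U \<in> Ucls l {0}"
proof -
  have U: "U \<in> sets borel" "U \<noteq> {}" "bounded U" using assms by (auto simp: Ucls_def)
  have U': "(+) (- x) ` U \<in> sets borel" by (rule translate_borel[OF U(1)])
  have "sigma_hat ((+) (- x) ` U) k 0 = sigma_hat U k x" for k
    unfolding sigma_hat_eq_outer_density[OF U(1)] sigma_hat_eq_outer_density[OF U'] using outer_density_translate[OF U(1), of "- x" _ x] by simp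
  moreover have "bounded ((+) (- x) ` U)" by (rule bounded_translation[OF U(3)])
  moreover have "(+) (- x) ` U \<noteq> {}" using U(2) by simp
  ultimately show ?thesis using assms U' by (simp add: Ucls_def)
qed

lemma hit_translate: "hit ((+) a ` F) (\<lambda>s. a + \<omega> s) = hit F \<omega>"
  by (simp add: hit_def image_iff)

lemma tau_translate: "tau r (\<lambda>s. a + \<omega> s) = tau r \<omega>"
  by (simp add: tau_def)

lemma Scls_translate:
  fixes P :: "real^'n \<Rightarrow> (real \<Rightarrow> real^'n) measure"
  assumes P: "is_wiener P" and S: "\<Sigma> \<in> Scls P U \<epsilon> \<eta>"
  shows "(+) a ` \<Sigma> \<in> Scls P ((+) a ` U) \<epsilon> \<eta>"
proof -
  have c: "compact \<Sigma>" using S by (simp add: Scls_def)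
  then have c': "compact ((+) a ` \<Sigma>)" by (rule compact_translation)
  have "\<eta> \<le> measure (P y') {\<omega>\<in>space (P y'). hit ((+) a ` \<Sigma>) \<omega> < tau \<epsilon> \<omega>}" if "y' \<in> frontier ((+) a ` U)" for y'
  proof -
    from that obtain y where y: "y' = a + y" "y \<in> frontier U" by (auto simp: frontier_translation)
    have "measure (P (a + y)) {\<omega>\<in>paths. hit ((+) a ` \<Sigma>) \<omega> < tau \<epsilon> \<omega>} = measure (P y) {\<omega>\<in>paths. hit \<Sigma> \<omega> < tau \<epsilon> \<omega>}"
      by (rule wiener_translate_measure[OF P hit_less_tau_measurable[OF compact_imp_closed[OF c']]])
         (auto simp: hit_translate tau_translate plus_paths)
    then show ?thesis using S y by (simp add: Scls_def is_wienerD(3)[OF P])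
  qed
  then show ?thesis using c' by (simp add: Scls_def)
qed

lemma exp_neg_int_translate: "exp_neg_int (\<lambda>z. V (- a + z)) T (\<lambda>s. a + \<omega> s) = exp_neg_int V T \<omega>"
  by (simp add: exp_neg_int_def)

lemma Vcls_translate:
  fixes P :: "real^'n \<Rightarrow> (real \<Rightarrow> real^'n) measure"
  assumes P: "is_wiener P" and V: "V \<in> Vcls P U \<epsilon> \<eta>"
  shows "(\<lambda>z. V (- a + z)) \<in> Vcls P ((+) a ` U) \<epsilon> \<eta>"
proof -
  let ?V = "\<lambda>z. V (- a + z)"
  have Vm: "V \<in> borel_measurable borel" using V by (simp add: Vcls_def)
  have Vm': "?V \<in> borel_measurable borel" by (rule measurable_compose[OF _ Vm]) measurable
  have "locally_bounded ?V"
    unfolding locally_bounded_def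
  proof (intro allI impI)
    fix K :: "(real^'n) set" assume "compact K"
    then have "compact ((+) (- a) ` K)" by (rule compact_translation)
    then have "bounded (V ` ((+) (- a) ` K))" using V by (simp add: Vcls_def locally_bounded_def)
    then show "bounded (?V ` K)" by (simp only: image_image)
  qed
  moreover have "(\<integral>\<omega>. exp_neg_int ?V (tau \<epsilon> \<omega>) \<omega> \<partial>P y') \<le> 1 - \<eta>" if "y' \<in> frontier ((+) a ` U)" for y'
  proof -
    from that obtain y where y: "y' = a + y" "y \<in> frontier U" by (auto simp: frontier_translation)
    have "(\<integral>\<omega>. exp_neg_int ?V (tau \<epsilon> \<omega>) \<omega> \<partial>P (a + y)) = (\<integral>\<omega>. exp_neg_int V (tau \<epsilon> \<omega>) \<omega> \<partial>P y)"
    proof (rule wiener_translate_integral[OF P exp_neg_int_measurable[OF Vm' tau_measurable]])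
      show "exp_neg_int ?V (tau \<epsilon> (\<lambda>s. a + \<omega> s)) (\<lambda>s. a + \<omega> s) = exp_neg_int V (tau \<epsilon> \<omega>) \<omega>" for \<omega>
        unfolding tau_translate by (rule exp_neg_int_translate)
    qed simp
    then show ?thesis using V y by (simp add: Vcls_def)
  qed
  ultimately show ?thesis using V Vm' by (simp add: Vcls_def)
qed

text \<open>Moving set, obstacle and starting point by \<open>- x\<close> keeps
  \<open>\<epsilon>\<close> and the scale and does not change the probability. The result competes
  in the supremum for \<open>{0}\<close>, where the density condition is imposed at one point
  only.\<close>

lemma hard_sup_le_origin:
  fixes P :: "real^'n \<Rightarrow> (real \<Rightarrow> real^'n) measure"
  assumes P: "is_wiener P"
  shows "hard_sup P \<eta> A u \<le> hard_sup P \<eta> {0} u"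
  unfolding hard_sup_def
proof (rule SUP_least, clarify)
  fix l \<epsilon> U \<Sigma> x
  assume a: "0 < \<epsilon>" "\<epsilon> \<le> u * 2 powr - real l" "U \<in> Ucls l A" "\<Sigma> \<in> Scls P U \<epsilon> \<eta>" "x \<in> A"
  let ?U = "(+) (- x) ` U" and ?S = "(+) (- x) ` \<Sigma>"
  have c: "compact \<Sigma>" using a(4) by (simp add: Scls_def)
  then have F: "closed ?S" by (intro compact_imp_closed compact_translation)
  let ?B = "{\<omega>\<in>paths. hit ?S \<omega> = \<infinity>}"
  have B: "?B \<in> sets pathM" by (rule hit_infinite_measurable[OF F])
  have "measure (P (- x + x)) ?B = measure (P x) {\<omega>\<in>paths. hit \<Sigma> \<omega> = \<infinity>}"
  proof (rule wiener_translate_measure[OF P B])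
    show "(\<lambda>s. - x + \<omega> s) \<in> ?B \<longleftrightarrow> \<omega> \<in> {\<omega>\<in>paths. hit \<Sigma> \<omega> = \<infinity>}" if "\<omega> \<in> paths" for \<omega>
      using that plus_paths[OF that, of "- x"] by (simp only: mem_Collect_eq hit_translate)
  qed blast
  then have e: "measure (P x) {\<omega>\<in>space (P x). hit \<Sigma> \<omega> = \<infinity>} = measure (P 0) {\<omega>\<in>space (P 0). hit ?S \<omega> = \<infinity>}"
    by (simp add: is_wienerD(3)[OF P])
  have i: "(l, \<epsilon>, ?U, ?S, 0) \<in> {(lstar, \<epsilon>, U0, \<Sigma>, x). 0 < \<epsilon> \<and> \<epsilon> \<le> u * 2 powr (- real lstar) \<and>
         U0 \<in> Ucls lstar {0} \<and> \<Sigma> \<in> Scls P U0 \<epsilon> \<eta> \<and> x \<in> {0}}"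
    using a(1,2) Ucls_translate[OF a(3,5)] Scls_translate[OF P a(4), of "- x"] by simp
  show "ereal (measure (P x) {\<omega>\<in>space (P x). hit \<Sigma> \<omega> = \<infinity>}) \<le>
    (SUP (lstar, \<epsilon>, U0, \<Sigma>, x) \<in> {(lstar, \<epsilon>, U0, \<Sigma>, x). 0 < \<epsilon> \<and> \<epsilon> \<le> u * 2 powr (- real lstar) \<and>
         U0 \<in> Ucls lstar {0} \<and> \<Sigma> \<in> Scls P U0 \<epsilon> \<eta> \<and> x \<in> {0}}. ereal (measure (P x) {\<omega>\<in>space (P x). hit \<Sigma> \<omega> = \<infinity>}))"
    by (rule SUP_upper2[OF i]) (simp add: e)
qed

lemma soft_sup_le_origin:
  fixes P :: "real^'n \<Rightarrow> (real \<Rightarrow> real^'n) measure"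
  assumes P: "is_wiener P"
  shows "soft_sup P \<eta> A u \<le> soft_sup P \<eta> {0} u"
  unfolding soft_sup_def
proof (rule SUP_least, clarify)
  fix l \<epsilon> U V x
  assume a: "0 < \<epsilon>" "\<epsilon> \<le> u * 2 powr - real l" "U \<in> Ucls l A" "V \<in> Vcls P U \<epsilon> \<eta>" "x \<in> A"
  \<comment> \<open>The double minus is left in place to match the form of
    \<open>Vcls_translate\<close> for translation by \<open>- x\<close>.\<close>
  let ?U = "(+) (- x) ` U" and ?V = "\<lambda>z. V (- (- x) + z)"
  have V': "?V \<in> Vcls P ?U \<epsilon> \<eta>" by (rule Vcls_translate[OF P a(4)])
  then have Vm: "?V \<in> borel_measurable borel" by (simp add: Vcls_def)
  have "(\<integral>\<omega>. exp_neg_int ?V \<infinity> \<omega> \<partial>P (- x + x)) = (\<integral>\<omega>. exp_neg_int V \<infinity> \<omega> \<partial>P x)"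
  proof (rule wiener_translate_integral[OF P])
    show "exp_neg_int ?V \<infinity> \<in> borel_measurable pathM" by (rule exp_neg_int_measurable[OF Vm]) auto
  qed (rule exp_neg_int_translate)
  then have e: "(\<integral>\<omega>. exp_neg_int V \<infinity> \<omega> \<partial>P x) = (\<integral>\<omega>. exp_neg_int ?V \<infinity> \<omega> \<partial>P 0)" by simp
  have i: "(l, \<epsilon>, ?U, ?V, 0) \<in> {(lstar, \<epsilon>, U0, V, x). 0 < \<epsilon> \<and> \<epsilon> \<le> u * 2 powr (- real lstar) \<and>
         U0 \<in> Ucls lstar {0} \<and> V \<in> Vcls P U0 \<epsilon> \<eta> \<and> x \<in> {0}}"
    using a(1,2) Ucls_translate[OF a(3,5)] V' by simp
  show "ereal (\<integral>\<omega>. exp_neg_int V \<infinity> \<omega> \<partial>P x) \<le>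
    (SUP (lstar, \<epsilon>, U0, V, x) \<in> {(lstar, \<epsilon>, U0, V, x). 0 < \<epsilon> \<and> \<epsilon> \<le> u * 2 powr (- real lstar) \<and>
         U0 \<in> Ucls lstar {0} \<and> V \<in> Vcls P U0 \<epsilon> \<eta> \<and> x \<in> {0}}. ereal (\<integral>\<omega>. exp_neg_int V \<infinity> \<omega> \<partial>P x))"
    by (rule SUP_upper2[OF i]) (simp add: e)
qed

section \<open>The limits\<close>

text \<open>The scales are \<open>2 powr (- (l + q * j))\<close> for \<open>j < J\<close>. All are
  at most \<open>2 powr (- l)\<close>, where the density condition holds; neighbours differ by
  \<open>2 ^ q > L\<close>; and \<open>u \<le> 2 powr (- (q * J))\<close> puts
  \<open>\<epsilon>\<close> below all of them.\<close>

lemma Ucls_bound: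
  fixes P :: "real^'n \<Rightarrow> (real \<Rightarrow> real^'n) measure"
  assumes P: "is_wiener P" and \<eta>: "0 < \<eta>" "\<eta> < 1" and \<delta>: "0 < \<delta>"
  obtains u0 where "0 < u0"
    "\<And>K Kinf U l A \<epsilon> u x. killing K Kinf \<Longrightarrow> trap P K U \<epsilon> \<eta> \<Longrightarrow> U \<in> Ucls l A \<Longrightarrow> 0 < \<epsilon> \<Longrightarrow>
       \<epsilon> \<le> u * 2 powr (- real l) \<Longrightarrow> u \<le> u0 \<Longrightarrow> x \<in> A \<Longrightarrow> (\<integral>\<omega>. Kinf \<omega> \<partial>P x) \<le> \<delta>"
proof (rule solidification[OF P \<eta> \<delta>])
  fix J :: nat and L :: real
  assume L: "1 \<le> L" and
    main: "\<And>K Kinf U \<epsilon> R x. killing K Kinf \<Longrightarrow> trap P K U \<epsilon> \<eta> \<Longrightarrow> U \<in> sets borel \<Longrightarrow> bounded U \<Longrightarrow> 0 < \<epsilon> \<Longrightarrow>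
       finite R \<Longrightarrow> J \<le> card R \<Longrightarrow> (\<And>r. r \<in> R \<Longrightarrow> \<epsilon> \<le> r \<and> outer_density U r x \<le> 1/2) \<Longrightarrow>
       (\<And>r r'. r \<in> R \<Longrightarrow> r' \<in> R \<Longrightarrow> r < r' \<Longrightarrow> L * r \<le> r') \<Longrightarrow> (\<integral>\<omega>. Kinf \<omega> \<partial>P x) \<le> \<delta>"
  obtain q :: nat where q: "L < 2 ^ q" using real_arch_pow[of 2 L] by auto
  have q0: "0 < q" using q L by (cases q) auto
  show ?thesis
  proof (rule that[of "2 powr (- real (q * J))"])
    fix K Kinf U l A \<epsilon> u x
    assume k: "killing K Kinf" and tr: "trap P K U \<epsilon> \<eta>" and U: "U \<in> Ucls l A" and \<epsilon>: "0 < \<epsilon>" "\<epsilon> \<le> u * 2 powr (- real l)"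
      and u: "u \<le> 2 powr (- real (q * J))" and x: "x \<in> A"
    define f where "f j = 2 powr (- real (l + q * j))" for j :: nat
    have f_less: "f i < f j \<longleftrightarrow> j < i" for i j using q0 by (simp add: f_def)
    have inj: "inj_on f {..<J}"
    proof (rule inj_onI)
      fix i j assume "f i = f j"
      then show "i = j" using f_less[of i j] f_less[of j i] by (cases i j rule: linorder_cases) auto
    qed
    have Ub: "U \<in> sets borel" "bounded U" using U by (auto simp: Ucls_def)
    show "(\<integral>\<omega>. Kinf \<omega> \<partial>P x) \<le> \<delta>"
    proof (rule main[OF k tr Ub \<epsilon>(1)])
      show "finite (f ` {..<J})" by simp
      show "J \<le> card (f ` {..<J})" by (simp add: card_image[OF inj])
      fix r assume "r \<in> f ` {..<J}"
      then obtain j where j: "r = f j" "j < J" by auto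
      have "u * 2 powr (- real l) \<le> 2 powr (- real (q * J)) * 2 powr (- real l)" using u by (intro mult_right_mono) auto
      also have "\<dots> = 2 powr (- real (l + q * J))" by (simp add: powr_add[symmetric] algebra_simps)
      also have "\<dots> \<le> f j" unfolding f_def using j(2) by (intro powr_mono) (auto intro: mult_mono)
      finally have "\<epsilon> \<le> r" using \<epsilon>(2) j(1) by simp
      moreover have "outer_density U r x \<le> 1/2"
      proof -
        have "sigma_hat U (int (l + q * j)) x \<le> 1/2" using U x by (auto simp: Ucls_def)
        then show ?thesis unfolding sigma_hat_eq_outer_density[OF Ub(1)] j(1) f_def by simp
      qed
      ultimately show "\<epsilon> \<le> r \<and> outer_density U r x \<le> 1/2" ..
    next
      fix r r' assume "r \<in> f ` {..<J}" "r' \<in> f ` {..<J}" "r < r'"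
      then obtain i j where ij: "r = f i" "r' = f j" "j < i" using f_less by auto
      have "L * f i \<le> 2 ^ q * f i" using q by (intro mult_right_mono) (auto simp: f_def)
      also have "\<dots> = 2 powr (real q - real (l + q * i))" by (simp add: f_def powr_realpow[symmetric] powr_add[symmetric] del: of_nat_add)
      also have "\<dots> \<le> f j"
      proof -
        have "q * Suc j \<le> q * i" using ij(3) by (intro mult_left_mono) auto
        then have "real (q * Suc j) \<le> real (q * i)" by (simp only: of_nat_le_iff)
        then show ?thesis unfolding f_def by (intro powr_mono) (auto simp: algebra_simps)
      qed
      finally show "L * r \<le> r'" using ij by simp
    qed
  qed simp
qed

lemma hard_soft_sup_le:
  fixes P :: "real^'n \<Rightarrow> (real \<Rightarrow> real^'n) measure"
  assumes P: "is_wiener P" and \<eta>: "0 < \<eta>" "\<eta> < 1" and \<delta>: "0 < \<delta>"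
  obtains u0 where "0 < u0" "\<And>u. u \<le> u0 \<Longrightarrow> hard_sup P \<eta> A u \<le> ereal \<delta>" "\<And>u. u \<le> u0 \<Longrightarrow> soft_sup P \<eta> A u \<le> ereal \<delta>"
proof (rule Ucls_bound[OF P \<eta> \<delta>])
  fix u0 :: real
  assume u0: "0 < u0"
    "\<And>K Kinf U l A \<epsilon> u x. killing K Kinf \<Longrightarrow> trap P K U \<epsilon> \<eta> \<Longrightarrow> U \<in> Ucls l A \<Longrightarrow> 0 < \<epsilon> \<Longrightarrow>
       \<epsilon> \<le> u * 2 powr (- real l) \<Longrightarrow> u \<le> u0 \<Longrightarrow> x \<in> A \<Longrightarrow> (\<integral>\<omega>. Kinf \<omega> \<partial>P x) \<le> \<delta>"
  show ?thesis
  proof (rule that[OF u0(1)])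
    fix u assume u: "u \<le> u0"
    show "hard_sup P \<eta> A u \<le> ereal \<delta>"
      unfolding hard_sup_def
    proof (rule SUP_least, clarify)
      fix l \<epsilon> U \<Sigma> x
      assume a: "0 < \<epsilon>" "\<epsilon> \<le> u * 2 powr - real l" "U \<in> Ucls l A" "\<Sigma> \<in> Scls P U \<epsilon> \<eta>" "x \<in> A"
      have F: "closed \<Sigma>" using a(4) by (auto simp: Scls_def intro: compact_imp_closed)
      have "(\<integral>\<omega>. hardKinf \<Sigma> \<omega> \<partial>P x) \<le> \<delta>"
        by (rule u0(2)[OF killing_hard[OF F] trap_hard[OF P a(4)] a(3,1,2) u a(5)])
      then show "ereal (measure (P x) {\<omega>\<in>space (P x). hit \<Sigma> \<omega> = \<infinity>}) \<le> ereal \<delta>"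
        unfolding measure_hit_infinite[OF P F] by simp
    qed
    show "soft_sup P \<eta> A u \<le> ereal \<delta>"
      unfolding soft_sup_def
    proof (rule SUP_least, clarify)
      fix l \<epsilon> U V x
      assume a: "0 < \<epsilon>" "\<epsilon> \<le> u * 2 powr - real l" "U \<in> Ucls l A" "V \<in> Vcls P U \<epsilon> \<eta>" "x \<in> A"
      have Vm: "V \<in> borel_measurable borel" using a(4) by (simp add: Vcls_def)
      have "(\<integral>\<omega>. exp_neg_int V \<infinity> \<omega> \<partial>P x) \<le> \<delta>"
        by (rule u0(2)[OF killing_soft[OF Vm] trap_soft[OF P a(4)] a(3,1,2) u a(5)])
      then show "ereal (\<integral>\<omega>. exp_neg_int V \<infinity> \<omega> \<partial>P x) \<le> ereal \<delta>" by simp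
    qed
  qed
qed

text \<open>In \<open>ereal\<close> a supremum over an empty family is \<open>-\<infinity>\<close>,
  so the lower bound \<open>0\<close> needs an admissible set. A large ball works: the radii with
  \<open>l \<ge> 0\<close> are at most \<open>1\<close>, hence the margin \<open>1\<close> in its
  radius.\<close>

lemma Ucls_sball:
  fixes A :: "(real^'n) set"
  assumes "bounded A"
  obtains M where "sball 0 M \<in> Ucls 0 A"
proof -
  obtain B where B: "0 < B" "\<And>x. x \<in> A \<Longrightarrow> norm x \<le> B" using assms by (auto simp: bounded_pos)
  let ?U = "sball 0 (B + 1) :: (real^'n) set"
  have "sigma_hat ?U l x \<le> 1/2" if "x \<in> A" "0 \<le> l" for x l
  proof -
    have r: "2 powr (- real_of_int l) \<le> 1" using that(2) by (simp add: powr_minus inverse_le_1_iff ge_one_powr_ge_zero)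
    have "supn (x - 0) \<le> B" using B(2)[OF that(1)] supn_le_norm[of x] by simp
    then have "sball x (2 powr (- real_of_int l)) \<subseteq> ?U" using r by (intro sball_subset) linarith
    then have "sball x (2 powr (- real_of_int l)) \<inter> - ?U = {}" by blast
    then show ?thesis unfolding sigma_hat_eq_outer_density[OF sball_borel] by (simp add: outer_density_def)
  qed
  moreover have "0 \<in> ?U" using B by (simp add: sball_def)
  moreover have "bounded ?U" unfolding sball_eq_cbox by (rule bounded_cbox)
  ultimately have "?U \<in> Ucls 0 A" unfolding Ucls_def by auto
  then show ?thesis by (rule that)
qed

text \<open>The ball itself serves as obstacle: from its boundary it is hit at time
  \<open>0\<close>, whereas the exit from the \<open>u\<close>-ball takes positive time.\<close>

lemma hard_sup_nonneg:
  fixes P :: "real^'n \<Rightarrow> (real \<Rightarrow> real^'n) measure"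
  assumes P: "is_wiener P" and \<eta>: "\<eta> < 1" and A: "A \<noteq> {}" "bounded A" and u: "0 < u"
  shows "0 \<le> hard_sup P \<eta> A u"
proof -
  obtain M where U: "sball 0 M \<in> Ucls 0 A" using Ucls_sball[OF A(2)] by blast
  let ?U = "sball 0 M :: (real^'n) set"
  obtain x where x: "x \<in> A" using A(1) by blast
  have c: "compact ?U" unfolding sball_eq_cbox by (rule compact_cbox)
  have "\<eta> \<le> measure (P y) {\<omega>\<in>space (P y). hit ?U \<omega> < tau u \<omega>}" if "y \<in> frontier ?U" for y
  proof -
    interpret prob_space "P y" by (rule is_wienerD(1)[OF P])
    have y: "y \<in> ?U" using that frontier_subset_closed[OF closed_sball] by blast
    have s: "{\<omega>\<in>space (P y). hit ?U \<omega> < tau u \<omega>} \<in> events"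
      using hit_less_tau_measurable[OF closed_sball] is_wienerD(2,3)[OF P] by simp
    have "AE \<omega> in P y. \<omega> \<in> {\<omega>\<in>space (P y). hit ?U \<omega> < tau u \<omega>}"
      using is_wienerD(4)[OF P, of y] AE_space
    proof eventually_elim
      case (elim \<omega>)
      have "hit ?U \<omega> \<le> ereal 0" unfolding hit_def by (rule Inf_lower) (use elim y in force)
      also have "\<dots> < tau u \<omega>" using tau_pos[OF u] elim(2) is_wienerD(3)[OF P] by (simp add: zero_ereal_def[symmetric])
      finally show ?case using elim(2) by blast
    qed
    then have "prob {\<omega>\<in>space (P y). hit ?U \<omega> < tau u \<omega>} = 1" using s by (subst prob_eq_1) auto
    then show ?thesis using \<eta> by simp
  qed
  then have S: "?U \<in> Scls P ?U u \<eta>" using c by (simp add: Scls_def)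
  have "(0, u, ?U, ?U, x) \<in> {(lstar, \<epsilon>, U0, \<Sigma>, x). 0 < \<epsilon> \<and> \<epsilon> \<le> u * 2 powr (- real lstar) \<and>
         U0 \<in> Ucls lstar A \<and> \<Sigma> \<in> Scls P U0 \<epsilon> \<eta> \<and> x \<in> A}"
    using u U S x by simp
  then show ?thesis unfolding hard_sup_def by (rule SUP_upper2) simp
qed

lemma time_integral_const: "0 \<le> c \<Longrightarrow> 0 \<le> t \<Longrightarrow> time_integral (\<lambda>_. c) (ereal t) \<omega> = ennreal (c * t)"
proof -
  assume c: "0 \<le> c" "0 \<le> t"
  have "time_integral (\<lambda>_. c) (ereal t) \<omega> = (\<integral>\<^sup>+ s. ennreal c * indicator {0..<t} s \<partial>lborel)"
    unfolding time_integral_def by (rule nn_integral_cong) (auto simp: indicator_def)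
  also have "\<dots> = ennreal c * ennreal t" using c by (subst nn_integral_cmult) auto
  finally show ?thesis using c by (simp add: ennreal_mult)
qed

text \<open>A large constant potential is admissible: its weight at the exit time is
  \<open>exp (- n * \<tau>)\<close> with \<open>\<tau> > 0\<close>, which tends to \<open>0\<close>
  in the mean as \<open>n\<close> grows.\<close>

lemma soft_sup_nonneg:
  fixes P :: "real^'n \<Rightarrow> (real \<Rightarrow> real^'n) measure"
  assumes P: "is_wiener P" and \<eta>: "\<eta> < 1" and A: "A \<noteq> {}" "bounded A" and u: "0 < u"
  shows "0 \<le> soft_sup P \<eta> A u"
proof -
  obtain M where U: "sball 0 M \<in> Ucls 0 A" using Ucls_sball[OF A(2)] by blast
  let ?U = "sball 0 M :: (real^'n) set"
  obtain x where x: "x \<in> A" using A(1) by blast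
  interpret P0: prob_space "P 0" by (rule is_wienerD(1)[OF P])
  let ?V = "\<lambda>n::nat. \<lambda>_::real^'n. real n"
  have Vm: "?V n \<in> borel_measurable borel" for n by simp
  have fm: "(\<lambda>\<omega>. exp_neg_int (?V n) (tau u \<omega>) \<omega>) \<in> borel_measurable pathM" for n
    by (rule exp_neg_int_measurable[OF Vm tau_measurable]) simp
  have "(\<lambda>n. \<integral>\<omega>. exp_neg_int (?V n) (tau u \<omega>) \<omega> \<partial>P 0) \<longlonglongrightarrow> (\<integral>\<omega>. 0 \<partial>P 0)"
  proof (rule integral_dominated_convergence[where w="\<lambda>_. 1"])
    show "(\<lambda>\<omega>. exp_neg_int (?V n) (tau u \<omega>) \<omega>) \<in> borel_measurable (P 0)" for n
      using fm by (simp add: wiener_measurable_sets[OF P])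
    show "AE \<omega> in P 0. (\<lambda>n. exp_neg_int (?V n) (tau u \<omega>) \<omega>) \<longlonglongrightarrow> 0"
      using wiener_AE_exits[OF P, of u 0]
    proof eventually_elim
      case (elim \<omega>)
      then have w: "\<omega> \<in> paths" by (simp add: exits_iff)
      let ?t = "exit_time u \<omega>"
      have t: "0 < ?t" using tau_pos[OF u w] elim by (simp add: tau_eq[OF w])
      have "exp_neg_int (?V n) (tau u \<omega>) \<omega> = exp (- ?t) ^ n" for n
        using t elim by (simp add: tau_eq[OF w] exp_neg_int_eq time_integral_const neg_exp_def exp_of_nat_mult[symmetric])
      moreover have "(\<lambda>n. exp (- ?t) ^ n) \<longlonglongrightarrow> 0" by (rule LIMSEQ_realpow_zero) (use t in auto)
      ultimately show ?case by simp
    qed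
  qed (auto simp: exp_neg_int_eq neg_exp_bounds)
  then have "\<forall>\<^sub>F n in sequentially. (\<integral>\<omega>. exp_neg_int (?V n) (tau u \<omega>) \<omega> \<partial>P 0) < 1 - \<eta>"
    using \<eta> by (intro order_tendstoD) auto
  then obtain n where n: "(\<integral>\<omega>. exp_neg_int (?V n) (tau u \<omega>) \<omega> \<partial>P 0) < 1 - \<eta>"
    by (auto simp: eventually_sequentially)
  \<comment> \<open>A constant potential and the exit time do not see the starting point, so the
    \<open>n\<close> found at the origin works at every boundary point.\<close>
  have tr: "(\<integral>\<omega>. exp_neg_int (?V n) (tau u \<omega>) \<omega> \<partial>P (y + 0)) = (\<integral>\<omega>. exp_neg_int (?V n) (tau u \<omega>) \<omega> \<partial>P 0)" for y
    by (rule wiener_translate_integral[OF P fm]) (simp add: tau_translate exp_neg_int_def)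
  have "(\<integral>\<omega>. exp_neg_int (?V n) (tau u \<omega>) \<omega> \<partial>P y) \<le> 1 - \<eta>" for y
    using tr[of y] n unfolding add_0_right by linarith
  then have V: "?V n \<in> Vcls P ?U u \<eta>"
    by (auto simp: Vcls_def locally_bounded_def intro: bounded_subset[of "{real n}"])
  have "(0, u, ?U, ?V n, x) \<in> {(lstar, \<epsilon>, U0, V, x). 0 < \<epsilon> \<and> \<epsilon> \<le> u * 2 powr (- real lstar) \<and>
         U0 \<in> Ucls lstar A \<and> V \<in> Vcls P U0 \<epsilon> \<eta> \<and> x \<in> A}"
    using u U V x by simp
  then show ?thesis unfolding soft_sup_def
    by (rule SUP_upper2) (auto intro!: integral_nonneg_AE AE_I2 simp: exp_neg_int_eq neg_exp_bounds)
qed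

lemma ereal_tendsto_zeroI:
  fixes f :: "real \<Rightarrow> ereal"
  assumes "\<And>u. 0 < u \<Longrightarrow> 0 \<le> f u" and le: "\<And>\<delta>. 0 < \<delta> \<Longrightarrow> \<exists>u0>0. \<forall>u\<le>u0. f u \<le> ereal \<delta>"
  shows "(f \<longlongrightarrow> 0) (at_right 0)"
proof (rule order_tendstoI)
  fix a :: ereal assume "a < 0"
  then have "a < f u" if "0 < u" for u using assms(1)[OF that] by (rule less_le_trans)
  then show "\<forall>\<^sub>F u in at_right 0. a < f u"
    unfolding eventually_at_right_field by (intro exI[of _ 1]) simp
next
  fix a :: ereal assume "0 < a"
  then obtain \<delta> where \<delta>: "0 < ereal \<delta>" "ereal \<delta> < a" using ereal_dense2 by blast
  then obtain u0 where u0: "u0 > 0" "\<forall>u\<le>u0. f u \<le> ereal \<delta>" using le[of \<delta>] by auto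
  have "f u < a" if "u < u0" for u
  proof -
    have "f u \<le> ereal \<delta>" using u0(2) that by simp
    then show ?thesis using \<delta>(2) by (rule le_less_trans)
  qed
  then show "\<forall>\<^sub>F u in at_right 0. f u < a"
    unfolding eventually_at_right_field using u0(1) by (intro exI[of _ u0]) simp
qed

theorem theorem3p1:
  fixes P :: "real^'n \<Rightarrow> (real \<Rightarrow> real^'n) measure"
    and A :: "(real^'n) set" and \<eta> :: real
  assumes "CARD('n) \<ge> 3"
    and "is_wiener P"
    and "A \<noteq> {}" and "compact A"
    and "0 < \<eta>" and "\<eta> < 1"
  shows "(hard_sup P \<eta> A \<longlongrightarrow> 0) (at_right 0)
       \<and> (\<forall>A'. A' \<noteq> {} \<and> compact A' \<longrightarrow> (\<forall>u. hard_sup P \<eta> A' u \<le> hard_sup P \<eta> {0} u))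
       \<and> (soft_sup P \<eta> A \<longlongrightarrow> 0) (at_right 0)
       \<and> (\<forall>A'. A' \<noteq> {} \<and> compact A' \<longrightarrow> (\<forall>u. soft_sup P \<eta> A' u \<le> soft_sup P \<eta> {0} u))"
proof -
  note P = assms(2) and \<eta> = assms(5,6) and A = assms(3) compact_imp_bounded[OF assms(4)]
  have "\<exists>u0>0. \<forall>u\<le>u0. hard_sup P \<eta> A u \<le> ereal \<delta>" if "0 < \<delta>" for \<delta>
    by (rule hard_soft_sup_le[OF P \<eta> that]) (intro exI conjI allI impI; assumption | blast)
  then have "(hard_sup P \<eta> A \<longlongrightarrow> 0) (at_right 0)"
    by (intro ereal_tendsto_zeroI hard_sup_nonneg[OF P \<eta>(2) A])
  moreover have "\<exists>u0>0. \<forall>u\<le>u0. soft_sup P \<eta> A u \<le> ereal \<delta>" if "0 < \<delta>" for \<delta>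
    by (rule hard_soft_sup_le[OF P \<eta> that]) (intro exI conjI allI impI; assumption | blast)
  then have "(soft_sup P \<eta> A \<longlongrightarrow> 0) (at_right 0)"
    by (intro ereal_tendsto_zeroI soft_sup_nonneg[OF P \<eta>(2) A])
  ultimately show ?thesis using hard_sup_le_origin[OF P] soft_sup_le_origin[OF P] by blast
qed

end
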